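(* Let $D=\mathrm{diag}(d_1,\dots,d_r)\in \mathcal{M}_r(\mathbb{C})$ be an invertible diagonal matrix, write $d_j=e^{i\theta_j}|d_j|$ with $\theta_j\in[0,2\pi)$, and let $\lambda\in(0,1)$. The $\lambda$-Aluthge transform restricts to a $C^\infty$ map $\Delta_\lambda:\mathcal{S}(D)\to\mathcal{S}(D)$, and for every $N\in\mathcal{U}(D)$ there exists a (real) subspace $\mathcal{E}^s_{N,\lambda}$ of the tangent space $T_N\mathcal{S}(D)$ such that: 1. $T_N\mathcal{S}(D)=\mathcal{E}^s_{N,\lambda}\oplus T_N\,\mathcal{U}(D)$; 2. both $\mathcal{E}^s_{N,\lambda}$ and $T_N\,\mathcal{U}(D)$ are invariant under the derivative $T_N\Delta_\lambda$ of $\Delta_\lambda$ at $N$; 3. $\big\|\,T_N\Delta_\lambda|_{\mathcal{E}^s_{N,\lambda}}\big\|\le k_{D,\lambda}<1$, where $$k_{D,\lambda}=\max\left\{\max_{|d_i|\ne|d_j|}\frac{|d_j|^{1-\lambda}|d_i|^{\lambda}+|d_i|^{1-\lambda}|d_j|^{\lambda}}{|d_i|+|d_j|},\ \max_{\theta_i\ne\theta_j}\big|\lambda\big(e^{i(\theta_j-\theta_i)}-1\big)+1\big|\right\};$$ 4. if $U\in\mathcal{U}(r)$ satisfies $N=UDU^*$, then $\mathcal{E}^s_{N,\lambda}=U\,\mathcal{E}^s_{D,\lambda}\,U^*$. In particular, the map $\mathcal{U}(D)\ni N\mapsto\mathcal{E}^s_{N,\lambda}$ is smooth, in the sense that the projections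 $P_{N,\lambda}$ of $T_N\mathcal{S}(D)$ onto $\mathcal{E}^s_{N,\lambda}$ parallel to $T_N\,\mathcal{U}(D)$ depend smoothly on $N\in\mathcal{U}(D)$.
   Context: $\mathcal{M}_r(\mathbb{C})$ is the space of complex $r\times r$ matrices, regarded as a real Hilbert space with inner product $\langle A,B\rangle=\mathrm{Re}\,\mathrm{tr}(B^*A)$ (Frobenius norm $\|\cdot\|_2$); operator norms on tangent spaces are taken with respect to this norm. $\mathcal{U}(r)$ is the unitary group. For $T\in\mathcal{M}_r(\mathbb{C})$ with polar decomposition $T=U|T|$, $|T|=(T^*T)^{1/2}$, and $\lambda\in(0,1)$, the $\lambda$-Aluthge transform is $\Delta_\lambda(T)=|T|^{\lambda}U|T|^{1-\lambda}$; for invertible $T$, $\Delta_\lambda(T)=|T|^\lambda T|T|^{-\lambda}$. The similarity orbit of $D$ is $\mathcal{S}(D)=\{SDS^{-1}: S\in \mathcal{M}_r(\mathbb{C})\text{ invertible}\}$, a $C^\infty$ submanifold of $\mathcal{M}_r(\mathbb{C})$; the unitary orbit is $\mathcal{U}(D)=\{UDU^*:U\in\mathcal{U}(r)\}$, a compact submanifold of $\mathcal{S}(D)$. For $N\in\mathcal{U}(D)$, $T_N\mathcal{S}(D)=\{AN-NA:A\in\mathcal{M}_r(\mathbb{C})\}$ and $T_N\,\mathcal{U}(D)=\{AN-NA:A^*=-A\}$. A maximum over an empty index set is taken to be $0$. *)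

theory Defs
  imports "HOL-Analysis.Analysis"
begin

text \<open>
  The norm of the type \<open>complex^'n^'n\<close> is the Frobenius norm, and its inner product (as a real
  Euclidean space) is \<open>Re (tr (B\<^sup>* A))\<close>. The notions \<open>subspace\<close>, \<open>has_derivative\<close> and
  \<open>frechet_derivative\<close> on this type are those of the underlying real vector space.
\<close>

type_synonym 'n cmat = "complex^'n^'n"


subsection \<open>The Aluthge transform\<close>

definition cadjoint :: "('n::finite) cmat \<Rightarrow> 'n cmat" where
  "cadjoint A = (\<chi> i j. cnj (A $ j $ i))"

definition cunitary :: "('n::finite) cmat \<Rightarrow> bool" where
  "cunitary U \<longleftrightarrow> cadjoint U ** U = mat 1 \<and> U ** cadjoint U = mat 1"

definition diag_mat :: "complex^'n \<Rightarrow> ('n::finite) cmat" where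
  "diag_mat d = (\<chi> i j. if i = j then d $ i else 0)"

text \<open>
  The power \<open>P\<^sup>t\<close> of a positive semidefinite \<open>P\<close>, by functional calculus: apply \<open>x \<mapsto> x powr t\<close> to the
  eigenvalues in a unitary diagonalization. The result does not depend on the diagonalization.
  The value is unspecified if \<open>P\<close> is not positive semidefinite.
\<close>

definition psd_powr :: "('n::finite) cmat \<Rightarrow> real \<Rightarrow> 'n cmat" where
  "psd_powr P t = (THE Q. \<exists>U (p :: real^'n).
     cunitary U \<and> (\<forall>i. 0 \<le> p $ i) \<and>
     P = U ** diag_mat (\<chi> i. of_real (p $ i)) ** cadjoint U \<and>
     Q = U ** diag_mat (\<chi> i. of_real (p $ i powr t)) ** cadjoint U)"

definition mat_abs :: "('n::finite) cmat \<Rightarrow> 'n cmat" where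
  "mat_abs T = psd_powr (cadjoint T ** T) (1/2)"

text \<open>
  For singular \<open>T\<close> the unitary factor of \<open>T = U |T|\<close> is not unique, but \<open>U |T|\<^bsup>1-lam\<^esup>\<close> is
  the same for all choices when \<open>lam < 1\<close>.
\<close>

definition aluthge :: "real \<Rightarrow> ('n::finite) cmat \<Rightarrow> 'n cmat" where
  "aluthge lam T =
     (let U = (SOME U. cunitary U \<and> T = U ** mat_abs T)
      in psd_powr (mat_abs T) lam ** U ** psd_powr (mat_abs T) (1 - lam))"


subsection \<open>Orbits and their tangent spaces\<close>

definition similarity_orbit :: "('n::finite) cmat \<Rightarrow> 'n cmat set" where
  "similarity_orbit D = {S ** D ** matrix_inv S | S. invertible S}"

definition unitary_orbit :: "('n::finite) cmat \<Rightarrow> 'n cmat set" where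
  "unitary_orbit D = {U ** D ** cadjoint U | U. cunitary U}"

definition tangent_similarity_orbit :: "('n::finite) cmat \<Rightarrow> 'n cmat set" where
  "tangent_similarity_orbit N = {A ** N - N ** A | A. True}"

definition tangent_unitary_orbit :: "('n::finite) cmat \<Rightarrow> 'n cmat set" where
  "tangent_unitary_orbit N = {A ** N - N ** A | A. cadjoint A = - A}"


subsection \<open>Smoothness, direct sums, norms of restrictions\<close>

text \<open>\<open>C\<^sup>n\<close> on an open subset of a finite-dimensional space.\<close>

primrec higher_differentiable_on ::
    "'a::euclidean_space set \<Rightarrow> ('a \<Rightarrow> 'b::real_normed_vector) \<Rightarrow> nat \<Rightarrow> bool" where
  "higher_differentiable_on W f 0 \<longleftrightarrow> continuous_on W f"
| "higher_differentiable_on W f (Suc n) \<longleftrightarrow>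
     (\<forall>x\<in>W. f differentiable (at x)) \<and>
     (\<forall>v. higher_differentiable_on W (\<lambda>x. frechet_derivative f (at x) v) n)"

definition smooth_on_open ::
    "'a::euclidean_space set \<Rightarrow> ('a \<Rightarrow> 'b::real_normed_vector) \<Rightarrow> bool" where
  "smooth_on_open W f \<longleftrightarrow> open W \<and> (\<forall>n. higher_differentiable_on W f n)"

text \<open>
  For an embedded submanifold \<open>M\<close> of a Euclidean space, a function on \<open>M\<close> is \<open>C\<^sup>\<infinity>\<close> iff it extends, near
  each point of \<open>M\<close>, to a \<open>C\<^sup>\<infinity>\<close> function on an open subset of the ambient space.
\<close>

definition smooth_on_submanifold ::
    "'a::euclidean_space set \<Rightarrow> ('a \<Rightarrow> 'b::real_normed_vector) \<Rightarrow> bool" where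
  "smooth_on_submanifold M f \<longleftrightarrow>
     (\<forall>x\<in>M. \<exists>W g. x \<in> W \<and> smooth_on_open W g \<and> (\<forall>y\<in>M \<inter> W. g y = f y))"

definition is_direct_sum :: "'a::real_vector set \<Rightarrow> 'a set \<Rightarrow> 'a set \<Rightarrow> bool" where
  "is_direct_sum V E F \<longleftrightarrow>
     subspace E \<and> subspace F \<and> V = {x + y | x y. x \<in> E \<and> y \<in> F} \<and> E \<inter> F = {0}"

text \<open>The projection of \<open>E \<oplus> F\<close> onto \<open>E\<close> parallel to \<open>F\<close>.\<close>

definition proj_parallel :: "'a::real_vector set \<Rightarrow> 'a set \<Rightarrow> 'a \<Rightarrow> 'a" where
  "proj_parallel E F x = (THE y. y \<in> E \<and> x - y \<in> F)"

text \<open>The operator norm of the restriction of a linear map to a subspace, cf. \<open>onorm\<close>.\<close>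

definition onorm_on ::
    "'a::real_normed_vector set \<Rightarrow> ('a \<Rightarrow> 'b::real_normed_vector) \<Rightarrow> real" where
  "onorm_on E L = (SUP x\<in>E. norm (L x) / norm x)"

text \<open>
  The derivative at \<open>N\<close> of the restriction of the Aluthge transform to the similarity orbit of \<open>D\<close>.
  A derivative within a submanifold is determined only on the tangent space at \<open>N\<close> (where it is the
  tangent map), so this function may be applied to vectors of that space only.
\<close>

definition aluthge_tangent_map ::
    "real \<Rightarrow> ('n::finite) cmat \<Rightarrow> 'n cmat \<Rightarrow> 'n cmat \<Rightarrow> 'n cmat" where
  "aluthge_tangent_map lam D N =
     frechet_derivative (aluthge lam) (at N within similarity_orbit D)"


subsection \<open>The contraction constant\<close>

definition Max0 :: "real set \<Rightarrow> real" where
  "Max0 A = (if A = {} then 0 else Max A)"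

definition contraction_const :: "complex^'n \<Rightarrow> ('n::finite \<Rightarrow> real) \<Rightarrow> real \<Rightarrow> real" where
  "contraction_const d \<theta> lam =
     max
       (Max0 {(cmod (d $ j) powr (1 - lam) * cmod (d $ i) powr lam
               + cmod (d $ i) powr (1 - lam) * cmod (d $ j) powr lam)
              / (cmod (d $ i) + cmod (d $ j)) | i j. cmod (d $ i) \<noteq> cmod (d $ j)})
       (Max0 {cmod (of_real lam * (exp (\<i> * of_real (\<theta> j - \<theta> i)) - 1) + 1)
              | i j. \<theta> i \<noteq> \<theta> j})"

end

theory Submission
  imports Defs "HOL-Complex_Analysis.Cauchy_Integral_Formula"
begin

text \<open>
  For invertible \<open>T\<close> the transform is \<open>|T|\<^sup>\<lambda> T |T|\<^sup>-\<^sup>\<lambda>\<close>, and \<open>|T|\<^sup>s\<close> is a Cauchy integral of the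
  resolvent of \<open>T\<^sup>* T\<close> over a fixed circle for all \<open>T\<close> near a given matrix. Hence the transform is
  smooth, and its derivative at \<open>D\<close> is given by divided differences. This derivative couples the entry
  \<open>X\<^sub>i\<^sub>j\<close> only with the conjugate of \<open>X\<^sub>j\<^sub>i\<close>, so it splits into complex 2 by 2 blocks. A block with \<open>d\<^sub>i \<noteq> d\<^sub>j\<close>
  fixes the line tangent to the unitary orbit, and its other eigenvalue \<open>\<mu>\<^sub>i\<^sub>j\<close> is bounded by the contraction
  constant. The stable space is the sum of the eigenlines for the \<open>\<mu>\<^sub>i\<^sub>j\<close>. The projection onto it is
  expressed through the spectral projections of \<open>N\<close>, which are polynomials in \<open>N\<close>, so it is smooth
  in \<open>N\<close> and equivariant under unitary conjugation.
\<close>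


subsection \<open>Matrix algebra and smooth maps\<close>

text \<open>Powers are defined through a unitary diagonalization, but eigenvectors need not depend
  continuously on a matrix where eigenvalues collide. The circle integral avoids them, so coinciding
  moduli among the \<open>d $ i\<close> cause no trouble. The derivative of a resolvent
  \<open>R\<close> is a sandwich between two copies of \<open>R\<close>, and integrating the product
  of two scalar resolvents against the weight yields a divided difference. The eigenvalue 1 has a
  conceptual source: an invertible normal matrix commutes with its modulus, so the transform fixes
  the whole unitary orbit and its derivative fixes the tangent vectors of that orbit. The other
  eigenvalue of a block is then the trace minus 1, and no characteristic polynomial has to be
  solved. That it differs from 1, which the projection needs, follows from the strict bound by the
  contraction constant. The derivative is only real linear in \<open>X\<close>; the pair of
  \<open>X_ij\<close> and \<open>cnj X_ji\<close> serves as coordinates in which a block is complex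
  linear. A derivative within the orbit is determined on tangent vectors only, so it is read off
  from the ambient derivative.\<close>

lemma bounded_bilinear_matrix_mult:
  "bounded_bilinear ((**) :: ('n::finite) cmat \<Rightarrow> 'n cmat \<Rightarrow> 'n cmat)"
  unfolding bilinear_conv_bounded_bilinear[symmetric]
  by (auto simp: bilinear_def vec_eq_iff matrix_matrix_mult_def algebra_simps sum.distrib scaleR_sum_right
      intro!: linearI)

interpretation mmult: bounded_bilinear "(**) :: ('n::finite) cmat \<Rightarrow> 'n cmat \<Rightarrow> 'n cmat"
  by (rule bounded_bilinear_matrix_mult)

lemma cadjoint_nth [simp]: "cadjoint A $ i $ j = cnj (A $ j $ i)"
  by (simp add: cadjoint_def)

lemma diag_mat_nth: "diag_mat d $ i $ j = (if i = j then d $ i else 0)"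
  by (simp add: diag_mat_def)

lemma mat_nth: "mat c $ i $ j = (if i = j then c else 0)"
  by (simp add: mat_def)

lemma bounded_linear_cadjoint: "bounded_linear (cadjoint :: ('n::finite) cmat \<Rightarrow> 'n cmat)"
  unfolding linear_conv_bounded_linear[symmetric]
  by (auto intro!: linearI simp: vec_eq_iff)

lemma bounded_linear_mat: "bounded_linear (mat :: complex \<Rightarrow> ('n::finite) cmat)"
  unfolding linear_conv_bounded_linear[symmetric]
  by (auto intro!: linearI simp: vec_eq_iff mat_def)

lemma matrix_inv_mult:
  fixes A :: "('n::finite) cmat"
  assumes "invertible A"
  shows "matrix_inv A ** A = mat 1" "A ** matrix_inv A = mat 1"
  using someI_ex[OF assms[unfolded invertible_def]] unfolding matrix_inv_def by auto

lemma matrix_inv_eqI: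
  fixes A :: "('n::finite) cmat"
  assumes "B ** A = mat 1"
  shows "matrix_inv A = B"
proof -
  have "invertible A" using assms invertible_left_inverse by blast
  then have "matrix_inv A = (B ** A) ** matrix_inv A" using assms by simp
  also have "\<dots> = B" using \<open>invertible A\<close> by (simp add: matrix_mul_assoc[symmetric] matrix_inv_mult)
  finally show ?thesis .
qed

lemma continuous_on_det:
  fixes f :: "'a::topological_space \<Rightarrow> ('n::finite) cmat"
  assumes "\<And>i j. continuous_on S (\<lambda>x. f x $ i $ j)"
  shows "continuous_on S (\<lambda>x. det (f x))"
  unfolding det_def by (intro continuous_intros assms)

lemma open_invertible: "open {A :: ('n::finite) cmat. invertible A}"
proof -
  have "continuous_on UNIV (\<lambda>A :: 'n cmat. det A)"
    by (intro continuous_on_det continuous_intros)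
  then have "open ((\<lambda>A :: 'n cmat. det A) -` (- {0}))"
    by (intro open_vimage) auto
  also have "(\<lambda>A :: 'n cmat. det A) -` (- {0}) = {A. invertible A}"
    by (auto simp: invertible_det_nz)
  finally show ?thesis .
qed

text \<open>Cramer's rule: each entry of the inverse is a quotient of two determinants, both
  polynomial in the entries of \<open>A\<close>, and the denominator does not vanish.\<close>

lemma continuous_on_matrix_inv: "continuous_on {A :: ('n::finite) cmat. invertible A} matrix_inv"
proof -
  have *: "matrix_inv A $ i $ k = det (\<chi> p q. if q = i then axis k 1 $ p else A $ p $ q) / det A"
    if "invertible A" for A :: "'n cmat" and i k
  proof -
    have "A *v (matrix_inv A *v axis k 1) = axis k 1"
      by (simp add: matrix_vector_mul_assoc matrix_inv_mult that)
    with that have "matrix_inv A *v axis k 1 =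
        (\<chi> m. det (\<chi> p q. if q = m then axis k 1 $ p else A $ p $ q) / det A)"
      by (simp add: cramer invertible_det_nz)
    moreover have "(matrix_inv A *v axis k 1) $ i = matrix_inv A $ i $ k"
      by (simp add: matrix_vector_mul_component column_def axis_def matrix_vector_mult_def
          if_distrib[of "(*) _"] cong: if_cong)
    ultimately show ?thesis by simp
  qed
  have "continuous_on {A :: 'n cmat. invertible A}
      (\<lambda>A. det (\<chi> p q. if q = i then axis k 1 $ p else A $ p $ q) / det A)" for i k :: 'n
  proof (intro continuous_on_divide continuous_on_det ballI)
    show "continuous_on {A :: 'n cmat. invertible A}
      (\<lambda>A. (\<chi> p q. if q = i then axis k 1 $ p else A $ p $ q) $ ia $ j)" for ia j
      by (cases "j = i") (auto intro!: continuous_on_const continuous_on_id continuous_on_component)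
  qed (auto simp: invertible_det_nz intro!: continuous_on_const continuous_on_id continuous_on_component)
  then have "continuous_on {A :: 'n cmat. invertible A} (\<lambda>A. matrix_inv A $ i $ k)" for i k
    by (rule continuous_on_eq) (auto simp: *)
  then have "continuous_on {A :: 'n cmat. invertible A} (\<lambda>A. \<chi> i k. matrix_inv A $ i $ k)"
    by (intro continuous_on_vec_lambda)
  then show ?thesis by simp
qed

text \<open>By the identity \<open>B^-1 (B - A) A^-1 = A^-1 - B^-1\<close>, the remainder of the
  linear approximation is \<open>- (B^-1 - A^-1) (B - A) A^-1\<close>. After division by
  \<open>norm (B - A)\<close> the middle factor is bounded, and the first one tends to 0 by
  continuity of the inverse.\<close>

lemma has_derivative_matrix_inv:
  fixes A :: "('n::finite) cmat"
  assumes A: "invertible A"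
  shows "(matrix_inv has_derivative (\<lambda>H. - (matrix_inv A ** H ** matrix_inv A))) (at A)"
proof -
  define R where "R = (\<lambda>B :: 'n cmat. (matrix_inv B - matrix_inv A) ** ((B - A) /\<^sub>R norm (B - A)) ** matrix_inv A)"
  have bl: "bounded_linear (\<lambda>H. - (matrix_inv A ** H ** matrix_inv A))"
    by (intro bounded_linear_minus bounded_linear_compose[OF mmult.bounded_linear_left]
        bounded_linear_compose[OF mmult.bounded_linear_right] bounded_linear_ident)
  have ev: "\<forall>\<^sub>F B in at A. - R B = ((matrix_inv B - matrix_inv A) - - (matrix_inv A ** (B - A) ** matrix_inv A)) /\<^sub>R norm (B - A)"
  proof (rule eventually_at_topological[THEN iffD2], intro exI conjI ballI impI)
    fix B :: "'n cmat" assume "B \<in> {A. invertible A}" "B \<noteq> A"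
    then have B: "invertible B" by simp
    have "matrix_inv B ** (B - A) ** matrix_inv A = matrix_inv A - matrix_inv B"
      using A B by (simp add: mmult.diff_left mmult.diff_right matrix_inv_mult)
         (simp add: matrix_mul_assoc[symmetric] matrix_inv_mult)
    then have "matrix_inv B - matrix_inv A + matrix_inv A ** (B - A) ** matrix_inv A
        = - ((matrix_inv B - matrix_inv A) ** (B - A) ** matrix_inv A)"
      by (simp add: mmult.diff_left)
    then show "- R B = ((matrix_inv B - matrix_inv A) - - (matrix_inv A ** (B - A) ** matrix_inv A)) /\<^sub>R norm (B - A)"
      by (simp add: R_def mmult.scaleR_left mmult.scaleR_right)
  qed (use A open_invertible in auto)
  have cont: "((\<lambda>B. matrix_inv B) \<longlongrightarrow> matrix_inv A) (at A)"
    using continuous_on_matrix_inv[where 'n='n] A open_invertible[where 'n='n]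
    by (simp add: continuous_on_eq_continuous_at isCont_def)
  have "((\<lambda>B. (matrix_inv B - matrix_inv A) ** ((B - A) /\<^sub>R norm (B - A))) \<longlongrightarrow> 0) (at A)"
  proof -
    obtain K where K: "\<And>(X :: 'n cmat) (Y :: 'n cmat). norm (X ** Y) \<le> norm X * norm Y * K"
      using bounded_bilinear.bounded[OF bounded_bilinear_matrix_mult] by blast
    have "((\<lambda>B. norm (matrix_inv B - matrix_inv A) * \<bar>K\<bar>) \<longlongrightarrow> 0) (at A)"
      using cont by (intro tendsto_mult_left_zero tendsto_norm_zero) (simp add: LIM_zero)
    then show ?thesis
    proof (rule Lim_null_comparison[rotated], intro always_eventually allI)
      fix B
      have "norm ((B - A) /\<^sub>R norm (B - A)) \<le> 1" by (cases "B = A") simp_all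
      then have le: "norm (matrix_inv B - matrix_inv A) * norm ((B - A) /\<^sub>R norm (B - A))
          \<le> norm (matrix_inv B - matrix_inv A)"
        by (rule mult_left_le) simp
      have "norm ((matrix_inv B - matrix_inv A) ** ((B - A) /\<^sub>R norm (B - A)))
          \<le> norm (matrix_inv B - matrix_inv A) * norm ((B - A) /\<^sub>R norm (B - A)) * K" by (rule K)
      also have "\<dots> \<le> norm (matrix_inv B - matrix_inv A) * norm ((B - A) /\<^sub>R norm (B - A)) * \<bar>K\<bar>"
        by (intro mult_left_mono) auto
      also have "\<dots> \<le> norm (matrix_inv B - matrix_inv A) * \<bar>K\<bar>"
        by (rule mult_right_mono[OF le]) simp
      finally show "norm ((matrix_inv B - matrix_inv A) ** ((B - A) /\<^sub>R norm (B - A)))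
          \<le> norm (matrix_inv B - matrix_inv A) * \<bar>K\<bar>" .
    qed
  qed
  then have "(R \<longlongrightarrow> 0 ** matrix_inv A) (at A)"
    unfolding R_def by (intro mmult.tendsto tendsto_const)
  then have "((\<lambda>B. - R B) \<longlongrightarrow> 0) (at A)" using tendsto_minus by fastforce
  then show ?thesis
    unfolding has_derivative_at_within by (intro conjI bl Lim_transform_eventually[OF _ ev])
qed

lemma has_derivative_matrix_inv_compose:
  fixes f :: "'a::real_normed_vector \<Rightarrow> ('n::finite) cmat"
  assumes "(f has_derivative f') (at x)" "invertible (f x)"
  shows "((\<lambda>x. matrix_inv (f x)) has_derivative
      (\<lambda>v. - (matrix_inv (f x) ** f' v ** matrix_inv (f x)))) (at x)"
  using has_derivative_compose[OF assms(1) has_derivative_matrix_inv[OF assms(2)]] .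

section \<open>Calculus of iterated differentiability and of integrals with a parameter\<close>

lemma higher_differentiable_onD:
  assumes "higher_differentiable_on W f (Suc n)" "x \<in> W"
  shows "(f has_derivative frechet_derivative f (at x)) (at x)"
  using assms frechet_derivative_works by auto

lemma higher_differentiable_on_continuous:
  assumes "higher_differentiable_on W f n"
  shows "continuous_on W f"
proof (cases n)
  case (Suc m)
  then show ?thesis
    using assms by (auto intro!: continuous_at_imp_continuous_on differentiable_imp_continuous_within)
qed (use assms in simp)

lemma higher_differentiable_on_cong:
  assumes "open W" "\<And>x. x \<in> W \<Longrightarrow> f x = g x" "higher_differentiable_on W f n"
  shows "higher_differentiable_on W g n"
  using assms(2,3)
proof (induction n arbitrary: f g)
  case 0
  then show ?case by (simp cong: continuous_on_cong)
next
  case (Suc n)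
  have diff: "g differentiable at x" "frechet_derivative g (at x) = frechet_derivative f (at x)" if "x \<in> W" for x
  proof -
    have f: "f differentiable at x" using Suc.prems that by simp
    show "frechet_derivative g (at x) = frechet_derivative f (at x)"
      using frechet_derivative_transform_within_open[OF f assms(1) that Suc.prems(1)] by simp
    show "g differentiable at x"
      by (rule differentiableI, rule has_derivative_transform_within_open
          [OF f[unfolded frechet_derivative_works] assms(1) that Suc.prems(1)])
  qed
  then have "higher_differentiable_on W (\<lambda>x. frechet_derivative g (at x) v) n" for v
    using Suc.IH[of "\<lambda>x. frechet_derivative f (at x) v" "\<lambda>x. frechet_derivative g (at x) v"] Suc.prems
    by simp
  then show ?case using diff by simp
qed

text \<open>Lets an explicit derivative formula replace \<open>frechet_derivative\<close>, which is
  defined by choice. The closure rules below are inductions on the order through this rule.\<close>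

lemma higher_differentiable_on_SucI:
  assumes "open W" "\<And>x. x \<in> W \<Longrightarrow> (f has_derivative f' x) (at x)"
    and "\<And>v. higher_differentiable_on W (\<lambda>x. f' x v) n"
  shows "higher_differentiable_on W f (Suc n)"
proof -
  have "frechet_derivative f (at x) = f' x" if "x \<in> W" for x
    using frechet_derivative_at[OF assms(2)[OF that]] by simp
  then have "higher_differentiable_on W (\<lambda>x. frechet_derivative f (at x) v) n" for v
    using higher_differentiable_on_cong[OF assms(1) _ assms(3)[of v]] by simp
  moreover have "f differentiable at x" if "x \<in> W" for x
    using assms(2)[OF that] unfolding differentiable_def by blast
  ultimately show ?thesis by simp
qed

lemma higher_differentiable_on_Suc:
  "higher_differentiable_on W f (Suc n) \<Longrightarrow> higher_differentiable_on W f n"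
proof (induction n arbitrary: f)
  case 0
  then show ?case using higher_differentiable_on_continuous by (metis higher_differentiable_on.simps(1))
next
  case (Suc n)
  then show ?case by (metis higher_differentiable_on.simps(2))
qed

lemma higher_differentiable_on_const:
  assumes "open W"
  shows "higher_differentiable_on W (\<lambda>x. c) n"
proof (induction n arbitrary: c)
  case (Suc n)
  show ?case by (rule higher_differentiable_on_SucI[OF assms, of _ "\<lambda>_ _. 0"]) (auto simp: Suc)
qed simp

lemma higher_differentiable_on_linear:
  assumes "open W" "bounded_linear L"
  shows "higher_differentiable_on W L n"
proof (cases n)
  case (Suc m)
  then show ?thesis
    using higher_differentiable_on_SucI[OF assms(1), of L "\<lambda>_. L" m] assms
    by (simp add: bounded_linear_imp_has_derivative higher_differentiable_on_const del: higher_differentiable_on.simps)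
qed (use assms in \<open>auto intro: linear_continuous_on\<close>)

lemma higher_differentiable_on_compose_linear:
  assumes W: "open W" and L: "bounded_linear L"
  shows "higher_differentiable_on W f n \<Longrightarrow> higher_differentiable_on W (\<lambda>x. L (f x)) n"
proof (induction n arbitrary: f)
  case 0
  then show ?case using L by (simp add: bounded_linear.continuous_on)
next
  case (Suc n)
  show ?case
    by (rule higher_differentiable_on_SucI[OF W, of _ "\<lambda>x v. L (frechet_derivative f (at x) v)"])
      (use Suc in \<open>auto intro!: bounded_linear.has_derivative[OF L] simp: frechet_derivative_works[symmetric]\<close>)
qed

lemma higher_differentiable_on_add:
  assumes W: "open W"
  shows "higher_differentiable_on W f n \<Longrightarrow> higher_differentiable_on W g n \<Longrightarrow>
    higher_differentiable_on W (\<lambda>x. f x + g x) n"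
proof (induction n arbitrary: f g)
  case 0
  then show ?case by (simp add: continuous_on_add)
next
  case (Suc n)
  show ?case
    by (rule higher_differentiable_on_SucI[OF W, of _ "\<lambda>x v. frechet_derivative f (at x) v + frechet_derivative g (at x) v"])
      (use Suc in \<open>auto intro!: has_derivative_add simp: frechet_derivative_works[symmetric]\<close>)
qed

lemma higher_differentiable_on_sum:
  assumes "open W" "\<And>i. i \<in> I \<Longrightarrow> higher_differentiable_on W (f i) n"
  shows "higher_differentiable_on W (\<lambda>x. \<Sum>i\<in>I. f i x) n"
  using assms(2)
  by (induction I rule: infinite_finite_induct)
    (auto intro: higher_differentiable_on_const higher_differentiable_on_add assms(1))

lemma higher_differentiable_on_minus:
  "open W \<Longrightarrow> higher_differentiable_on W f n \<Longrightarrow> higher_differentiable_on W (\<lambda>x. - f x) n"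
  by (rule higher_differentiable_on_compose_linear[of W uminus])
    (simp_all add: bounded_linear_minus bounded_linear_ident)

lemma higher_differentiable_on_diff:
  "open W \<Longrightarrow> higher_differentiable_on W f n \<Longrightarrow> higher_differentiable_on W g n \<Longrightarrow>
    higher_differentiable_on W (\<lambda>x. f x - g x) n"
  using higher_differentiable_on_add[of W f n "\<lambda>x. - g x"] higher_differentiable_on_minus[of W g n] by simp

lemma higher_differentiable_on_bilinear:
  assumes W: "open W" and B: "bounded_bilinear B"
  shows "higher_differentiable_on W f n \<Longrightarrow> higher_differentiable_on W g n \<Longrightarrow>
    higher_differentiable_on W (\<lambda>x. B (f x) (g x)) n"
proof (induction n arbitrary: f g)
  case 0
  then show ?case by (simp add: bounded_bilinear.continuous_on[OF B])
next
  case (Suc n)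
  show ?case
  proof (rule higher_differentiable_on_SucI[OF W, of _
        "\<lambda>x v. B (f x) (frechet_derivative g (at x) v) + B (frechet_derivative f (at x) v) (g x)"])
    show "((\<lambda>x. B (f x) (g x)) has_derivative (\<lambda>v. B (f x) (frechet_derivative g (at x) v) +
        B (frechet_derivative f (at x) v) (g x))) (at x)" if "x \<in> W" for x
      using that Suc.prems by (intro bounded_bilinear.FDERIV[OF B] higher_differentiable_onD)
    fix v
    \<comment> \<open>The product rule keeps undifferentiated factors; they are used at the lower
      order \<open>n\<close>.\<close>
    show "higher_differentiable_on W (\<lambda>x. B (f x) (frechet_derivative g (at x) v) +
        B (frechet_derivative f (at x) v) (g x)) n"
      using Suc.prems Suc.prems[THEN higher_differentiable_on_Suc]
      by (intro higher_differentiable_on_add[OF W] Suc.IH) auto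
  qed
qed

lemmas higher_differentiable_on_mult = higher_differentiable_on_bilinear[OF _ bounded_bilinear_matrix_mult]

text \<open>A bootstrap: the derivative of the inverse is built from the inverse itself, so its
  order \<open>n\<close> smoothness, known by induction, gives order \<open>n + 1\<close>.\<close>

lemma higher_differentiable_on_matrix_inv:
  fixes f :: "'a::euclidean_space \<Rightarrow> ('n::finite) cmat"
  assumes W: "open W" and inv: "\<And>x. x \<in> W \<Longrightarrow> invertible (f x)"
  shows "higher_differentiable_on W f n \<Longrightarrow> higher_differentiable_on W (\<lambda>x. matrix_inv (f x)) n"
proof (induction n)
  case 0
  then show ?case
    using continuous_on_compose2[OF continuous_on_matrix_inv, of W f] inv by auto
next
  case (Suc n)
  show ?case
  proof (rule higher_differentiable_on_SucI[OF W, of _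
        "\<lambda>x v. - (matrix_inv (f x) ** frechet_derivative f (at x) v ** matrix_inv (f x))"])
    show "((\<lambda>x. matrix_inv (f x)) has_derivative
        (\<lambda>v. - (matrix_inv (f x) ** frechet_derivative f (at x) v ** matrix_inv (f x)))) (at x)" if "x \<in> W" for x
      using that Suc.prems inv by (intro has_derivative_matrix_inv_compose higher_differentiable_onD)
    show "higher_differentiable_on W
        (\<lambda>x. - (matrix_inv (f x) ** frechet_derivative f (at x) v ** matrix_inv (f x))) n" for v
      using Suc.prems higher_differentiable_on_Suc[OF Suc.prems]
      by (intro higher_differentiable_on_minus higher_differentiable_on_mult W Suc.IH) auto
  qed
qed

text \<open>Differentiation under the integral sign. The curve enters only through the first
  argument of \<open>g\<close>, so continuity of the curve is enough. The derivative is an integral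
  of the same form, with \<open>g\<close> replaced by its derivative in a direction
  \<open>(0, v)\<close>, and so the statement can be iterated.\<close>

lemma has_derivative_integral_param:
  fixes g :: "'z::euclidean_space \<times> 'a::euclidean_space \<Rightarrow> 'b::euclidean_space" and \<gamma> :: "real \<Rightarrow> 'z"
  assumes g: "higher_differentiable_on \<Omega> g (Suc n)" and W: "open W"
    and \<gamma>: "continuous_on (cbox a b) \<gamma>" and sub: "\<And>t x. t \<in> cbox a b \<Longrightarrow> x \<in> W \<Longrightarrow> (\<gamma> t, x) \<in> \<Omega>"
    and x: "x \<in> W"
  shows "((\<lambda>x. integral (cbox a b) (\<lambda>t. g (\<gamma> t, x))) has_derivative
    (\<lambda>v. integral (cbox a b) (\<lambda>t. frechet_derivative g (at (\<gamma> t, x)) (0, v)))) (at x)"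
proof -
  obtain e where e: "e > 0" "ball x e \<subseteq> W" using W x openE by blast
  \<comment> \<open>\<open>leibniz_rule\<close> expects the derivative as a continuous map into the
    bounded linear operators; in finite dimension its continuity can be checked on basis
    vectors.\<close>
  define G' where "G' = (\<lambda>x t. Blinfun (\<lambda>v. frechet_derivative g (at (\<gamma> t, x)) (0, v)))"
  have der: "((\<lambda>x. g (\<gamma> t, x)) has_derivative (\<lambda>v. frechet_derivative g (at (\<gamma> t, x)) (0, v))) (at x)"
    if "x \<in> W" "t \<in> cbox a b" for x t
    by (rule has_derivative_compose[of "\<lambda>x. (\<gamma> t, x)", OF _ higher_differentiable_onD[OF g]])
      (use that sub in \<open>auto intro!: derivative_eq_intros\<close>)
  have G': "blinfun_apply (G' x t) = (\<lambda>v. frechet_derivative g (at (\<gamma> t, x)) (0, v))"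
    if "x \<in> W" "t \<in> cbox a b" for x t
    unfolding G'_def by (rule bounded_linear_Blinfun_apply) (rule has_derivative_bounded_linear[OF der[OF that]])
  have cont: "continuous_on (W \<times> cbox a b) (\<lambda>(x, t). h (\<gamma> t, x))" if "continuous_on \<Omega> h" for h :: "_ \<Rightarrow> 'b"
    unfolding case_prod_beta
    by (rule continuous_on_compose2[OF that])
      (use sub in \<open>auto intro!: continuous_intros continuous_on_compose2[OF \<gamma>]\<close>)
  have contG': "continuous_on (W \<times> cbox a b) (\<lambda>(x, t). G' x t)"
    unfolding case_prod_beta
  proof (rule continuous_on_blinfun_componentwise)
    fix i :: 'a
    have "continuous_on \<Omega> (\<lambda>y. frechet_derivative g (at y) (0, i))"
      using g by (intro higher_differentiable_on_continuous[of _ _ n]) simp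
    from cont[OF this] show "continuous_on (W \<times> cbox a b) (\<lambda>p. blinfun_apply (G' (fst p) (snd p)) i)"
      by (rule continuous_on_eq) (auto simp: G')
  qed
  have int: "G' x integrable_on cbox a b"
    by (rule integrable_continuous, rule continuous_on_compose2[OF contG', of _ "\<lambda>t. (x, t)", simplified])
      (use x in \<open>auto intro!: continuous_intros\<close>)
  have "((\<lambda>x. integral (cbox a b) (\<lambda>t. g (\<gamma> t, x))) has_derivative integral (cbox a b) (G' x)) (at x within ball x e)"
  proof (rule leibniz_rule)
    show "((\<lambda>x. g (\<gamma> t, x)) has_derivative blinfun_apply (G' y t)) (at y within ball x e)"
      if "y \<in> ball x e" "t \<in> cbox a b" for y t
      unfolding G'[OF subsetD[OF e(2) that(1)] that(2)]
      by (rule has_derivative_at_withinI[OF der[OF subsetD[OF e(2) that(1)] that(2)]])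
    show "(\<lambda>t. g (\<gamma> t, y)) integrable_on cbox a b" if "y \<in> ball x e" for y
      by (rule integrable_continuous, rule continuous_on_compose2[OF higher_differentiable_on_continuous[OF g]])
        (use that e sub \<gamma> in \<open>auto intro!: continuous_intros\<close>)
    show "continuous_on (ball x e \<times> cbox a b) (\<lambda>(x, t). G' x t)"
      using contG' by (rule continuous_on_subset) (use e in auto)
  qed (use e in auto)
  moreover have "at x within ball x e = at x" using e(1) by (intro at_within_open) auto
  moreover have "blinfun_apply (integral (cbox a b) (G' x)) =
      (\<lambda>v. integral (cbox a b) (\<lambda>t. frechet_derivative g (at (\<gamma> t, x)) (0, v)))"
  proof
    fix v
    have "blinfun_apply (integral (cbox a b) (G' x)) v = integral (cbox a b) (\<lambda>t. blinfun_apply (G' x t) v)"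
      by (rule blinfun_apply_integral[OF int])
    also have "\<dots> = integral (cbox a b) (\<lambda>t. frechet_derivative g (at (\<gamma> t, x)) (0, v))"
      by (rule integral_cong) (simp only: G'[OF x])
    finally show "blinfun_apply (integral (cbox a b) (G' x)) v =
      integral (cbox a b) (\<lambda>t. frechet_derivative g (at (\<gamma> t, x)) (0, v))" .
  qed
  ultimately show ?thesis by (simp only:)
qed

lemma higher_differentiable_on_integral:
  fixes g :: "'z::euclidean_space \<times> 'a::euclidean_space \<Rightarrow> 'b::euclidean_space" and \<gamma> :: "real \<Rightarrow> 'z"
  assumes W: "open W" and \<gamma>: "continuous_on (cbox a b) \<gamma>"
    and sub: "\<And>t x. t \<in> cbox a b \<Longrightarrow> x \<in> W \<Longrightarrow> (\<gamma> t, x) \<in> \<Omega>"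
  shows "higher_differentiable_on \<Omega> g n \<Longrightarrow>
    higher_differentiable_on W (\<lambda>x. integral (cbox a b) (\<lambda>t. g (\<gamma> t, x))) n"
proof (induction n arbitrary: g)
  case 0
  have "continuous_on (W \<times> cbox a b) (\<lambda>(x, t). g (\<gamma> t, x))"
    unfolding case_prod_beta
    by (rule continuous_on_compose2[of \<Omega> g])
      (use 0 sub in \<open>auto intro!: continuous_intros continuous_on_compose2[OF \<gamma>]\<close>)
  from integral_continuous_on_param[OF this] show ?case by simp
next
  case (Suc n)
  show ?case
    by (rule higher_differentiable_on_SucI[OF W has_derivative_integral_param[OF Suc.prems W \<gamma> sub]])
      (use Suc in auto)
qed


subsection \<open>Unitary diagonalization and powers of the modulus\<close>

lemma cadjoint_mult: "cadjoint (A ** B) = cadjoint B ** cadjoint A"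
  by (simp add: vec_eq_iff matrix_matrix_mult_def mult.commute)

lemma cadjoint_cadjoint [simp]: "cadjoint (cadjoint A) = A"
  by (simp add: vec_eq_iff)

lemma cadjoint_mat: "cadjoint (mat c) = mat (cnj c)"
  by (simp add: vec_eq_iff mat_nth)

lemma cunitaryD:
  assumes "cunitary U"
  shows "cadjoint U ** U = mat 1" "U ** cadjoint U = mat 1"
    "cadjoint U ** (U ** X) = X" "U ** (cadjoint U ** X) = X"
  using assms by (simp_all add: cunitary_def matrix_mul_assoc)

lemma cunitary_invertible: "cunitary U \<Longrightarrow> invertible U"
  using cunitary_def invertible_def by blast

lemma cunitary_cadjoint: "cunitary U \<Longrightarrow> cunitary (cadjoint U)"
  by (simp add: cunitary_def)

lemma cunitary_mult: "cunitary U \<Longrightarrow> cunitary V \<Longrightarrow> cunitary (U ** V)"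
  by (simp add: cunitary_def cadjoint_mult matrix_mul_assoc[symmetric] cunitaryD(3,4))

lemma cunitary_one: "cunitary (mat 1)"
  by (simp add: cunitary_def cadjoint_mat)

lemma diag_mat_mult_left: "(diag_mat d ** A) $ i $ j = d $ i * A $ i $ j"
  by (simp add: matrix_matrix_mult_def diag_mat_nth if_distrib[of "\<lambda>x. x * _"] cong: if_cong)

lemma diag_mat_mult_right: "(A ** diag_mat d) $ i $ j = A $ i $ j * d $ j"
  by (simp add: matrix_matrix_mult_def diag_mat_nth if_distrib[of "\<lambda>x. _ * x"] cong: if_cong)

lemma diag_mat_mult: "diag_mat a ** diag_mat b = diag_mat (\<chi> i. a $ i * b $ i)"
  by (auto simp: vec_eq_iff diag_mat_mult_left diag_mat_nth)

lemma cadjoint_diag_mat: "cadjoint (diag_mat a) = diag_mat (\<chi> i. cnj (a $ i))"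
  by (auto simp: vec_eq_iff diag_mat_nth)

lemma diag_mat_one: "diag_mat (\<chi> i. 1) = mat 1"
  by (auto simp: vec_eq_iff diag_mat_nth mat_nth)

section \<open>The spectral theorem for Hermitian matrices\<close>

abbreviation rdiag :: "real^'n \<Rightarrow> ('n::finite) cmat" where
  "rdiag p \<equiv> diag_mat (\<chi> i. complex_of_real (p $ i))"

text \<open>The Hermitian form behind the real inner product of the type class, which is only its
  real part; orthonormality over the complex numbers needs the whole form.\<close>

definition cip :: "complex^'n \<Rightarrow> complex^'n \<Rightarrow> complex" where
  "cip x y = (\<Sum>i\<in>UNIV. x $ i * cnj (y $ i))"

lemma inner_eq_Re_cip: "x \<bullet> y = Re (cip x y)"
  by (simp add: cip_def inner_vec_def inner_complex_def)

lemma cip_self: "cip x x = of_real ((norm x)\<^sup>2)"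
proof -
  have "cip x x = of_real (\<Sum>i\<in>UNIV. (cmod (x $ i))\<^sup>2)"
    unfolding cip_def of_real_sum complex_norm_square[symmetric] by simp
  also have "(\<Sum>i\<in>UNIV. (cmod (x $ i))\<^sup>2) = (norm x)\<^sup>2"
    by (simp add: norm_vec_def L2_set_def sum_nonneg)
  finally show ?thesis .
qed

lemma cip_cnj: "cnj (cip x y) = cip y x"
  by (simp add: cip_def mult.commute)

lemma cip_smult_right: "cip x (c *s y) = cnj c * cip x y"
  by (simp add: cip_def sum_distrib_left algebra_simps)

lemma cip_smult_left: "cip (c *s x) y = c * cip x y"
  by (simp add: cip_def sum_distrib_left algebra_simps)

lemma cip_diff_left: "cip (x - y) z = cip x z - cip y z"
  by (simp add: cip_def sum_subtractf algebra_simps)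

lemma cip_add_left: "cip (x + y) z = cip x z + cip y z"
  by (simp add: cip_def sum.distrib algebra_simps)

lemma cip_matrix_vector: "cip (A *v x) y = cip x (cadjoint A *v y)"
proof -
  have "cip (A *v x) y = (\<Sum>i\<in>UNIV. \<Sum>j\<in>UNIV. A $ i $ j * x $ j * cnj (y $ i))"
    by (simp add: cip_def matrix_vector_mult_def sum_distrib_right)
  also have "\<dots> = (\<Sum>j\<in>UNIV. \<Sum>i\<in>UNIV. A $ i $ j * x $ j * cnj (y $ i))"
    by (rule sum.swap)
  also have "\<dots> = cip x (cadjoint A *v y)"
    by (simp add: cip_def matrix_vector_mult_def sum_distrib_left algebra_simps)
  finally show ?thesis .
qed

lemma scaleR_eq_smult: "r *\<^sub>R (x :: complex^'n) = of_real r *s x"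
  by (simp add: vec_eq_iff complex_eq_iff)

lemma matrix_vector_smult: "A *v (c *s x) = c *s (A *v (x :: complex^'n))"
  by (simp add: vec_eq_iff matrix_vector_mult_def sum_distrib_left algebra_simps)

lemma matrix_vector_add: "A *v (x + y) = A *v x + A *v (y :: complex^'n)"
  by (simp add: vec_eq_iff matrix_vector_mult_def sum.distrib algebra_simps)

lemma continuous_on_matrix_vector: "continuous_on S (\<lambda>x. A *v (x :: complex^'n))"
  unfolding matrix_vector_mult_def by (intro continuous_intros)

text \<open>The first-order condition at a maximum: for positive \<open>a\<close> and small positive
  \<open>t\<close> the linear term would win. The chosen \<open>t\<close> turns the assumption into
  \<open>2 * a \<le> a\<close>.\<close>

lemma quadratic_bound_zero:
  fixes a C :: real
  assumes "\<And>t. 2 * t * a \<le> t\<^sup>2 * C"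
  shows "a \<le> 0"
proof (rule ccontr)
  assume "\<not> a \<le> 0"
  then have a: "a > 0" by simp
  define t where "t = a / (\<bar>C\<bar> + 1)"
  have t: "t > 0" using a by (simp add: t_def)
  have "2 * a \<le> t * C"
    using assms[of t] t by (simp add: power2_eq_square)
  also have "\<dots> \<le> t * (\<bar>C\<bar> + 1)" using t by (intro mult_left_mono) auto
  also have "\<dots> = a" by (simp add: t_def)
  finally show False using a by simp
qed

text \<open>The Rayleigh quotient attains its maximum on the orthogonal complement of the eigenvectors
  found so far, and a maximizer is an eigenvector.\<close>

lemma hermitian_eigenvector_exists:
  fixes A :: "('n::finite) cmat" and f :: "'n \<Rightarrow> complex^'n" and p :: "'n \<Rightarrow> real"
  assumes A: "cadjoint A = A" and I: "I \<noteq> UNIV"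
    and eig: "\<And>i. i \<in> I \<Longrightarrow> A *v f i = of_real (p i) *s f i"
  shows "\<exists>x M. cip x x = 1 \<and> (\<forall>i\<in>I. cip x (f i) = 0) \<and> A *v x = of_real M *s x"
proof -
  define V where "V = {x. \<forall>i\<in>I. cip x (f i) = 0}"
  \<comment> \<open>Real orthogonality to both \<open>f i\<close> and \<open>\<i> *s f i\<close>
    amounts to \<open>cip x (f i) = 0\<close>. The real dimension of \<open>B\<close> is at most
    \<open>2 * card I\<close>, which is less than \<open>2 * CARD('n)\<close>, so a nonzero
    \<open>x\<close> remains.\<close>
  define B where "B = f ` I \<union> (\<lambda>i. \<i> *s f i) ` I"
  have VI: "x \<in> V" if "\<And>b. b \<in> B \<Longrightarrow> x \<bullet> b = 0" for x
  proof -
    have "cip x (f i) = 0" if "i \<in> I" for i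
    proof (rule complex_eqI)
      show "Re (cip x (f i)) = Re 0"
        using \<open>\<And>b. b \<in> B \<Longrightarrow> x \<bullet> b = 0\<close>[of "f i"] that by (simp add: B_def inner_eq_Re_cip)
      show "Im (cip x (f i)) = Im 0"
        using \<open>\<And>b. b \<in> B \<Longrightarrow> x \<bullet> b = 0\<close>[of "\<i> *s f i"] that
        by (simp add: B_def inner_eq_Re_cip cip_smult_right)
    qed
    then show ?thesis by (simp add: V_def)
  qed
  have cV: "c *s x \<in> V" if "x \<in> V" for c x using that by (simp add: V_def cip_smult_left)
  have rV: "r *\<^sub>R x \<in> V" if "x \<in> V" for r x using cV[OF that] by (simp add: scaleR_eq_smult)
  have dV: "x - y \<in> V" if "x \<in> V" "y \<in> V" for x y using that by (simp add: V_def cip_diff_left)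
  have aV: "x + y \<in> V" if "x \<in> V" "y \<in> V" for x y using that by (simp add: V_def cip_add_left)
  have AV: "A *v x \<in> V" if "x \<in> V" for x
    using that by (simp add: V_def cip_matrix_vector A eig cip_smult_right)
  have "card I < CARD('n)" using I by (intro psubset_card_mono) auto
  moreover have "card B \<le> card I + card I"
    unfolding B_def by (rule order_trans[OF card_Un_le]) (intro add_mono card_image_le, auto)
  moreover have "dim B \<le> card B" by (rule dim_le_card') (simp add: B_def)
  ultimately have "dim B < DIM(complex^'n)" by simp
  then obtain x0 where x0: "x0 \<noteq> 0" "\<And>y. y \<in> span B \<Longrightarrow> orthogonal x0 y"
    using orthogonal_to_subspace_exists by blast
  then have "x0 \<in> V" by (intro VI) (auto simp: orthogonal_def span_base)
  have "closed V"
    unfolding V_def cip_def Ball_def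
    by (intro closed_Collect_all closed_Collect_imp closed_Collect_eq continuous_intros) simp
  then have "compact (V \<inter> sphere 0 1)" by (simp add: closed_Int_compact)
  moreover have "V \<inter> sphere 0 1 \<noteq> {}"
    using x0 rV[OF \<open>x0 \<in> V\<close>, of "inverse (norm x0)"] by fastforce
  moreover have "continuous_on (V \<inter> sphere 0 1) (\<lambda>y. (A *v y) \<bullet> y)"
    by (intro continuous_intros continuous_on_matrix_vector)
  ultimately have "\<exists>x\<in>V \<inter> sphere 0 1. \<forall>y\<in>V \<inter> sphere 0 1. (A *v y) \<bullet> y \<le> (A *v x) \<bullet> x"
    by (rule continuous_attains_sup)
  then obtain x where x: "x \<in> V" "norm x = 1"
      and max: "\<And>y. y \<in> V \<Longrightarrow> norm y = 1 \<Longrightarrow> (A *v y) \<bullet> y \<le> (A *v x) \<bullet> x"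
    by auto
  define M where "M = (A *v x) \<bullet> x"
  have le: "(A *v y) \<bullet> y \<le> M * (y \<bullet> y)" if "y \<in> V" for y
  proof (cases "y = 0")
    case False
    have AR: "A *v (r *\<^sub>R y) = r *\<^sub>R (A *v y)" for r by (simp add: scaleR_eq_smult matrix_vector_smult)
    have "(A *v (y /\<^sub>R norm y)) \<bullet> (y /\<^sub>R norm y) \<le> M"
      unfolding M_def using False rV[OF that] by (intro max) simp_all
    then have "((A *v y) \<bullet> y) / (norm y)\<^sup>2 \<le> M"
      by (simp add: AR power2_eq_square divide_inverse mult_ac)
    then show ?thesis using False unfolding power2_norm_eq_inner[symmetric] by (simp add: pos_divide_le_eq)
  qed simp
  define w where "w = A *v x - of_real M *s x"
  have "w \<in> V" unfolding w_def by (intro dV AV cV x)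
  have sym: "(A *v y) \<bullet> z = (A *v z) \<bullet> y" for y z
    by (metis A cip_matrix_vector inner_commute inner_eq_Re_cip)
  \<comment> \<open>Moving from the maximizer \<open>x\<close> along the residual \<open>w\<close>
    changes the form \<open>(A *v y) \<bullet> y - M * (y \<bullet> y)\<close> by
    \<open>2 * t * (w \<bullet> w)\<close> to first order in \<open>t\<close>, while the form stays
    nonpositive on \<open>V\<close>.\<close>
  have "w \<bullet> w \<le> 0"
  proof (rule quadratic_bound_zero)
    fix t :: real
    have "x + t *\<^sub>R w \<in> V" by (simp add: scaleR_eq_smult aV cV x \<open>w \<in> V\<close>)
    from le[OF this]
    have "(A *v x + t *\<^sub>R (A *v w)) \<bullet> (x + t *\<^sub>R w) \<le> M * ((x + t *\<^sub>R w) \<bullet> (x + t *\<^sub>R w))"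
      by (simp add: matrix_vector_add scaleR_eq_smult matrix_vector_smult)
    moreover have "(A *v x) \<bullet> x = M" by (simp add: M_def)
    moreover have "x \<bullet> x = 1" using x by (simp add: dot_square_norm)
    moreover have "(A *v w) \<bullet> x = (A *v x) \<bullet> w" by (rule sym)
    moreover have "(A *v x) \<bullet> w = w \<bullet> w + M * (x \<bullet> w)"
      by (simp add: w_def scaleR_eq_smult[symmetric] algebra_simps inner_simps)
    ultimately show "2 * t * (w \<bullet> w) \<le> t\<^sup>2 * (M * (w \<bullet> w) - (A *v w) \<bullet> w)"
      by (simp add: inner_simps inner_commute[of w x] algebra_simps power2_eq_square)
  qed
  then have "w = 0" using inner_ge_zero[of w] inner_eq_zero_iff[of w] by linarith
  then show ?thesis
    using x by (intro exI[of _ x] exI[of _ M]) (auto simp: w_def V_def cip_self)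
qed

text \<open>Indexing by subsets of \<open>'n\<close> makes the induction end with exactly one
  eigenvector for each column of a square matrix.\<close>

lemma hermitian_orthonormal_eigenvectors:
  fixes A :: "('n::finite) cmat" and I :: "'n set"
  assumes A: "cadjoint A = A"
  shows "finite I \<Longrightarrow> \<exists>f p. \<forall>i\<in>I. A *v f i = of_real (p i) *s f i \<and> (\<forall>j\<in>I. cip (f i) (f j) = (if i = j then 1 else 0))"
proof (induction I rule: finite_induct)
  case (insert k I)
  then obtain f p where fp: "\<And>i. i \<in> I \<Longrightarrow> A *v f i = of_real (p i) *s f i"
      "\<And>i j. i \<in> I \<Longrightarrow> j \<in> I \<Longrightarrow> cip (f i) (f j) = (if i = j then 1 else 0)"
    by blast
  obtain x M where x: "cip x x = 1" "\<And>i. i \<in> I \<Longrightarrow> cip x (f i) = 0" "A *v x = of_real M *s x"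
    using hermitian_eigenvector_exists[OF A, of I f p] insert fp by blast
  have x': "cip (f i) x = 0" if "i \<in> I" for i
    using x(2)[OF that] cip_cnj[of x "f i"] by simp
  show ?case
    by (rule exI[of _ "f(k := x)"], rule exI[of _ "p(k := M)"]) (use fp x x' insert in auto)
qed simp

lemma hermitian_diagonalizable:
  fixes A :: "('n::finite) cmat"
  assumes A: "cadjoint A = A"
  obtains U p where "cunitary U" "A = U ** rdiag p ** cadjoint U"
proof -
  obtain f :: "'n \<Rightarrow> complex^'n" and p where f: "\<And>i. A *v f i = of_real (p i) *s f i"
      "\<And>i j. cip (f i) (f j) = (if i = j then 1 else 0)"
    using hermitian_orthonormal_eigenvectors[OF A finite_class.finite_UNIV] by auto
  define U :: "'n cmat" where "U = (\<chi> r i. f i $ r)"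
  have "cadjoint U ** U = mat 1"
  proof -
    have "(cadjoint U ** U) $ i $ j = cip (f j) (f i)" for i j
      by (simp add: matrix_matrix_mult_def U_def cip_def mult.commute)
    then show ?thesis by (simp add: vec_eq_iff f mat_nth)
  qed
  then have U: "cunitary U" using matrix_left_right_inverse cunitary_def by blast
  have "A ** U = U ** rdiag (\<chi> i. p i)"
  proof -
    have "(A ** U) $ r $ i = (A *v f i) $ r" for r i
      by (simp add: matrix_matrix_mult_def matrix_vector_mult_def U_def)
    then show ?thesis by (simp add: vec_eq_iff f diag_mat_mult_right U_def mult.commute)
  qed
  then have "A = U ** rdiag (\<chi> i. p i) ** cadjoint U"
    using U by (metis cunitaryD(2) matrix_mul_assoc matrix_mul_rid)
  with U that show ?thesis by blast
qed

text \<open>The change of basis \<open>W\<close> intertwines the two diagonal matrices, so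
  \<open>W $ i $ j\<close> can be nonzero only where \<open>p $ j = q $ i\<close>. There
  \<open>f\<close> takes the same value, hence \<open>W\<close> also intertwines the images under
  \<open>f\<close>. This justifies the \<open>THE\<close> in \<open>psd_powr\<close>.\<close>

lemma diagonalization_unique:
  fixes U V :: "('n::finite) cmat" and f :: "real \<Rightarrow> real"
  assumes U: "cunitary U" and V: "cunitary V"
    and eq: "U ** rdiag p ** cadjoint U = V ** rdiag q ** cadjoint V"
  shows "U ** rdiag (\<chi> i. f (p $ i)) ** cadjoint U = V ** rdiag (\<chi> i. f (q $ i)) ** cadjoint V"
proof -
  define W where "W = cadjoint V ** U"
  have "W ** rdiag p = cadjoint V ** (U ** rdiag p ** cadjoint U) ** U"
    by (simp add: W_def matrix_mul_assoc[symmetric] cunitaryD[OF U])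
  also have "\<dots> = rdiag q ** W"
    unfolding eq by (simp add: W_def matrix_mul_assoc[symmetric] cunitaryD[OF V])
  finally have "(W ** rdiag p) $ i $ j = (rdiag q ** W) $ i $ j" for i j by simp
  then have "W $ i $ j = 0 \<or> p $ j = q $ i" for i j
    by (simp add: diag_mat_mult_left diag_mat_mult_right)
  then have W: "W ** rdiag (\<chi> i. f (p $ i)) = rdiag (\<chi> i. f (q $ i)) ** W"
    unfolding vec_eq_iff diag_mat_mult_left diag_mat_mult_right by (metis mult.commute mult_zero_left vec_lambda_beta)
  have "U ** rdiag (\<chi> i. f (p $ i)) ** cadjoint U = V ** (W ** rdiag (\<chi> i. f (p $ i))) ** cadjoint U"
    by (simp add: W_def matrix_mul_assoc[symmetric] cunitaryD[OF V])
  also have "\<dots> = V ** rdiag (\<chi> i. f (q $ i)) ** cadjoint V"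
    unfolding W by (simp add: W_def matrix_mul_assoc[symmetric] cunitaryD[OF U])
  finally show ?thesis .
qed

section \<open>Real powers of the modulus and the transform of an invertible matrix\<close>

lemma psd_powr_eq:
  fixes U :: "('n::finite) cmat"
  assumes U: "cunitary U" and p: "\<And>i. 0 \<le> p $ i"
  shows "psd_powr (U ** rdiag p ** cadjoint U) t = U ** rdiag (\<chi> i. p $ i powr t) ** cadjoint U"
  unfolding psd_powr_def
proof (rule the_equality)
  show "\<exists>V q. cunitary V \<and> (\<forall>i. 0 \<le> q $ i) \<and>
      U ** rdiag p ** cadjoint U = V ** rdiag q ** cadjoint V \<and>
      U ** rdiag (\<chi> i. p $ i powr t) ** cadjoint U = V ** diag_mat (\<chi> i. complex_of_real (q $ i powr t)) ** cadjoint V"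
    using U p by (intro exI[of _ U] exI[of _ p]) simp
next
  fix Q
  assume "\<exists>V q. cunitary V \<and> (\<forall>i. 0 \<le> q $ i) \<and>
      U ** rdiag p ** cadjoint U = V ** rdiag q ** cadjoint V \<and>
      Q = V ** diag_mat (\<chi> i. complex_of_real (q $ i powr t)) ** cadjoint V"
  then show "Q = U ** rdiag (\<chi> i. p $ i powr t) ** cadjoint U"
    using diagonalization_unique[OF U, of _ p _ "\<lambda>x. x powr t"] by auto
qed

text \<open>Each \<open>p $ i\<close> is the squared length of a column of \<open>T ** U\<close>,
  and no column of an invertible matrix is zero.\<close>

lemma gram_diagonalization:
  fixes T :: "('n::finite) cmat"
  assumes T: "invertible T"
  obtains U p where "cunitary U" "\<And>i. 0 < p $ i" "cadjoint T ** T = U ** rdiag p ** cadjoint U"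
proof -
  have "cadjoint (cadjoint T ** T) = cadjoint T ** T" by (simp add: cadjoint_mult)
  then obtain U p where U: "cunitary U" and eq: "cadjoint T ** T = U ** rdiag p ** cadjoint U"
    using hermitian_diagonalizable by blast
  have "0 < p $ i" for i
  proof -
    define S where "S = T ** U"
    have "cadjoint S ** S = cadjoint U ** (cadjoint T ** T) ** U"
      by (simp add: S_def cadjoint_mult matrix_mul_assoc)
    also have "\<dots> = rdiag p"
      unfolding eq by (simp add: matrix_mul_assoc[symmetric] cunitaryD[OF U])
    finally have S: "cadjoint S ** S = rdiag p" .
    have "complex_of_real (p $ i) = (cadjoint S ** S) $ i $ i"
      by (simp add: S diag_mat_nth)
    also have "\<dots> = of_real (\<Sum>k\<in>UNIV. (cmod (S $ k $ i))\<^sup>2)"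
      unfolding of_real_sum complex_norm_square by (simp add: matrix_matrix_mult_def mult.commute)
    finally have p: "p $ i = (\<Sum>k\<in>UNIV. (cmod (S $ k $ i))\<^sup>2)" using of_real_eq_iff by blast
    have "invertible S" unfolding S_def by (intro invertible_mult T cunitary_invertible[OF U])
    then have "column i S \<noteq> 0"
      by (metis det_zero_column(1) invertible_det_nz zero_neq_one)
    then obtain k where "S $ k $ i \<noteq> 0" by (auto simp: vec_eq_iff column_def)
    then show ?thesis
      unfolding p by (intro sum_pos2[of _ k]) auto
  qed
  with U eq that show ?thesis by blast
qed

text \<open>This is \<open>|T|^s\<close> taken directly from \<open>T^* T\<close>, without forming
  the square root first; halving the exponent accounts for the square.\<close>

definition abs_powr :: "real \<Rightarrow> ('n::finite) cmat \<Rightarrow> 'n cmat" where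
  "abs_powr s T = psd_powr (cadjoint T ** T) (s / 2)"

lemma abs_powr_eq:
  assumes "cunitary U" "\<And>i. 0 < p $ i" "cadjoint T ** T = U ** rdiag p ** cadjoint U"
  shows "abs_powr s T = U ** rdiag (\<chi> i. p $ i powr (s / 2)) ** cadjoint U"
  unfolding abs_powr_def assms(3) by (rule psd_powr_eq) (use assms in \<open>auto intro: less_imp_le\<close>)

lemma abs_powr_add:
  assumes "invertible T"
  shows "abs_powr s T ** abs_powr t T = abs_powr (s + t) T"
proof -
  obtain U p where U: "cunitary U" "\<And>i. 0 < p $ i" "cadjoint T ** T = U ** rdiag p ** cadjoint U"
    using gram_diagonalization[OF assms] by blast
  have "abs_powr s T ** abs_powr t T =
      U ** (rdiag (\<chi> i. p $ i powr (s / 2)) ** rdiag (\<chi> i. p $ i powr (t / 2))) ** cadjoint U"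
    unfolding abs_powr_eq[OF U] by (simp add: matrix_mul_assoc[symmetric] cunitaryD[OF U(1)])
  also have "rdiag (\<chi> i. p $ i powr (s / 2)) ** rdiag (\<chi> i. p $ i powr (t / 2)) =
      rdiag (\<chi> i. p $ i powr ((s + t) / 2))"
    unfolding diag_mat_mult by (simp add: powr_add add_divide_distrib)
  finally show ?thesis unfolding abs_powr_eq[OF U] .
qed

lemma abs_powr_0:
  assumes "invertible T"
  shows "abs_powr 0 T = mat 1"
proof -
  obtain U p where U: "cunitary U" "\<And>i. 0 < p $ i" "cadjoint T ** T = U ** rdiag p ** cadjoint U"
    using gram_diagonalization[OF assms] by blast
  have "(\<chi> i. complex_of_real (p $ i powr 0)) = (\<chi> i. 1)" using U(2) by (simp add: vec_eq_iff less_imp_neq[symmetric])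
  then show ?thesis
    unfolding abs_powr_eq[OF U] by (simp add: diag_mat_one cunitaryD[OF U(1)])
qed

lemma invertible_abs_powr:
  assumes "invertible T"
  shows "invertible (abs_powr s T)" "matrix_inv (abs_powr s T) = abs_powr (- s) T"
proof -
  have "abs_powr (- s) T ** abs_powr s T = mat 1"
    by (simp add: abs_powr_add abs_powr_0 assms)
  then show "invertible (abs_powr s T)" "matrix_inv (abs_powr s T) = abs_powr (- s) T"
    using invertible_left_inverse matrix_inv_eqI by blast+
qed

lemma abs_powr_unitary_conj:
  assumes T: "invertible T" and V: "cunitary V"
  shows "abs_powr s (V ** T ** cadjoint V) = V ** abs_powr s T ** cadjoint V"
proof -
  obtain U p where U: "cunitary U" "\<And>i. 0 < p $ i" "cadjoint T ** T = U ** rdiag p ** cadjoint U"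
    using gram_diagonalization[OF T] by blast
  have "cadjoint (V ** T ** cadjoint V) ** (V ** T ** cadjoint V) = V ** (cadjoint T ** T) ** cadjoint V"
    by (simp add: cadjoint_mult matrix_mul_assoc[symmetric] cunitaryD[OF V])
  also have "\<dots> = (V ** U) ** rdiag p ** cadjoint (V ** U)"
    unfolding U(3) by (simp add: cadjoint_mult matrix_mul_assoc[symmetric])
  finally show ?thesis
    using abs_powr_eq[OF cunitary_mult[OF V U(1)] U(2)] abs_powr_eq[OF U]
    by (simp add: cadjoint_mult matrix_mul_assoc)
qed

lemma mat_abs_eq: "invertible T \<Longrightarrow> mat_abs T = abs_powr 1 T"
  by (simp add: mat_abs_def abs_powr_def)

lemma psd_powr_mat_abs:
  assumes "invertible T"
  shows "psd_powr (mat_abs T) s = abs_powr s T"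
proof -
  obtain U p where U: "cunitary U" "\<And>i. 0 < p $ i" "cadjoint T ** T = U ** rdiag p ** cadjoint U"
    using gram_diagonalization[OF assms] by blast
  have "psd_powr (U ** rdiag (\<chi> i. p $ i powr (1/2)) ** cadjoint U) s
      = U ** rdiag (\<chi> i. (\<chi> i. p $ i powr (1/2)) $ i powr s) ** cadjoint U"
    by (rule psd_powr_eq) (use U in auto)
  then show ?thesis
    unfolding mat_abs_eq[OF assms] abs_powr_eq[OF U] by (simp add: powr_powr)
qed

lemma cadjoint_abs_powr:
  assumes "invertible T"
  shows "cadjoint (abs_powr s T) = abs_powr s T"
proof -
  obtain U p where U: "cunitary U" "\<And>i. 0 < p $ i" "cadjoint T ** T = U ** rdiag p ** cadjoint U"
    using gram_diagonalization[OF assms] by blast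
  show ?thesis
    unfolding abs_powr_eq[OF U] by (simp add: cadjoint_mult cadjoint_diag_mat matrix_mul_assoc)
qed

lemma abs_powr_2: "invertible T \<Longrightarrow> abs_powr 2 T = cadjoint T ** T"
proof -
  assume "invertible T"
  then obtain U p where U: "cunitary U" "\<And>i. 0 < p $ i" "cadjoint T ** T = U ** rdiag p ** cadjoint U"
    using gram_diagonalization by blast
  show ?thesis
    unfolding abs_powr_eq[OF U] using U by (simp add: less_imp_le)
qed

text \<open>The \<open>SOME\<close> in \<open>aluthge\<close> has no freedom here: an invertible
  modulus forces the unitary factor to be \<open>T |T|^-1\<close>. This matrix is indeed unitary,
  because \<open>|T|^-1 (T^* T) |T|^-1\<close> is the identity.\<close>

lemma aluthge_invertible:
  assumes T: "invertible T"
  shows "aluthge lam T = abs_powr lam T ** T ** abs_powr (- lam) T"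
proof -
  define V where "V = T ** abs_powr (-1) T"
  have "cadjoint V ** V = abs_powr (-1) T ** (cadjoint T ** T) ** abs_powr (-1) T"
    by (simp add: V_def cadjoint_mult cadjoint_abs_powr T matrix_mul_assoc)
  also have "\<dots> = mat 1"
    by (simp add: abs_powr_2[symmetric] abs_powr_add abs_powr_0 T)
  finally have "cunitary V" using matrix_left_right_inverse cunitary_def by blast
  moreover have "T = V ** mat_abs T"
    by (simp add: V_def mat_abs_eq T abs_powr_add abs_powr_0 matrix_mul_assoc[symmetric])
  ultimately have "\<exists>U. cunitary U \<and> T = U ** mat_abs T" by blast
  define W where "W = (SOME U. cunitary U \<and> T = U ** mat_abs T)"
  have "T = W ** mat_abs T"
    using someI_ex[OF \<open>\<exists>U. cunitary U \<and> T = U ** mat_abs T\<close>] by (simp add: W_def)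
  then have "T ** abs_powr (-1) T = W"
    by (metis T abs_powr_0 abs_powr_add add.right_inverse mat_abs_eq matrix_mul_assoc matrix_mul_rid)
  have "aluthge lam T = abs_powr lam T ** W ** abs_powr (1 - lam) T"
    by (simp add: aluthge_def W_def[symmetric] psd_powr_mat_abs T)
  also have "\<dots> = abs_powr lam T ** T ** (abs_powr (-1) T ** abs_powr (1 - lam) T)"
    unfolding \<open>T ** abs_powr (-1) T = W\<close>[symmetric] by (simp add: matrix_mul_assoc)
  finally show ?thesis by (simp add: abs_powr_add T)
qed

lemma aluthge_unitary_conj:
  assumes T: "invertible T" and V: "cunitary V"
  shows "aluthge lam (V ** T ** cadjoint V) = V ** aluthge lam T ** cadjoint V"
proof -
  have "invertible (V ** T ** cadjoint V)"
    by (intro invertible_mult T cunitary_invertible[OF V] cunitary_invertible[OF cunitary_cadjoint[OF V]])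
  then show ?thesis
    unfolding aluthge_invertible[OF T] abs_powr_unitary_conj[OF T V]
    by (simp add: aluthge_invertible abs_powr_unitary_conj[OF T V])
      (simp add: matrix_mul_assoc[symmetric] cunitaryD[OF V])
qed


subsection \<open>Powers of the modulus as resolvent integrals\<close>

text \<open>Cauchy-Schwarz in each row. The norm of the matrix type is the Frobenius norm, whereas
  the spectral estimates below need an operator bound.\<close>

lemma norm_matrix_vector_le:
  fixes A :: "('n::finite) cmat"
  shows "norm (A *v x) \<le> norm A * norm x"
proof -
  have "cmod ((A *v x) $ i) \<le> norm (A $ i) * norm x" for i
  proof -
    have "cmod ((A *v x) $ i) \<le> (\<Sum>j\<in>UNIV. cmod (A $ i $ j) * cmod (x $ j))"
      by (simp add: matrix_vector_mult_def norm_mult[symmetric] norm_sum)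
    also have "\<dots> \<le> L2_set (\<lambda>j. cmod (A $ i $ j)) UNIV * L2_set (\<lambda>j. cmod (x $ j)) UNIV"
      using L2_set_mult_ineq[of "\<lambda>j. cmod (A $ i $ j)" "\<lambda>j. cmod (x $ j)" UNIV] by simp
    finally show ?thesis by (simp add: norm_vec_def)
  qed
  then have "norm (A *v x) \<le> L2_set (\<lambda>i. norm (A $ i) * norm x) UNIV"
    unfolding norm_vec_def[of "A *v x"] by (intro L2_set_mono) auto
  also have "\<dots> = norm A * norm x"
    unfolding norm_vec_def[of A] by (simp add: L2_set_left_distrib)
  finally show ?thesis .
qed

lemma norm_cunitary_vector:
  assumes "cunitary U"
  shows "norm (U *v x) = norm x"
proof -
  have "cip (U *v x) (U *v x) = cip x x"
    unfolding cip_matrix_vector using assms by (simp add: matrix_vector_mul_assoc cunitaryD)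
  then have "(norm (U *v x))\<^sup>2 = (norm x)\<^sup>2"
    unfolding cip_self of_real_eq_iff .
  then show ?thesis by simp
qed

lemma norm_rdiag_vector_le:
  assumes "\<And>i. \<bar>q $ i\<bar> \<le> b" "0 \<le> b"
  shows "norm (rdiag q *v x) \<le> b * norm x"
proof -
  have "(rdiag q *v x) $ i = of_real (q $ i) * x $ i" for i
    by (simp add: matrix_vector_mult_def diag_mat_nth if_distrib[of "\<lambda>x. x * _"] cong: if_cong)
  then have "cmod ((rdiag q *v x) $ i) \<le> b * cmod (x $ i)" for i
    using mult_right_mono[OF assms(1)[of i], of "cmod (x $ i)"] by (simp add: norm_mult)
  then have "norm (rdiag q *v x) \<le> L2_set (\<lambda>i. b * cmod (x $ i)) UNIV"
    unfolding norm_vec_def[of "rdiag q *v x"] by (intro L2_set_mono) auto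
  also have "\<dots> = b * norm x"
    unfolding norm_vec_def using assms(2) by (simp add: L2_set_right_distrib)
  finally show ?thesis .
qed

lemma mat_vector: "mat c *v x = c *s (x :: complex^'n)"
  by (simp add: vec_eq_iff matrix_vector_mult_def mat_nth if_distrib[of "\<lambda>x. x * _"] cong: if_cong)

lemma matrix_vector_diff: "(A - B) *v x = A *v x - B *v (x :: complex^'n)"
  by (simp add: vec_eq_iff matrix_vector_mult_def sum_subtractf algebra_simps)

lemma norm_smult: "norm (c *s x) = cmod c * norm (x :: complex^'n)"
  by (simp add: norm_vec_def norm_mult L2_set_right_distrib)

lemma mat_mult_commute: "mat c ** A = A ** mat (c :: complex)"
  by (simp add: vec_eq_iff matrix_matrix_mult_def mat_nth if_distrib[of "\<lambda>x. x * _"] if_distrib[of "\<lambda>x. _ * x"] mult.commute cong: if_cong)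

lemma mat_minus_diagonalization:
  assumes U: "cunitary U"
  shows "mat z - U ** diag_mat p ** cadjoint U = U ** diag_mat (\<chi> i. z - p $ i) ** cadjoint U"
proof -
  have "diag_mat (\<chi> i. z - p $ i) = mat z - diag_mat p"
    by (auto simp: vec_eq_iff diag_mat_nth mat_nth)
  then have "U ** diag_mat (\<chi> i. z - p $ i) ** cadjoint U = U ** mat z ** cadjoint U - U ** diag_mat p ** cadjoint U"
    by (simp add: mmult.diff_left mmult.diff_right)
  also have "U ** mat z ** cadjoint U = mat z"
    unfolding mat_mult_commute[of z U, symmetric] by (simp add: matrix_mul_assoc[symmetric] cunitaryD[OF U])
  finally show ?thesis by simp
qed

lemma matrix_inv_diagonalization:
  assumes U: "cunitary U" and p: "\<And>i. p $ i \<noteq> 0"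
  shows "matrix_inv (U ** diag_mat p ** cadjoint U) = U ** diag_mat (\<chi> i. inverse (p $ i)) ** cadjoint U"
proof (rule matrix_inv_eqI)
  have "U ** diag_mat (\<chi> i. inverse (p $ i)) ** cadjoint U ** (U ** diag_mat p ** cadjoint U)
      = U ** (diag_mat (\<chi> i. inverse (p $ i)) ** diag_mat p) ** cadjoint U"
    by (simp add: matrix_mul_assoc[symmetric] cunitaryD[OF U])
  also have "\<dots> = mat 1"
    by (simp add: diag_mat_mult p diag_mat_one cunitaryD[OF U])
  finally show "U ** diag_mat (\<chi> i. inverse (p $ i)) ** cadjoint U ** (U ** diag_mat p ** cadjoint U) = mat 1" .
qed

text \<open>The circle about \<open>c\<close> of radius \<open>r\<close> lies in the right half plane and encloses the spectrum of
  \<open>T\<^sup>* T\<close> for all \<open>T \<in> W\<close>.\<close>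

definition spectral_circle :: "real \<Rightarrow> real \<Rightarrow> ('n::finite) cmat set \<Rightarrow> bool" where
  "spectral_circle c r W \<longleftrightarrow> 0 < r \<and> r < c \<and> open W \<and> (\<forall>T\<in>W. invertible T \<and>
    (\<forall>z. cmod (z - of_real c) = r \<longrightarrow> invertible (mat z - cadjoint T ** T)) \<and>
    (\<forall>U p i. cunitary U \<longrightarrow> cadjoint T ** T = U ** rdiag p ** cadjoint U \<longrightarrow> \<bar>p $ i - c\<bar> < r))"

text \<open>The spectrum of \<open>T\<^sup>* T\<close> lies within distance \<open>\<parallel>T\<^sup>* T - c\<parallel>\<close> (operator norm) of \<open>c\<close>, which is
  stable under small perturbations of \<open>T\<close>.\<close>

lemma spectral_circle_exists:
  fixes T0 :: "('n::finite) cmat"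
  assumes T0: "invertible T0"
  obtains c r W where "spectral_circle c r W" "T0 \<in> W"
proof -
  obtain U p where U: "cunitary U" "\<And>i. 0 < p $ i" "cadjoint T0 ** T0 = U ** rdiag p ** cadjoint U"
    using gram_diagonalization[OF T0] by blast
  define c where "c = Max (range (($) p))"
  define m where "m = Min (range (($) p))"
  have mc: "p $ i \<le> c" "m \<le> p $ i" for i by (auto simp: c_def m_def)
  have "m \<in> range (($) p)" unfolding m_def by (intro Min_in) auto
  then have "m > 0" using U by auto
  \<comment> \<open>The spectrum of \<open>T0^* T0\<close> lies in \<open>[m, c]\<close>, within
    \<open>c - m\<close> of the centre \<open>c\<close>. Increasing this radius by
    \<open>m / 2\<close> leaves room for a perturbation and still keeps \<open>r < c\<close>, so the
    disc avoids 0.\<close>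
  define r where "r = c - m / 2"
  have r: "0 < r" "r < c" "c - m < r" 
    using \<open>m > 0\<close> order_trans[OF mc(2) mc(1)] by (simp_all add: r_def)
  define W where "W = {T. norm (cadjoint T ** T - cadjoint T0 ** T0) < r - (c - m)}"
  have "open W"
    unfolding W_def
    by (intro open_Collect_less continuous_intros mmult.continuous_on
        bounded_linear.continuous_on[OF bounded_linear_cadjoint])
  have key: "norm ((cadjoint T ** T - mat (of_real c)) *v x) < r * norm x" if "T \<in> W" "x \<noteq> 0" for T x
  proof -
    have "cadjoint T0 ** T0 - mat (of_real c) = U ** rdiag (\<chi> i. p $ i - c) ** cadjoint U"
    proof -
      have "mat (of_real c) - cadjoint T0 ** T0 = U ** rdiag (\<chi> i. c - p $ i) ** cadjoint U"
        unfolding U(3) mat_minus_diagonalization[OF U(1)] by simp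
      then have "cadjoint T0 ** T0 - mat (of_real c) = - (U ** rdiag (\<chi> i. c - p $ i) ** cadjoint U)"
        by (metis minus_diff_eq)
      also have "\<dots> = U ** (- rdiag (\<chi> i. c - p $ i)) ** cadjoint U"
        by (simp add: mmult.minus_left mmult.minus_right)
      also have "- rdiag (\<chi> i. c - p $ i) = rdiag (\<chi> i. p $ i - c)"
        by (auto simp: vec_eq_iff diag_mat_nth)
      finally show ?thesis .
    qed
    moreover have "norm ((U ** rdiag (\<chi> i. p $ i - c) ** cadjoint U) *v x) \<le> (c - m) * norm x"
    proof -
      have "norm ((U ** rdiag (\<chi> i. p $ i - c) ** cadjoint U) *v x)
          = norm (rdiag (\<chi> i. p $ i - c) *v (cadjoint U *v x))"
        by (simp add: matrix_vector_mul_assoc[symmetric] norm_cunitary_vector[OF U(1)])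
      also have "\<dots> \<le> (c - m) * norm (cadjoint U *v x)"
        using mc order_trans[OF mc(2) mc(1)] by (intro norm_rdiag_vector_le) (auto simp: abs_le_iff algebra_simps)
      finally show ?thesis by (simp add: norm_cunitary_vector cunitary_cadjoint U)
    qed
    ultimately have 1: "norm ((cadjoint T0 ** T0 - mat (of_real c)) *v x) \<le> (c - m) * norm x" by simp
    have 2: "norm ((cadjoint T ** T - cadjoint T0 ** T0) *v x) < (r - (c - m)) * norm x"
      using that by (intro le_less_trans[OF norm_matrix_vector_le] mult_strict_right_mono) (auto simp: W_def)
    have "(cadjoint T ** T - mat (of_real c)) *v x =
        (cadjoint T ** T - cadjoint T0 ** T0) *v x + (cadjoint T0 ** T0 - mat (of_real c)) *v x"
      by (simp add: matrix_vector_diff)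
    also have "norm \<dots> < (r - (c - m)) * norm x + (c - m) * norm x"
      by (rule le_less_trans[OF norm_triangle_ineq]) (intro add_less_le_mono 1 2)
    finally show ?thesis by (simp add: algebra_simps)
  qed
  show thesis
  proof (rule that, unfold spectral_circle_def, intro conjI ballI allI impI)
    show "0 < r" "r < c" "open W" "T0 \<in> W" using r \<open>open W\<close> by (simp_all add: W_def)
    fix T assume T: "T \<in> W"
    \<comment> \<open>This and the next two claims all contradict \<open>key\<close> when they fail:
      a kernel vector of \<open>T\<close>, an eigenvector for a point of the circle and one for an
      eigenvalue not inside it are all stretched by \<open>T^* T - c\<close> by a factor of at least
      \<open>r\<close>.\<close>
    show "invertible T"
      unfolding invertible_left_inverse matrix_left_invertible_ker
    proof (intro allI impI, rule ccontr)
      fix x assume x: "T *v x = 0" "x \<noteq> 0"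
      then have "(cadjoint T ** T - mat (of_real c)) *v x = - (of_real c *s x)"
        by (simp add: matrix_vector_diff matrix_vector_mul_assoc[symmetric] mat_vector)
      then show False using key[OF T x(2)] r x(2) by (simp add: norm_smult)
    qed
    show "invertible (mat z - cadjoint T ** T)" if z: "cmod (z - of_real c) = r" for z
      unfolding invertible_left_inverse matrix_left_invertible_ker
    proof (intro allI impI, rule ccontr)
      fix x assume x: "(mat z - cadjoint T ** T) *v x = 0" "x \<noteq> 0"
      then have "(cadjoint T ** T - mat (of_real c)) *v x = (z - of_real c) *s x"
        by (simp add: matrix_vector_diff mat_vector vector_sub_rdistrib)
      then show False using key[OF T x(2)] norm_smult[of "z - of_real c" x] z by simp
    qed
    show "\<bar>q $ i - c\<bar> < r" if V: "cunitary V" "cadjoint T ** T = V ** rdiag q ** cadjoint V" for V q i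
    proof -
      define x where "x = V *v axis i 1"
      have nx: "norm x = 1" by (simp add: x_def norm_cunitary_vector V(1))
      have "(cadjoint T ** T) *v x = (V ** rdiag q) *v axis i 1"
        by (simp add: x_def V matrix_vector_mul_assoc matrix_mul_assoc[symmetric] cunitaryD[OF V(1)])
      also have "\<dots> = of_real (q $ i) *s x"
        by (simp add: x_def matrix_vector_mul_assoc[symmetric] matrix_vector_smult[symmetric])
           (rule arg_cong[of _ _ "(*v) V"], simp add: vec_eq_iff matrix_vector_mult_def diag_mat_nth axis_def
             if_distrib[of "\<lambda>x. x * _"] if_distrib[of "\<lambda>x. _ * x"] cong: if_cong)
      finally have "(cadjoint T ** T - mat (of_real c)) *v x = of_real (q $ i - c) *s x"
        by (simp add: matrix_vector_diff mat_vector vector_sub_rdistrib)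
      moreover have "x \<noteq> 0" using nx by auto
      ultimately show ?thesis using key[OF T, of x] nx by (simp add: norm_smult del: of_real_diff)
    qed
  qed
qed

text \<open>\<open>ddpow s a b\<close> is the divided difference of \<open>x \<mapsto> x powr (s / 2)\<close> at \<open>a\<^sup>2\<close> and \<open>b\<^sup>2\<close>.\<close>

definition ddpow :: "real \<Rightarrow> real \<Rightarrow> real \<Rightarrow> real" where
  "ddpow s a b = (if a = b then s / 2 * a powr (s - 2) else (a powr s - b powr s) / (a\<^sup>2 - b\<^sup>2))"

text \<open>The Cauchy integrand without its factor \<open>1 / (z - p)\<close>, pulled back to the
  parameter interval. It turns contour integrals into ordinary integrals of a resolvent times a
  weight.\<close>

definition circle_weight :: "real \<Rightarrow> real \<Rightarrow> real \<Rightarrow> real \<Rightarrow> complex" where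
  "circle_weight c r s t = circlepath (of_real c) r t powr of_real (s / 2)
     * vector_derivative (circlepath (of_real c) r) (at t) / (2 * of_real pi * \<i>)"

section \<open>Scalar Cauchy integrals over the circle\<close>

lemma cmod_circlepath: "0 < r \<Longrightarrow> cmod (circlepath z r t - z) = r"
  by (simp add: circlepath norm_mult)

text \<open>Keeps the closed disc off the branch cut, so that the principal power is holomorphic on
  it.\<close>

lemma circle_right_half_plane:
  assumes "r < c" "z \<in> cball (of_real c) r"
  shows "z \<notin> \<real>\<^sub>\<le>\<^sub>0" "0 < Re z"
proof -
  have "c - Re z \<le> cmod (of_real c - z)" using complex_Re_le_cmod[of "of_real c - z"] by simp
  then show "0 < Re z" using assms by (simp add: dist_norm)
  then show "z \<notin> \<real>\<^sub>\<le>\<^sub>0" by (auto simp: complex_nonpos_Reals_iff)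
qed

lemma continuous_circle_weight:
  assumes "0 < r" "r < c"
  shows "continuous_on S (circle_weight c r s)"
proof -
  have z: "circlepath (of_real c) r t \<notin> \<real>\<^sub>\<le>\<^sub>0" "0 < Re (circlepath (of_real c) r t)" for t
    using circle_right_half_plane[OF assms(2), of "circlepath (of_real c) r t"]
      cmod_circlepath[OF assms(1), of "of_real c" t] by (auto simp: dist_norm norm_minus_commute)
  have z0: "circlepath (of_real c) r t \<noteq> 0" for t using z(2)[of t] by auto
  have cp: "continuous_on S (circlepath (of_real c) r)"
    unfolding circlepath by (intro continuous_intros)
  show ?thesis
    unfolding circle_weight_def vector_derivative_circlepath
    by (intro continuous_on_divide continuous_on_mult continuous_on_powr_complex cp continuous_on_const
        continuous_on_exp continuous_on_of_real continuous_on_id)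
      (use z0 less_imp_le[OF z(2)] in \<open>auto simp del: of_real_divide\<close>)
qed

lemma has_integral_circle_weight:
  assumes "r < c" "\<bar>p - c\<bar> < r"
  shows "((\<lambda>t. circle_weight c r s t / (circlepath (of_real c) r t - of_real p)) has_integral of_real (p powr (s / 2))) {0..1}"
proof -
  have "(\<lambda>z. z powr complex_of_real (s / 2)) holomorphic_on cball (of_real c) r"
    using circle_right_half_plane[OF assms(1)] by (intro holomorphic_intros) auto
  then have "((\<lambda>u. u powr of_real (s / 2) / (u - of_real p)) has_contour_integral
      (2 * of_real pi * \<i> * (of_real p powr of_real (s / 2)))) (circlepath (of_real c) r)"
    using assms by (intro Cauchy_integral_circlepath_simple) (simp_all flip: of_real_diff)
  then have "((\<lambda>t. circlepath (of_real c) r t powr of_real (s / 2) / (circlepath (of_real c) r t - of_real p)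
      * vector_derivative (circlepath (of_real c) r) (at t)) has_integral
      (2 * of_real pi * \<i> * (of_real p powr of_real (s / 2)))) {0..1}"
    by (simp add: has_contour_integral)
  from has_integral_divide[OF this, of "2 * of_real pi * \<i>"]
  have "((\<lambda>t. circle_weight c r s t / (circlepath (of_real c) r t - of_real p)) has_integral
      of_real p powr of_real (s / 2)) {0..1}"
    by (simp add: circle_weight_def mult_ac)
  moreover have "complex_of_real p powr of_real (s / 2) = of_real (p powr (s / 2))"
    using assms by (intro powr_of_real) auto
  ultimately show ?thesis by simp
qed

lemma powr_square_half: "0 < a \<Longrightarrow> (a\<^sup>2) powr (s / 2) = a powr (s :: real)"
  by (simp add: powr_half_sqrt_powr powr_powr flip: powr_numeral)

text \<open>For \<open>a = b\<close> this is Cauchy's formula for the first derivative. For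
  \<open>a \<noteq> b\<close> partial fractions reduce it to the difference of two Cauchy formulas
  for values.\<close>

lemma has_integral_circle_weight_divided_difference:
  assumes rc: "r < c" and a: "0 < a" "\<bar>a\<^sup>2 - c\<bar> < r" and b: "0 < b" "\<bar>b\<^sup>2 - c\<bar> < r"
  shows "((\<lambda>t. circle_weight c r s t / ((circlepath (of_real c) r t - of_real (a\<^sup>2)) * (circlepath (of_real c) r t - of_real (b\<^sup>2))))
    has_integral of_real (ddpow s a b)) {0..1}"
proof (cases "a = b")
  case True
  define f where "f = (\<lambda>z. z powr complex_of_real (s / 2))"
  have hol: "f holomorphic_on cball (of_real c) r"
    unfolding f_def using circle_right_half_plane[OF rc] by (intro holomorphic_intros) auto
  have "((\<lambda>u. f u / (u - of_real (a\<^sup>2)) ^ Suc 1) has_contour_integral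
      (2 * pi * \<i> / fact 1 * (deriv ^^ 1) f (of_real (a\<^sup>2)))) (circlepath (of_real c) r)"
    using a hol by (intro Cauchy_has_contour_integral_higher_derivative_circlepath)
      (auto simp: dist_norm abs_minus_commute simp flip: of_real_diff of_real_power
        intro: holomorphic_on_imp_continuous_on holomorphic_on_subset)
  moreover have "(deriv ^^ 1) f (of_real (a\<^sup>2)) = of_real (ddpow s a b)"
  proof -
    have "complex_of_real (a\<^sup>2) \<notin> \<real>\<^sub>\<le>\<^sub>0" using a by (simp add: complex_nonpos_Reals_iff del: of_real_power)
    then have "(f has_field_derivative (of_real (s / 2) * of_real (a\<^sup>2) powr (of_real (s / 2) - 1))) (at (of_real (a\<^sup>2)))"
      unfolding f_def by (rule has_field_derivative_powr)
    then have "(deriv ^^ 1) f (of_real (a\<^sup>2)) = of_real (s / 2) * of_real (a\<^sup>2) powr of_real (s / 2 - 1)"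
      by (simp add: DERIV_imp_deriv)
    also have "complex_of_real (a\<^sup>2) powr of_real (s / 2 - 1) = of_real (a\<^sup>2 powr (s / 2 - 1))"
      by (rule powr_of_real) simp
    also have "a\<^sup>2 powr (s / 2 - 1) = a powr (s - 2)"
      using powr_square_half[OF a(1), of "s - 2"] by (simp add: diff_divide_distrib)
    finally show ?thesis using True by (simp add: ddpow_def)
  qed
  ultimately have "((\<lambda>u. f u / (u - of_real (a\<^sup>2)) ^ Suc 1) has_contour_integral
      (2 * of_real pi * \<i> * of_real (ddpow s a b))) (circlepath (of_real c) r)" by simp
  then have "((\<lambda>t. f (circlepath (of_real c) r t) / (circlepath (of_real c) r t - of_real (a\<^sup>2)) ^ Suc 1
      * vector_derivative (circlepath (of_real c) r) (at t)) has_integral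
      (2 * of_real pi * \<i> * of_real (ddpow s a b))) {0..1}"
    unfolding has_contour_integral .
  from has_integral_divide[OF this, of "2 * of_real pi * \<i>"] show ?thesis
    using True by (simp add: circle_weight_def f_def mult_ac power2_eq_square)
next
  case False
  let ?g = "circlepath (of_real c) r"
  have ne: "?g t \<noteq> of_real p" if "\<bar>p - c\<bar> < r" for p t
  proof
    assume "?g t = of_real p"
    then have "cmod (of_real p - of_real c) = r"
      using that cmod_circlepath[of r "of_real c" t] by simp
    then show False using that by (simp flip: of_real_diff)
  qed
  have ab: "a\<^sup>2 \<noteq> b\<^sup>2" using False a b by (simp add: power2_eq_iff_nonneg)
  have "((\<lambda>t. (circle_weight c r s t / (?g t - of_real (a\<^sup>2)) - circle_weight c r s t / (?g t - of_real (b\<^sup>2))) / of_real (a\<^sup>2 - b\<^sup>2))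
      has_integral (of_real ((a\<^sup>2) powr (s / 2)) - of_real ((b\<^sup>2) powr (s / 2))) / of_real (a\<^sup>2 - b\<^sup>2)) {0..1}"
    by (intro has_integral_divide has_integral_diff has_integral_circle_weight rc a b)
  moreover have "(of_real ((a\<^sup>2) powr (s / 2)) - of_real ((b\<^sup>2) powr (s / 2))) / of_real (a\<^sup>2 - b\<^sup>2) = complex_of_real (ddpow s a b)"
    using False by (simp add: ddpow_def powr_square_half a b)
  moreover have "(w / (z - x) - w / (z - y)) / (x - y) = w / ((z - x) * (z - y))"
    if "z \<noteq> x" "z \<noteq> y" "x \<noteq> y" for w x y z :: complex
    using that by (simp add: divide_simps) (simp add: algebra_simps)
  then have "(circle_weight c r s t / (?g t - of_real (a\<^sup>2)) - circle_weight c r s t / (?g t - of_real (b\<^sup>2))) / of_real (a\<^sup>2 - b\<^sup>2)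
      = circle_weight c r s t / ((?g t - of_real (a\<^sup>2)) * (?g t - of_real (b\<^sup>2)))" for t
    using ne[OF a(2)] ne[OF b(2)] ab by (simp only: of_real_diff of_real_eq_iff not_False_eq_True)
  ultimately show ?thesis by simp
qed

section \<open>Resolvents of the Gram matrix and their integrals\<close>

lemma mat_eq_diag: "mat c = diag_mat (\<chi> i. c)"
  by (simp add: vec_eq_iff mat_nth diag_mat_nth)

lemma Basis_vecE:
  assumes "b \<in> (Basis :: ('a::euclidean_space^'n::finite) set)"
  obtains i u where "b = axis i u" "u \<in> Basis"
  using assms unfolding Basis_vec_def by blast

lemma has_integral_matrix:
  fixes f :: "real \<Rightarrow> ('n::finite) cmat"
  assumes "\<And>i j. ((\<lambda>t. f t $ i $ j) has_integral I $ i $ j) S"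
  shows "(f has_integral I) S"
proof (subst has_integral_componentwise_iff, rule ballI)
  fix b :: "'n cmat"
  assume "b \<in> Basis"
  then obtain i v where v: "b = axis i v" "v \<in> Basis" by (rule Basis_vecE)
  from v(2) obtain j u where u: "v = axis j u" "u \<in> Basis" by (rule Basis_vecE)
  have "((\<lambda>t. f t $ i $ j \<bullet> u) has_integral I $ i $ j \<bullet> u) S"
    by (rule has_integral_componentwise_iff[THEN iffD1, OF assms[of i j], THEN bspec, OF u(2)])
  then show "((\<lambda>t. f t \<bullet> b) has_integral I \<bullet> b) S"
    by (simp only: v(1) u(1) inner_axis)
qed

text \<open>The point of the circle and the weight are independent variables here. The map is
  therefore smooth in all arguments jointly, and the dependence on the integration variable sits in
  the continuous curve \<open>circle_param\<close>.\<close>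

definition gram_resolvent :: "(complex \<times> complex) \<times> ('n::finite) cmat \<Rightarrow> 'n cmat" where
  "gram_resolvent y = mat (snd (fst y)) ** matrix_inv (mat (fst (fst y)) - cadjoint (snd y) ** snd y)"

definition gram_resolvent_set :: "((complex \<times> complex) \<times> ('n::finite) cmat) set" where
  "gram_resolvent_set = {y. invertible (mat (fst (fst y)) - cadjoint (snd y) ** snd y)}"

lemma higher_differentiable_on_gram:
  assumes "open W"
  shows "higher_differentiable_on W
    (\<lambda>y :: (complex \<times> complex) \<times> ('n::finite) cmat. mat (fst (fst y)) - cadjoint (snd y) ** snd y) n"
  apply (rule higher_differentiable_on_diff[OF assms])
   apply (rule higher_differentiable_on_linear[OF assms])
   apply (rule bounded_linear_compose[OF bounded_linear_mat bounded_linear_fst_comp[OF bounded_linear_fst]])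
  apply (rule higher_differentiable_on_mult[OF assms])
   apply (rule higher_differentiable_on_linear[OF assms])
   apply (rule bounded_linear_compose[OF bounded_linear_cadjoint bounded_linear_snd])
  apply (rule higher_differentiable_on_linear[OF assms bounded_linear_snd])
  done

lemma open_gram_resolvent_set: "open (gram_resolvent_set :: ((complex \<times> complex) \<times> ('n::finite) cmat) set)"
proof -
  have "continuous_on UNIV (\<lambda>y :: (complex \<times> complex) \<times> 'n cmat. mat (fst (fst y)) - cadjoint (snd y) ** snd y)"
    by (intro higher_differentiable_on_continuous[OF higher_differentiable_on_gram]) simp
  from open_vimage[OF open_invertible this] show ?thesis
    by (simp add: gram_resolvent_set_def vimage_def)
qed

lemma higher_differentiable_on_gram_resolvent: "higher_differentiable_on gram_resolvent_set gram_resolvent n"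
  unfolding gram_resolvent_def
  apply (rule higher_differentiable_on_mult[OF open_gram_resolvent_set])
   apply (rule higher_differentiable_on_linear[OF open_gram_resolvent_set])
   apply (rule bounded_linear_compose[OF bounded_linear_mat bounded_linear_snd_comp[OF bounded_linear_fst]])
  apply (rule higher_differentiable_on_matrix_inv[OF open_gram_resolvent_set])
   apply (simp add: gram_resolvent_set_def)
  apply (rule higher_differentiable_on_gram[OF open_gram_resolvent_set])
  done

text \<open>The minus sign from differentiating the inverse cancels the one in
  \<open>z - T^* T\<close>. The chosen \<open>frechet_derivative\<close> is identified by uniqueness
  along the slice where \<open>z\<close> and \<open>w\<close> are fixed.\<close>

lemma frechet_derivative_gram_resolvent:
  assumes "((z, w), T) \<in> gram_resolvent_set"
  shows "frechet_derivative gram_resolvent (at ((z, w), T)) (0, H) =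
    mat w ** (matrix_inv (mat z - cadjoint T ** T) ** (cadjoint H ** T + cadjoint T ** H) **
      matrix_inv (mat z - cadjoint T ** T))"
proof -
  have "((\<lambda>T. ((z, w), T)) has_derivative (\<lambda>H. (0, H))) (at T)"
    by (intro has_derivative_Pair has_derivative_const has_derivative_ident)
  from has_derivative_compose[OF this higher_differentiable_onD[OF higher_differentiable_on_gram_resolvent assms]]
  have 1: "((\<lambda>T. gram_resolvent ((z, w), T)) has_derivative
      (\<lambda>H. frechet_derivative gram_resolvent (at ((z, w), T)) (0, H))) (at T)" .
  have G: "((\<lambda>T. mat z - cadjoint T ** T) has_derivative (\<lambda>H. 0 - (cadjoint T ** H + cadjoint H ** T))) (at T)"
    by (rule has_derivative_diff[OF has_derivative_const mmult.FDERIV[OF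
        bounded_linear_imp_has_derivative[OF bounded_linear_cadjoint] has_derivative_ident]])
  have "((\<lambda>T. gram_resolvent ((z, w), T)) has_derivative (\<lambda>H. mat w **
      - (matrix_inv (mat z - cadjoint T ** T) ** (0 - (cadjoint T ** H + cadjoint H ** T)) ** matrix_inv (mat z - cadjoint T ** T)))) (at T)"
    unfolding gram_resolvent_def fst_conv snd_conv
    using assms
    by (intro bounded_linear.has_derivative[OF mmult.bounded_linear_right] has_derivative_matrix_inv_compose[OF G])
      (simp add: gram_resolvent_set_def)
  from has_derivative_unique[OF 1 this]
  have "frechet_derivative gram_resolvent (at ((z, w), T)) (0, H) = mat w **
      - (matrix_inv (mat z - cadjoint T ** T) ** (0 - (cadjoint T ** H + cadjoint H ** T)) ** matrix_inv (mat z - cadjoint T ** T))"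
    by (rule fun_cong)
  also have "0 - (cadjoint T ** H + cadjoint H ** T) = - (cadjoint H ** T + cadjoint T ** H)" by simp
  finally show ?thesis by (simp only: mmult.minus_left mmult.minus_right minus_minus)
qed

definition circle_param :: "real \<Rightarrow> real \<Rightarrow> real \<Rightarrow> real \<Rightarrow> complex \<times> complex" where
  "circle_param c r s t = (circlepath (of_real c) r t, circle_weight c r s t)"

lemma continuous_circle_param: "0 < r \<Longrightarrow> r < c \<Longrightarrow> continuous_on S (circle_param c r s)"
  unfolding circle_param_def
  apply (rule continuous_on_Pair)
   apply (unfold circlepath)
   apply (intro continuous_intros)
  apply (rule continuous_circle_weight)
   apply assumption+
  done

lemma gram_resolvent_diagonalization:
  assumes U: "cunitary U" and T: "cadjoint T ** T = U ** diag_mat p ** cadjoint U" and "\<And>i. p $ i \<noteq> z"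
  shows "gram_resolvent ((z, w), T) = U ** diag_mat (\<chi> i. w / (z - p $ i)) ** cadjoint U"
proof -
  have "gram_resolvent ((z, w), T) = mat w ** (U ** diag_mat (\<chi> i. inverse (z - p $ i)) ** cadjoint U)"
    unfolding gram_resolvent_def fst_conv snd_conv T mat_minus_diagonalization[OF U]
    by (subst matrix_inv_diagonalization[OF U]) (simp_all add: assms(3)[THEN not_sym])
  also have "\<dots> = U ** (mat w ** diag_mat (\<chi> i. inverse (z - p $ i))) ** cadjoint U"
    by (simp add: matrix_mul_assoc mat_mult_commute[of w U])
  also have "mat w ** diag_mat (\<chi> i. inverse (z - p $ i)) = diag_mat (\<chi> i. w / (z - p $ i))"
    by (auto simp: vec_eq_iff diag_mat_mult_right mat_nth diag_mat_nth divide_inverse)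
  finally show ?thesis .
qed

lemma conj_diag_nth: "(U ** diag_mat p ** cadjoint U) $ i $ j = (\<Sum>k\<in>UNIV. U $ i $ k * p $ k * cnj (U $ j $ k))"
  unfolding matrix_matrix_mult_def[of "U ** diag_mat p"] by (simp add: diag_mat_mult_right)

text \<open>In a unitary diagonalization of \<open>T^* T\<close> the resolvent is diagonal too, and
  each diagonal entry is a scalar Cauchy integral.\<close>

lemma abs_powr_integral:
  assumes rc: "0 < r" "r < c" and T: "invertible T"
    and p: "\<And>U p i. cunitary U \<Longrightarrow> cadjoint T ** T = U ** rdiag p ** cadjoint U \<Longrightarrow> \<bar>p $ i - c\<bar> < r"
  shows "abs_powr s T = integral (cbox 0 1) (\<lambda>t. gram_resolvent (circle_param c r s t, T))"
proof -
  obtain U p where U: "cunitary U" "\<And>i. 0 < p $ i" "cadjoint T ** T = U ** rdiag p ** cadjoint U"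
    using gram_diagonalization[OF T] by blast
  have pc: "\<bar>p $ i - c\<bar> < r" for i using p U by blast
  have ne: "complex_of_real (p $ i) \<noteq> circlepath (of_real c) r t" for i t
    using cmod_circlepath[OF rc(1), of "of_real c" t] pc[of i] by (metis norm_of_real of_real_diff order_less_irrefl)
  have "((\<lambda>t. gram_resolvent (circle_param c r s t, T)) has_integral abs_powr s T) {0..1}"
  proof (rule has_integral_matrix)
    fix i j
    have "((\<lambda>t. \<Sum>k\<in>UNIV. U $ i $ k * (circle_weight c r s t / (circlepath (of_real c) r t - of_real (p $ k))) * cnj (U $ j $ k))
      has_integral (\<Sum>k\<in>UNIV. U $ i $ k * of_real (p $ k powr (s / 2)) * cnj (U $ j $ k))) {0..1}"
      by (intro has_integral_sum has_integral_mult_left has_integral_mult_right has_integral_circle_weight rc pc finite)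
    then show "((\<lambda>t. gram_resolvent (circle_param c r s t, T) $ i $ j) has_integral abs_powr s T $ i $ j) {0..1}"
      unfolding abs_powr_eq[OF U] circle_param_def
      by (simp add: gram_resolvent_diagonalization[OF U(1,3)] ne conj_diag_nth)
  qed
  then show ?thesis by (simp add: integral_unique)
qed

lemma spectral_circleD:
  fixes W :: "('n::finite) cmat set"
  assumes "spectral_circle c r W"
  shows "0 < r" "r < c" "open W" "T \<in> W \<Longrightarrow> invertible T"
    "T \<in> W \<Longrightarrow> (circle_param c r s t, T) \<in> gram_resolvent_set"
    "T \<in> W \<Longrightarrow> cunitary U \<Longrightarrow> cadjoint T ** T = U ** rdiag p ** cadjoint U \<Longrightarrow> \<bar>p $ i - c\<bar> < r"
    "T \<in> W \<Longrightarrow> abs_powr s T = integral (cbox 0 1) (\<lambda>t. gram_resolvent (circle_param c r s t, T))"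
proof -
  show rc: "0 < r" "r < c" "open W" and inv: "T \<in> W \<Longrightarrow> invertible T"
    using assms by (auto simp: spectral_circle_def)
  show p: "T \<in> W \<Longrightarrow> cunitary U \<Longrightarrow> cadjoint T ** T = U ** rdiag p ** cadjoint U \<Longrightarrow> \<bar>p $ i - c\<bar> < r"
    for U p i using assms by (simp add: spectral_circle_def)
  show "T \<in> W \<Longrightarrow> (circle_param c r s t, T) \<in> gram_resolvent_set"
    using assms by (simp add: spectral_circle_def gram_resolvent_set_def circle_param_def cmod_circlepath)
  show "T \<in> W \<Longrightarrow> abs_powr s T = integral (cbox 0 1) (\<lambda>t. gram_resolvent (circle_param c r s t, T))"
    by (rule abs_powr_integral[OF rc(1,2) inv p])
qed

lemma aluthge_smooth_local:
  fixes T0 :: "('n::finite) cmat"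
  assumes T0: "invertible T0"
  obtains W where "T0 \<in> W" "smooth_on_open W (aluthge lam)"
proof -
  obtain c r W where W: "spectral_circle c r W" and T0W: "T0 \<in> W"
    using spectral_circle_exists[OF T0] by blast
  note W = spectral_circleD[OF W]
  have A: "higher_differentiable_on W (abs_powr s) n" for s n
  proof (rule higher_differentiable_on_cong[OF W(3)])
    show "higher_differentiable_on W (\<lambda>T. integral (cbox 0 1) (\<lambda>t. gram_resolvent (circle_param c r s t, T))) n"
      by (rule higher_differentiable_on_integral[OF W(3) continuous_circle_param[OF W(1,2)] W(5)
            higher_differentiable_on_gram_resolvent])
  qed (simp add: W(7))
  have "higher_differentiable_on W (aluthge lam) n" for n
  proof (rule higher_differentiable_on_cong[OF W(3)])
    show "higher_differentiable_on W (\<lambda>T. abs_powr lam T ** T ** abs_powr (- lam) T) n"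
      by (intro higher_differentiable_on_mult A W(3) higher_differentiable_on_linear bounded_linear_ident)
    show "abs_powr lam T ** T ** abs_powr (- lam) T = aluthge lam T" if "T \<in> W" for T
      using aluthge_invertible[OF W(4)[OF that], of lam] by simp
  qed
  with W(3) T0W that show ?thesis by (auto simp: smooth_on_open_def)
qed

section \<open>The derivative of the powers of the modulus at a diagonal matrix\<close>

lemma invertible_diag_mat: "invertible (diag_mat d) \<longleftrightarrow> (\<forall>i. d $ i \<noteq> 0)"
proof -
  have "det (diag_mat d) = (\<Prod>i\<in>UNIV. d $ i)"
    by (subst det_diagonal) (simp_all add: diag_mat_nth)
  then show ?thesis by (simp add: invertible_det_nz)
qed

lemma gram_diag_mat: "cadjoint (diag_mat d) ** diag_mat d = mat 1 ** rdiag (\<chi> i. (cmod (d $ i))\<^sup>2) ** cadjoint (mat 1)"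
  by (auto simp: vec_eq_iff cadjoint_diag_mat diag_mat_mult cadjoint_mat diag_mat_nth complex_norm_square
      mult.commute simp del: of_real_power)

lemma abs_powr_diag_mat:
  assumes "\<And>i. d $ i \<noteq> 0"
  shows "abs_powr s (diag_mat d) = rdiag (\<chi> i. cmod (d $ i) powr s)"
proof -
  have "abs_powr s (diag_mat d) = mat 1 ** rdiag (\<chi> i. (\<chi> i. (cmod (d $ i))\<^sup>2) $ i powr (s / 2)) ** cadjoint (mat 1)"
    by (rule abs_powr_eq[OF cunitary_one _ gram_diag_mat]) (simp add: assms)
  then show ?thesis by (simp add: powr_square_half assms cadjoint_mat)
qed

text \<open>A Daleckii-Krein formula. At a diagonal matrix both resolvents in the sandwich are
  diagonal, so they multiply each entry of \<open>H^* D + D^* H\<close> by a scalar, and the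
  integral of that scalar is a divided difference.\<close>

lemma has_derivative_abs_powr_diag_mat:
  fixes d :: "complex^'n::finite"
  assumes d: "\<And>i. d $ i \<noteq> 0"
  shows "(abs_powr s has_derivative (\<lambda>H. \<chi> i j. of_real (ddpow s (cmod (d $ i)) (cmod (d $ j))) *
    (cnj (H $ j $ i) * d $ j + cnj (d $ i) * H $ i $ j))) (at (diag_mat d))"
proof -
  let ?D = "diag_mat d"
  have inv: "invertible ?D" using d by (simp add: invertible_diag_mat)
  obtain c r W where W: "spectral_circle c r W" and DW: "?D \<in> W"
    using spectral_circle_exists[OF inv] by blast
  note W = spectral_circleD[OF W]
  let ?F = "\<lambda>T. integral (cbox 0 1) (\<lambda>t. gram_resolvent (circle_param c r s t, T))"
  let ?F' = "\<lambda>H. integral (cbox 0 1) (\<lambda>t. frechet_derivative gram_resolvent (at (circle_param c r s t, ?D)) (0, H))"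
  have pc: "\<bar>(cmod (d $ i))\<^sup>2 - c\<bar> < r" for i
    using W(6)[OF DW cunitary_one gram_diag_mat, of i] by simp
  let ?g = "circlepath (of_real c) r"
  have ne: "?g t \<noteq> of_real ((cmod (d $ i))\<^sup>2)" for i t
    using cmod_circlepath[OF W(1), of "of_real c" t] pc[of i] by (metis norm_of_real of_real_diff order_less_irrefl)
  have entry: "frechet_derivative gram_resolvent (at (circle_param c r s t, ?D)) (0, H) $ i $ j =
      circle_weight c r s t / ((?g t - of_real ((cmod (d $ i))\<^sup>2)) * (?g t - of_real ((cmod (d $ j))\<^sup>2))) *
      (cnj (H $ j $ i) * d $ j + cnj (d $ i) * H $ i $ j)" for t H i j
  proof -
    let ?w = "circle_weight c r s t" and ?z = "circlepath (of_real c) r t"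
    have "((?z, ?w), ?D) \<in> gram_resolvent_set" using W(5)[OF DW] by (simp add: circle_param_def)
    moreover have "matrix_inv (mat ?z - cadjoint ?D ** ?D) = diag_mat (\<chi> i. inverse (?z - of_real ((cmod (d $ i))\<^sup>2)))"
      unfolding gram_diag_mat mat_minus_diagonalization[OF cunitary_one]
      by (subst matrix_inv_diagonalization[OF cunitary_one])
        (use ne in \<open>simp_all add: cadjoint_mat\<close>)
    ultimately have "frechet_derivative gram_resolvent (at (circle_param c r s t, ?D)) (0, H) =
        diag_mat (\<chi> i. ?w) ** (diag_mat (\<chi> i. inverse (?z - of_real ((cmod (d $ i))\<^sup>2))) **
          (cadjoint H ** ?D + cadjoint ?D ** H) ** diag_mat (\<chi> i. inverse (?z - of_real ((cmod (d $ i))\<^sup>2))))"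
      unfolding circle_param_def mat_eq_diag[symmetric] by (simp only: frechet_derivative_gram_resolvent)
    then show ?thesis
      by (simp add: diag_mat_mult_right diag_mat_mult_left cadjoint_diag_mat divide_inverse mult_ac)
  qed
  have "?F' H = (\<chi> i j. of_real (ddpow s (cmod (d $ i)) (cmod (d $ j))) *
    (cnj (H $ j $ i) * d $ j + cnj (d $ i) * H $ i $ j))" (is "_ = ?I") for H
  proof -
    have "((\<lambda>t. frechet_derivative gram_resolvent (at (circle_param c r s t, ?D)) (0, H)) has_integral ?I) {0..1}"
    proof (rule has_integral_matrix)
      fix i j
      show "((\<lambda>t. frechet_derivative gram_resolvent (at (circle_param c r s t, ?D)) (0, H) $ i $ j)
        has_integral ?I $ i $ j) {0..1}"
        unfolding entry vec_lambda_beta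
        by (rule has_integral_mult_left, rule has_integral_circle_weight_divided_difference[OF W(2) _ pc _ pc]) (simp_all add: d)
    qed
    then show ?thesis by (simp add: integral_unique)
  qed
  moreover have "(?F has_derivative ?F') (at ?D)"
    by (rule has_derivative_integral_param[OF higher_differentiable_on_gram_resolvent W(3)
        continuous_circle_param[OF W(1,2)] W(5) DW])
  then have "(abs_powr s has_derivative ?F') (at ?D)"
    by (rule has_derivative_transform_within_open[OF _ W(3) DW]) (simp add: W(7))
  ultimately show ?thesis by simp
qed


subsection \<open>The derivative at a normal matrix\<close>

lemma ddpow_mult: "0 < a \<Longrightarrow> 0 < b \<Longrightarrow> ddpow s a b * (b\<^sup>2 - a\<^sup>2) = b powr s - a powr s"
proof (cases "a = b")
  case False
  assume ab: "0 < a" "0 < b"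
  then have "a\<^sup>2 - b\<^sup>2 \<noteq> 0" using False by (simp add: power2_eq_iff_nonneg)
  then show ?thesis using False by (simp add: ddpow_def field_simps)
qed (simp add: ddpow_def)

lemma ddpow_commute: "ddpow s a b = ddpow s b a"
  unfolding ddpow_def by (simp, metis minus_diff_eq minus_divide_divide)

text \<open>The entrywise form of the derivative of \<open>|T|^s |T|^(-s) = 1\<close>.\<close>

lemma ddpow_uminus:
  assumes "0 < a" "0 < b"
  shows "a powr s * ddpow (- s) a b = - (ddpow s a b * b powr (- s))"
proof (cases "a = b")
  case True
  have "a powr s * (a powr (- s - 2)) = a powr (- 2)" "a powr (s - 2) * a powr (- s) = a powr (- 2)"
    by (simp_all flip: powr_add)
  then show ?thesis using True by (simp add: ddpow_def)
next
  case False
  have "a powr s * (a powr (- s) - b powr (- s)) = - ((a powr s - b powr s) * b powr (- s))"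
    using assms by (simp add: algebra_simps flip: powr_add)
  then show ?thesis using False by (simp add: ddpow_def)
qed

text \<open>With \<open>x = d $ i\<close> and \<open>y = d $ j\<close>, this and
  \<open>aluthge_coeff_cnj\<close> multiply \<open>X_ij\<close> and \<open>cnj X_ji\<close> in the
  derivative at \<open>diag_mat d\<close>. The derivatives of the two outer powers combine, by
  \<open>ddpow_uminus\<close>, into one term with the factor \<open>y - x\<close>; differentiating
  the middle factor \<open>T\<close> gives the last summand.\<close>

definition aluthge_coeff :: "real \<Rightarrow> complex \<Rightarrow> complex \<Rightarrow> complex" where
  "aluthge_coeff lam x y = of_real (ddpow lam (cmod x) (cmod y) * cmod y powr (- lam)) * cnj x * (y - x)
    + of_real (cmod x powr lam * cmod y powr (- lam))"

definition aluthge_coeff_cnj :: "real \<Rightarrow> complex \<Rightarrow> complex \<Rightarrow> complex" where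
  "aluthge_coeff_cnj lam x y = of_real (ddpow lam (cmod x) (cmod y) * cmod y powr (- lam)) * y * (y - x)"

definition aluthge_deriv :: "real \<Rightarrow> complex^'n \<Rightarrow> 'n cmat \<Rightarrow> ('n::finite) cmat" where
  "aluthge_deriv lam d X = (\<chi> i j. aluthge_coeff lam (d $ i) (d $ j) * X $ i $ j
    + aluthge_coeff_cnj lam (d $ i) (d $ j) * cnj (X $ j $ i))"

lemma has_derivative_aluthge_diag_mat:
  fixes d :: "complex^'n::finite"
  assumes d: "\<And>i. d $ i \<noteq> 0"
  shows "(aluthge lam has_derivative aluthge_deriv lam d) (at (diag_mat d))"
proof -
  let ?D = "diag_mat d"
  let ?R' = "\<lambda>s H. \<chi> i j. of_real (ddpow s (cmod (d $ i)) (cmod (d $ j))) *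
    (cnj (H $ j $ i) * d $ j + cnj (d $ i) * H $ i $ j)"
  have "((\<lambda>T. abs_powr lam T ** T ** abs_powr (- lam) T) has_derivative
     (\<lambda>H. abs_powr lam ?D ** ?D ** ?R' (- lam) H + (abs_powr lam ?D ** H + ?R' lam H ** ?D) ** abs_powr (- lam) ?D)) (at ?D)"
    by (rule mmult.FDERIV[OF mmult.FDERIV[OF has_derivative_abs_powr_diag_mat[OF d] has_derivative_ident]
        has_derivative_abs_powr_diag_mat[OF d]])
  moreover have "abs_powr lam ?D ** ?D ** ?R' (- lam) H + (abs_powr lam ?D ** H + ?R' lam H ** ?D) ** abs_powr (- lam) ?D
      = aluthge_deriv lam d H" for H
  proof -
    have "(abs_powr lam ?D ** ?D ** ?R' (- lam) H + (abs_powr lam ?D ** H + ?R' lam H ** ?D) ** abs_powr (- lam) ?D) $ i $ j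
      = aluthge_deriv lam d H $ i $ j" for i j
    proof -
      let ?a = "cmod (d $ i)" and ?b = "cmod (d $ j)"
      let ?G = "cnj (H $ j $ i) * d $ j + cnj (d $ i) * H $ i $ j"
      have "(abs_powr lam ?D ** ?D ** ?R' (- lam) H + (abs_powr lam ?D ** H + ?R' lam H ** ?D) ** abs_powr (- lam) ?D) $ i $ j
        = of_real (?a powr lam * ddpow (- lam) ?a ?b) * d $ i * ?G
          + (of_real (?a powr lam) * H $ i $ j + of_real (ddpow lam ?a ?b) * ?G * d $ j) * of_real (?b powr (- lam))"
        unfolding abs_powr_diag_mat[OF d] diag_mat_mult
        by (simp add: diag_mat_mult_left diag_mat_mult_right mult_ac)
      also have "\<dots> = aluthge_deriv lam d H $ i $ j"
        unfolding ddpow_uminus[of ?a ?b lam, simplified, OF d d]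
        by (simp add: aluthge_deriv_def aluthge_coeff_def aluthge_coeff_cnj_def) (simp add: algebra_simps)
      finally show ?thesis .
    qed
    then show ?thesis by (simp add: vec_eq_iff)
  qed
  ultimately have "((\<lambda>T. abs_powr lam T ** T ** abs_powr (- lam) T) has_derivative aluthge_deriv lam d) (at ?D)"
    by simp
  then show ?thesis
    by (rule has_derivative_transform_within_open[OF _ open_invertible])
      (use d in \<open>simp_all add: invertible_diag_mat aluthge_invertible\<close>)
qed

lemma has_derivative_aluthge_unitary_conj:
  fixes d :: "complex^'n::finite"
  assumes d: "\<And>i. d $ i \<noteq> 0" and U: "cunitary U"
  shows "(aluthge lam has_derivative (\<lambda>X. U ** aluthge_deriv lam d (cadjoint U ** X ** U) ** cadjoint U))
    (at (U ** diag_mat d ** cadjoint U))"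
proof -
  let ?D = "diag_mat d" and ?N = "U ** diag_mat d ** cadjoint U"
  have D: "cadjoint U ** ?N ** U = ?D" by (simp add: matrix_mul_assoc[symmetric] cunitaryD[OF U])
  have inner: "((\<lambda>T. cadjoint U ** T ** U) has_derivative (\<lambda>X. cadjoint U ** X ** U)) (at ?N)"
    by (rule bounded_linear_imp_has_derivative)
      (rule bounded_linear_compose[OF mmult.bounded_linear_left mmult.bounded_linear_right])
  have "(aluthge lam has_derivative aluthge_deriv lam d) (at (cadjoint U ** ?N ** U))"
    unfolding D by (rule has_derivative_aluthge_diag_mat[OF d])
  from has_derivative_compose[OF inner this]
  have "((\<lambda>T. aluthge lam (cadjoint U ** T ** U)) has_derivative (\<lambda>X. aluthge_deriv lam d (cadjoint U ** X ** U))) (at ?N)" .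
  from bounded_linear.has_derivative[OF bounded_linear_compose[OF mmult.bounded_linear_left mmult.bounded_linear_right] this]
  have "((\<lambda>T. U ** aluthge lam (cadjoint U ** T ** U) ** cadjoint U) has_derivative
      (\<lambda>X. U ** aluthge_deriv lam d (cadjoint U ** X ** U) ** cadjoint U)) (at ?N)" .
  then show ?thesis
  proof (rule has_derivative_transform_within_open[OF _ open_invertible])
    show "?N \<in> {A. invertible A}"
      using d by (auto intro!: invertible_mult cunitary_invertible[OF U] cunitary_invertible[OF cunitary_cadjoint[OF U]]
          simp: invertible_diag_mat)
    show "U ** aluthge lam (cadjoint U ** T ** U) ** cadjoint U = aluthge lam T" if "T \<in> {A. invertible A}" for T
      using aluthge_unitary_conj[OF _ cunitary_cadjoint[OF U], of T lam] that
      by (simp add: matrix_mul_assoc[symmetric] cunitaryD[OF U])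
  qed
qed

section \<open>The orbits and derivatives within the similarity orbit\<close>

lemma similarity_orbit_conj:
  assumes "N \<in> similarity_orbit D" "invertible G"
  shows "G ** N ** matrix_inv G \<in> similarity_orbit D"
proof -
  obtain S where S: "invertible S" "N = S ** D ** matrix_inv S"
    using assms(1) by (auto simp: similarity_orbit_def)
  have "(matrix_inv S ** matrix_inv G) ** (G ** S) = matrix_inv S ** (matrix_inv G ** G) ** S"
    by (simp add: matrix_mul_assoc)
  then have "matrix_inv (G ** S) = matrix_inv S ** matrix_inv G"
    by (intro matrix_inv_eqI) (simp add: matrix_inv_mult S(1) assms(2))
  then have "G ** N ** matrix_inv G = (G ** S) ** D ** matrix_inv (G ** S)"
    by (simp add: S(2) matrix_mul_assoc)
  then show ?thesis
    using invertible_mult[OF assms(2) S(1)] by (auto simp: similarity_orbit_def)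
qed

lemma unitary_orbit_subset_similarity_orbit: "unitary_orbit D \<subseteq> similarity_orbit D"
proof
  fix N assume "N \<in> unitary_orbit D"
  then obtain U where U: "cunitary U" "N = U ** D ** cadjoint U" by (auto simp: unitary_orbit_def)
  then have "matrix_inv U = cadjoint U" by (intro matrix_inv_eqI cunitaryD)
  then show "N \<in> similarity_orbit D"
    using U(2) cunitary_invertible[OF U(1)] unfolding similarity_orbit_def mem_Collect_eq
    by (intro exI[of _ U]) simp
qed

lemma invertible_similarity_orbit:
  assumes "T \<in> similarity_orbit D" "invertible D"
  shows "invertible T"
proof -
  obtain S where S: "invertible S" "T = S ** D ** matrix_inv S"
    using assms(1) by (auto simp: similarity_orbit_def)
  then have "invertible (matrix_inv S)" using matrix_inv_mult[OF S(1)] by (auto simp: invertible_def)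
  then show ?thesis using S assms(2) by (auto intro!: invertible_mult)
qed

text \<open>Tangent vectors are velocities of the curves \<open>t \<mapsto> (1 + t A) N (1 + t A)\<^sup>-\<^sup>1\<close>, along which a
  derivative within the orbit is determined.\<close>

lemma frechet_derivative_within_similarity_orbit:
  fixes f :: "('n::finite) cmat \<Rightarrow> 'n cmat"
  assumes f: "(f has_derivative f') (at N)" and N: "N \<in> similarity_orbit D"
    and X: "X \<in> tangent_similarity_orbit N"
  shows "frechet_derivative f (at N within similarity_orbit D) X = f' X"
proof -
  let ?S = "similarity_orbit D" and ?g' = "frechet_derivative f (at N within similarity_orbit D)"
  obtain A where A: "X = A ** N - N ** A" using X by (auto simp: tangent_similarity_orbit_def)
  have "f differentiable (at N within ?S)"
    using has_derivative_at_withinI[OF f] by (rule differentiableI)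
  then have g': "(f has_derivative ?g') (at N within ?S)" by (simp add: frechet_derivative_works)
  define G where "G = (\<lambda>t. mat 1 + t *\<^sub>R A)"
  define \<eta> where "\<eta> = (\<lambda>t. G t ** N ** matrix_inv (G t))"
  \<comment> \<open>The curve stays in the orbit only while \<open>G t\<close> is invertible.
    Openness of \<open>K\<close> makes derivatives at 0 unique, so the two expressions for the
    velocity of \<open>f\<close> along the curve agree.\<close>
  define K where "K = G -` {B. invertible B}"
  have G: "(G has_derivative (\<lambda>h. h *\<^sub>R A)) (at t)" for t
    unfolding G_def by (auto intro!: derivative_eq_intros)
  have G0: "G 0 = mat 1" by (simp add: G_def)
  have inv1: "invertible (mat 1 :: 'n cmat)" by (auto simp: invertible_def)
  have K: "open K" "0 \<in> K"
  proof -
    show "open K" unfolding K_def by (intro open_vimage open_invertible) (simp add: G_def continuous_intros)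
    show "0 \<in> K" using inv1 by (simp add: K_def G0)
  qed
  have m1: "matrix_inv (mat 1 :: 'n cmat) = mat 1" by (intro matrix_inv_eqI) simp
  have \<eta>0: "\<eta> 0 = N" by (simp add: \<eta>_def G0 m1)
  have "(\<eta> has_derivative (\<lambda>h. (G 0 ** N) ** - (matrix_inv (G 0) ** (h *\<^sub>R A) ** matrix_inv (G 0)) +
      (G 0 ** 0 + (h *\<^sub>R A) ** N) ** matrix_inv (G 0))) (at 0)"
    unfolding \<eta>_def
    by (rule mmult.FDERIV[OF mmult.FDERIV[OF G has_derivative_const] has_derivative_matrix_inv_compose[OF G]])
      (simp add: G0 inv1)
  then have \<eta>: "(\<eta> has_derivative (\<lambda>h. h *\<^sub>R X)) (at 0)"
    by (simp add: G0 m1 A mmult.minus_right mmult.scaleR_left mmult.scaleR_right scaleR_diff_right mmult.zero_right)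
  have "\<eta> ` K \<subseteq> ?S"
    using similarity_orbit_conj[OF N] by (auto simp: \<eta>_def K_def)
  then have "(f has_derivative ?g') (at (\<eta> 0) within \<eta> ` K)"
    unfolding \<eta>0 by (rule has_derivative_subset[OF g'])
  from has_derivative_in_compose[OF has_derivative_at_withinI[OF \<eta>] this]
  have "((\<lambda>t. f (\<eta> t)) has_derivative (\<lambda>h. ?g' (h *\<^sub>R X))) (at 0)"
    unfolding at_within_open[OF K(2,1)] .
  moreover have "((\<lambda>t. f (\<eta> t)) has_derivative (\<lambda>h. f' (h *\<^sub>R X))) (at 0)"
    using has_derivative_compose[OF \<eta>, of f f'] f by (simp add: \<eta>0)
  ultimately have "(\<lambda>h. ?g' (h *\<^sub>R X)) = (\<lambda>h. f' (h *\<^sub>R X))" by (rule has_derivative_unique)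
  from fun_cong[OF this, of 1] show ?thesis by simp
qed

lemma aluthge_similarity_orbit:
  assumes "invertible D" "T \<in> similarity_orbit D"
  shows "aluthge lam T \<in> similarity_orbit D"
proof -
  have T: "invertible T" by (rule invertible_similarity_orbit[OF assms(2,1)])
  show ?thesis
    unfolding aluthge_invertible[OF T] invertible_abs_powr(2)[OF T, symmetric]
    by (rule similarity_orbit_conj[OF assms(2) invertible_abs_powr(1)[OF T]])
qed


subsection \<open>The scalar 2 by 2 blocks\<close>

text \<open>On the coordinates \<open>X_ij\<close>, \<open>cnj X_ji\<close> the block has the
  diagonal entries \<open>aluthge_coeff lam x y\<close> and
  \<open>cnj (aluthge_coeff lam y x)\<close>. This is its trace minus the eigenvalue 1.\<close>

definition aluthge_eigenvalue :: "real \<Rightarrow> complex \<Rightarrow> complex \<Rightarrow> complex" where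
  "aluthge_eigenvalue lam x y = aluthge_coeff lam x y + cnj (aluthge_coeff lam y x) - 1"

lemma aluthge_eigenvalue_commute: "aluthge_eigenvalue lam y x = cnj (aluthge_eigenvalue lam x y)"
  by (simp add: aluthge_eigenvalue_def)

text \<open>The vector with components \<open>y - x\<close> and \<open>cnj (y - x)\<close> spans the
  block of commutators of \<open>D\<close> with skew-Hermitian matrices, along which the transform
  is constant to first order relative to the identity. Algebraically,
  \<open>cnj x * (y - x) + y * cnj (y - x)\<close> is \<open>|y|^2 - |x|^2\<close>, which cancels
  the denominator of the divided difference.\<close>

lemma aluthge_coeff_fixed:
  assumes "x \<noteq> 0" "y \<noteq> 0"
  shows "aluthge_coeff lam x y * (y - x) + aluthge_coeff_cnj lam x y * cnj (y - x) = y - x"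
proof -
  let ?a = "cmod x" and ?b = "cmod y"
  have "cnj x * (y - x) + y * cnj (y - x) = of_real (?b\<^sup>2 - ?a\<^sup>2)"
    by (simp add: algebra_simps complex_norm_square del: of_real_power)
  then have "of_real (ddpow lam ?a ?b) * (cnj x * (y - x) + y * cnj (y - x)) = complex_of_real (?b powr lam - ?a powr lam)"
    using ddpow_mult[of ?a ?b lam] assms by (simp del: of_real_diff of_real_power flip: of_real_mult)
  moreover have "?b powr (- lam) * (?b powr lam - ?a powr lam) = 1 - ?a powr lam * ?b powr (- lam)"
    using assms by (simp add: algebra_simps flip: powr_add)
  ultimately have "of_real (?b powr (- lam)) * (of_real (ddpow lam ?a ?b) * (cnj x * (y - x) + y * cnj (y - x)))
      = complex_of_real (1 - ?a powr lam * ?b powr (- lam))"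
    by (metis of_real_mult)
  moreover have "aluthge_coeff lam x y * (y - x) + aluthge_coeff_cnj lam x y * cnj (y - x) = (y - x) *
     (of_real (?b powr (- lam)) * (of_real (ddpow lam ?a ?b) * (cnj x * (y - x) + y * cnj (y - x))) + of_real (?a powr lam * ?b powr (- lam)))"
    unfolding aluthge_coeff_def aluthge_coeff_cnj_def by (simp add: algebra_simps)
  ultimately show ?thesis by simp
qed

text \<open>The divided difference is now a derivative and brings a factor \<open>lam / 2\<close>;
  both diagonal entries of the block contribute the same term, which cancels the 2. For
  \<open>y / x = exp (\<i> * (\<theta> j - \<theta> i))\<close> the modulus of the result is a
  member of the second family in \<open>contraction_const\<close>.\<close>

lemma aluthge_eigenvalue_same_modulus:
  assumes "cmod x = cmod y" "x \<noteq> 0"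
  shows "aluthge_eigenvalue lam x y = of_real lam * (y / x - 1) + 1"
proof -
  let ?a = "cmod x"
  have a: "?a > 0" using assms(2) by simp
  have "ddpow lam ?a ?a * ?a powr (- lam) = lam / 2 / ?a\<^sup>2"
    using a by (simp add: ddpow_def powr_minus_divide powr_diff)
  then have c: "complex_of_real (ddpow lam ?a ?a * ?a powr (- lam)) = of_real lam / 2 / (x * cnj x)"
    by (simp add: complex_norm_square[symmetric])
  have xy: "y * cnj y = x * cnj x" using assms(1) by (metis complex_norm_square)
  have "?a powr lam * ?a powr (- lam) = 1" using a by (simp flip: powr_add)
  define k where "k = ddpow lam ?a ?a * ?a powr (- lam)"
  have "aluthge_eigenvalue lam x y = of_real k * (cnj x * (y - x) + y * (cnj x - cnj y)) + 1"
    unfolding aluthge_eigenvalue_def aluthge_coeff_def assms(1)[symmetric] k_def[symmetric]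
    by (simp add: \<open>?a powr lam * ?a powr (- lam) = 1\<close> algebra_simps del: of_real_mult)
  also have "complex_of_real k = of_real lam / 2 / (x * cnj x)" unfolding k_def by (rule c)
  also have "cnj x * (y - x) + y * (cnj x - cnj y) = 2 * (cnj x * (y - x))"
    using xy by (simp add: algebra_simps)
  also have "of_real lam / 2 / (x * cnj x) * (2 * (cnj x * (y - x))) = of_real lam * (y / x - 1)"
    using assms(2) by (simp add: field_simps)
  finally show ?thesis .
qed

text \<open>Over a common denominator the numerator becomes affine in \<open>w\<close>, which will
  be \<open>cnj x * y\<close>, with coefficients that are nonnegative in the application.\<close>

lemma aluthge_eigenvalue_field_identity:
  fixes \<alpha> \<beta> A B w s :: complex
  assumes "\<alpha> \<noteq> 0" "\<beta> \<noteq> 0" "s \<noteq> 0" and s: "s = (\<alpha> * A)\<^sup>2 - (\<beta> * B)\<^sup>2"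
  shows "(\<alpha> - \<beta>) / s * inverse \<beta> * (w - (\<alpha> * A)\<^sup>2) + \<alpha> * inverse \<beta>
      + ((\<alpha> - \<beta>) / s * inverse \<alpha> * (w - (\<beta> * B)\<^sup>2) + \<beta> * inverse \<alpha>) - 1
    = (\<alpha>\<^sup>2 * \<beta>\<^sup>2 * (A\<^sup>2 - B\<^sup>2) + w * (\<alpha>\<^sup>2 - \<beta>\<^sup>2)) / (\<alpha> * \<beta> * s)"
proof -
  have "(\<alpha> - \<beta>) / s * inverse \<beta> * (w - p) + \<alpha> * inverse \<beta>
      + ((\<alpha> - \<beta>) / s * inverse \<alpha> * (w - q) + \<beta> * inverse \<alpha>) - 1
    = ((\<alpha> - \<beta>) * \<alpha> * (w - p) + \<alpha>\<^sup>2 * s + ((\<alpha> - \<beta>) * \<beta> * (w - q) + \<beta>\<^sup>2 * s) - \<alpha> * \<beta> * s) / (\<alpha> * \<beta> * s)" for p q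
    using assms(1-3) by (simp add: field_simps power2_eq_square)
  moreover have "(\<alpha> - \<beta>) * \<alpha> * (w - (\<alpha> * A)\<^sup>2) + \<alpha>\<^sup>2 * s + ((\<alpha> - \<beta>) * \<beta> * (w - (\<beta> * B)\<^sup>2) + \<beta>\<^sup>2 * s) - \<alpha> * \<beta> * s
      = \<alpha>\<^sup>2 * \<beta>\<^sup>2 * (A\<^sup>2 - B\<^sup>2) + w * (\<alpha>\<^sup>2 - \<beta>\<^sup>2)"
    unfolding s by (simp add: power2_eq_square algebra_simps)
  ultimately show ?thesis by simp
qed

text \<open>In terms of \<open>\<alpha> = |x| powr lam\<close>, \<open>A = |x| powr (1 - lam)\<close> and likewise \<open>\<beta>\<close>, \<open>B\<close> for \<open>y\<close>, the bound
  is \<open>(\<beta> A + \<alpha> B) / (\<alpha> A + \<beta> B)\<close>, because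
  \<open>\<alpha> \<beta> (A\<^sup>2 - B\<^sup>2) + A B (\<alpha>\<^sup>2 - \<beta>\<^sup>2) = (\<alpha> A - \<beta> B) (\<beta> A + \<alpha> B)\<close>.\<close>

lemma cmod_aluthge_eigenvalue_less:
  assumes lam: "0 < lam" "lam < 1" and xy: "cmod y < cmod x" "y \<noteq> 0"
  shows "cmod (aluthge_eigenvalue lam x y) \<le>
    (cmod y powr (1 - lam) * cmod x powr lam + cmod x powr (1 - lam) * cmod y powr lam) / (cmod x + cmod y)"
proof -
  define a b where "a = cmod x" and "b = cmod y"
  have ab: "0 < b" "b < a" "0 < a" using xy by (auto simp: a_def b_def intro: order.strict_trans)
  define \<alpha> \<beta> A B where "\<alpha> = a powr lam" and "\<beta> = b powr lam" and "A = a powr (1 - lam)" and "B = b powr (1 - lam)"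
  have pos: "0 < \<alpha>" "0 < \<beta>" "0 < A" "0 < B" using ab by (simp_all add: \<alpha>_def \<beta>_def A_def B_def)
  have a: "a = \<alpha> * A" and b: "b = \<beta> * B"
    using ab by (simp_all add: \<alpha>_def \<beta>_def A_def B_def flip: powr_add)
  have less: "\<beta> < \<alpha>" "B < A"
    using ab lam by (simp_all add: \<alpha>_def \<beta>_def A_def B_def powr_less_mono2)
  have inv: "a powr (- lam) = inverse \<alpha>" "b powr (- lam) = inverse \<beta>"
    by (simp_all add: \<alpha>_def \<beta>_def powr_minus)
  have sq: "a\<^sup>2 - b\<^sup>2 > 0" using ab by (simp add: power_strict_mono)
  define w where "w = cnj x * y"
  have w: "cmod w = a * b" by (simp add: w_def norm_mult a_def b_def)
  have xx: "cnj x * x = of_real (a\<^sup>2)" "cnj y * y = of_real (b\<^sup>2)"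
    by (simp_all add: a_def b_def complex_norm_square mult.commute del: of_real_power)
  have c: "ddpow lam a b = (\<alpha> - \<beta>) / (a\<^sup>2 - b\<^sup>2)" "ddpow lam b a = (\<alpha> - \<beta>) / (a\<^sup>2 - b\<^sup>2)"
    using ab ddpow_commute[of lam b a] by (simp_all add: ddpow_def \<alpha>_def \<beta>_def)
  let ?c = "complex_of_real ((\<alpha> - \<beta>) / (a\<^sup>2 - b\<^sup>2))"
  have "aluthge_eigenvalue lam x y = ?c * of_real (inverse \<beta>) * (w - of_real (a\<^sup>2)) + of_real (\<alpha> * inverse \<beta>) +
      (?c * of_real (inverse \<alpha>) * (w - of_real (b\<^sup>2)) + of_real (\<beta> * inverse \<alpha>)) - 1"
    unfolding aluthge_eigenvalue_def aluthge_coeff_def a_def[symmetric] b_def[symmetric] c inv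
      \<alpha>_def[symmetric] \<beta>_def[symmetric] xx[symmetric] w_def
    by (simp add: algebra_simps)
  also have "\<dots> = (of_real (\<alpha>\<^sup>2 * \<beta>\<^sup>2 * (A\<^sup>2 - B\<^sup>2)) + w * of_real (\<alpha>\<^sup>2 - \<beta>\<^sup>2)) / of_real (\<alpha> * \<beta> * (a\<^sup>2 - b\<^sup>2))"
  proof -
    have ne: "complex_of_real \<alpha> \<noteq> 0" "complex_of_real \<beta> \<noteq> 0" "complex_of_real (a\<^sup>2 - b\<^sup>2) \<noteq> 0"
      using pos sq by (simp_all del: of_real_diff of_real_power)
    define s where "s = complex_of_real (a\<^sup>2 - b\<^sup>2)"
    have s: "s \<noteq> 0" "s = (of_real \<alpha> * of_real A)\<^sup>2 - (of_real \<beta> * of_real B)\<^sup>2"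
      using ne by (simp_all add: s_def a b)
    have e: "complex_of_real (a\<^sup>2) = (of_real \<alpha> * of_real A)\<^sup>2" "complex_of_real (b\<^sup>2) = (of_real \<beta> * of_real B)\<^sup>2"
      "?c = (of_real \<alpha> - of_real \<beta>) / s" "complex_of_real (\<alpha> * \<beta> * (a\<^sup>2 - b\<^sup>2)) = of_real \<alpha> * of_real \<beta> * s"
      "complex_of_real (\<alpha>\<^sup>2 * \<beta>\<^sup>2 * (A\<^sup>2 - B\<^sup>2)) = (of_real \<alpha>)\<^sup>2 * (of_real \<beta>)\<^sup>2 * ((of_real A)\<^sup>2 - (of_real B)\<^sup>2)"
      "complex_of_real (\<alpha>\<^sup>2 - \<beta>\<^sup>2) = (of_real \<alpha>)\<^sup>2 - (of_real \<beta>)\<^sup>2"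
      by (simp_all add: a b s_def)
    show ?thesis
      unfolding e of_real_mult[of \<alpha> "inverse \<beta>"] of_real_mult[of \<beta> "inverse \<alpha>"] of_real_inverse
      by (rule aluthge_eigenvalue_field_identity[OF ne(1,2) s])
  qed
  finally have eq: "aluthge_eigenvalue lam x y =
      (of_real (\<alpha>\<^sup>2 * \<beta>\<^sup>2 * (A\<^sup>2 - B\<^sup>2)) + w * of_real (\<alpha>\<^sup>2 - \<beta>\<^sup>2)) / of_real (\<alpha> * \<beta> * (a\<^sup>2 - b\<^sup>2))" .
  have den: "0 < \<alpha> * \<beta> * (a\<^sup>2 - b\<^sup>2)" using pos sq by simp
  have sq2: "0 \<le> A\<^sup>2 - B\<^sup>2" "0 \<le> \<alpha>\<^sup>2 - \<beta>\<^sup>2" using pos less by (simp_all add: power_mono)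
  \<comment> \<open>Since \<open>cmod w = a * b\<close> and both coefficients are nonnegative, the
    triangle inequality leaves a real expression that factors.\<close>
  have "cmod (of_real (\<alpha>\<^sup>2 * \<beta>\<^sup>2 * (A\<^sup>2 - B\<^sup>2)) + w * of_real (\<alpha>\<^sup>2 - \<beta>\<^sup>2))
      \<le> \<alpha>\<^sup>2 * \<beta>\<^sup>2 * (A\<^sup>2 - B\<^sup>2) + a * b * (\<alpha>\<^sup>2 - \<beta>\<^sup>2)"
    using sq2 by (intro order_trans[OF norm_triangle_ineq] add_mono)
      (simp_all only: norm_mult w norm_of_real abs_mult abs_of_nonneg zero_le_power2 power2_abs order_refl abs_power2)
  also have "\<dots> = (\<beta> * A + \<alpha> * B) / (a + b) * (\<alpha> * \<beta> * (a\<^sup>2 - b\<^sup>2))"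
  proof -
    have "a\<^sup>2 - b\<^sup>2 = (a + b) * (a - b)" by (simp add: power2_eq_square algebra_simps)
    then have "(\<beta> * A + \<alpha> * B) / (a + b) * (\<alpha> * \<beta> * (a\<^sup>2 - b\<^sup>2)) = (\<beta> * A + \<alpha> * B) * (\<alpha> * \<beta> * (a - b))"
      using ab by simp
    then show ?thesis by (simp add: a b power2_eq_square algebra_simps)
  qed
  finally have "cmod (aluthge_eigenvalue lam x y) \<le> (\<beta> * A + \<alpha> * B) / (a + b)"
    unfolding eq norm_divide using den by (simp add: pos_divide_le_eq del: of_real_mult of_real_diff of_real_power of_real_add)
  then show ?thesis by (simp add: \<alpha>_def \<beta>_def A_def B_def a_def b_def algebra_simps)
qed

lemma cmod_aluthge_eigenvalue:
  assumes lam: "0 < lam" "lam < 1" and xy: "cmod x \<noteq> cmod y" "x \<noteq> 0" "y \<noteq> 0"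
  shows "cmod (aluthge_eigenvalue lam x y) \<le>
    (cmod y powr (1 - lam) * cmod x powr lam + cmod x powr (1 - lam) * cmod y powr lam) / (cmod x + cmod y)"
proof (cases "cmod y < cmod x")
  case False
  then have "cmod x < cmod y" using xy by simp
  from cmod_aluthge_eigenvalue_less[OF lam this xy(2)] show ?thesis
    unfolding aluthge_eigenvalue_commute[of lam y x] by (simp add: add.commute)
qed (use cmod_aluthge_eigenvalue_less assms in blast)

text \<open>Denominator minus numerator is \<open>(a^lam - b^lam) (a^(1-lam) - b^(1-lam))\<close>,
  whose factors have the same sign.\<close>

lemma weighted_mean_less_one:
  assumes lam: "0 < lam" "lam < 1" and ab: "0 < a" "0 < b" "a \<noteq> (b::real)"
  shows "(b powr (1 - lam) * a powr lam + a powr (1 - lam) * b powr lam) / (a + b) < 1"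
proof -
  have *: "b powr (1 - lam) * a powr lam + a powr (1 - lam) * b powr lam < a + b" if "b < a" "0 < b" for a b
  proof -
    have "0 < a" using that by simp
    have "0 < (a powr lam - b powr lam) * (a powr (1 - lam) - b powr (1 - lam))"
      using that lam by (intro mult_pos_pos) (simp_all add: powr_less_mono2)
    moreover have "a powr lam * a powr (1 - lam) = a" "b powr lam * b powr (1 - lam) = b"
      using that \<open>0 < a\<close> by (simp_all flip: powr_add)
    ultimately show ?thesis by (simp add: algebra_simps)
  qed
  have "b powr (1 - lam) * a powr lam + a powr (1 - lam) * b powr lam < a + b"
    using *[of b a] *[of a b] ab by (cases "b < a") (simp_all add: algebra_simps)
  then show ?thesis using ab by (simp add: pos_divide_less_eq)
qed

text \<open>The point lies in the interior of the chord from 1 to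
  \<open>exp (\<i> * \<phi>)\<close>; the range of \<open>\<phi>\<close> makes the endpoints
  distinct. Its squared modulus is
  \<open>1 - 2 * lam * (1 - lam) * (1 - cos \<phi>)\<close>.\<close>

lemma cmod_convex_unit_less_one:
  assumes lam: "0 < lam" "lam < 1" and \<phi>: "- 2 * pi < \<phi>" "\<phi> < 2 * pi" "\<phi> \<noteq> 0"
  shows "cmod (of_real lam * (exp (\<i> * of_real \<phi>) - 1) + 1) < 1"
proof -
  have "cos \<phi> \<noteq> 1"
  proof
    assume "cos \<phi> = 1"
    then obtain n :: int where n: "\<phi> = of_int n * 2 * pi" using cos_one_2pi_int by auto
    have "of_int n * 2 * pi < 1 * 2 * pi" "(-1) * 2 * pi < of_int n * 2 * pi" using \<phi> unfolding n by simp_all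
    then have "real_of_int n < 1" "-1 < real_of_int n" by (simp_all only: mult_less_cancel_right) auto
    then have "n = 0" by linarith
    with n \<phi> show False by simp
  qed
  then have c: "cos \<phi> < 1" using cos_le_one[of \<phi>] by linarith
  have "(cmod (of_real lam * (exp (\<i> * of_real \<phi>) - 1) + 1))\<^sup>2 = (lam * (cos \<phi> - 1) + 1)\<^sup>2 + (lam * sin \<phi>)\<^sup>2"
    by (simp add: cmod_power2 Re_exp Im_exp)
  also have "\<dots> = 1 - 2 * lam * (1 - lam) * (1 - cos \<phi>)"
  proof -
    have "(sin \<phi>)\<^sup>2 = 1 - (cos \<phi>)\<^sup>2" by (simp add: sin_squared_eq)
    then show ?thesis by (simp add: power2_eq_square algebra_simps) (simp add: algebra_simps flip: distrib_left)
  qed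
  also have "\<dots> < 1" using lam c by simp
  finally show ?thesis by (simp add: abs_square_less_1[of "cmod _", simplified])
qed

section \<open>Unitary conjugation and the tangent spaces in coordinates\<close>

definition uconj :: "('n::finite) cmat \<Rightarrow> 'n cmat \<Rightarrow> 'n cmat" where
  "uconj U X = U ** X ** cadjoint U"

lemma linear_uconj: "linear (uconj U)"
  unfolding uconj_def linear_conv_bounded_linear
  by (rule bounded_linear_compose[OF mmult.bounded_linear_left mmult.bounded_linear_right])

lemma uconj_cadjoint [simp]:
  assumes "cunitary U"
  shows "uconj (cadjoint U) (uconj U X) = X" "uconj U (uconj (cadjoint U) X) = X"
  by (simp_all add: uconj_def matrix_mul_assoc[symmetric] cunitaryD[OF assms])

lemma uconj_mult: "cunitary U \<Longrightarrow> uconj U X ** uconj U Y = uconj U (X ** Y)"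
  by (simp add: uconj_def matrix_mul_assoc[symmetric] cunitaryD)

lemma cadjoint_uconj: "cadjoint (uconj U X) = uconj U (cadjoint X)"
  by (simp add: uconj_def cadjoint_mult matrix_mul_assoc)

lemma uconj_one: "uconj (mat 1) X = X"
  by (simp add: uconj_def cadjoint_mat)

lemma norm_cmat_power2: "(norm A)\<^sup>2 = (\<Sum>i\<in>UNIV. \<Sum>j\<in>UNIV. (cmod (A $ i $ j))\<^sup>2)"
  for A :: "('n::finite) cmat"
  by (simp add: norm_vec_def L2_set_def sum_nonneg)

lemma norm_cadjoint: "norm (cadjoint A) = norm (A :: ('n::finite) cmat)"
proof -
  have "(norm (cadjoint A))\<^sup>2 = (norm A)\<^sup>2"
    unfolding norm_cmat_power2 by (subst sum.swap) simp
  then show ?thesis by simp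
qed

lemma norm_cunitary_mult:
  fixes U A :: "('n::finite) cmat"
  assumes "cunitary U"
  shows "norm (U ** A) = norm A"
proof -
  have "(norm A)\<^sup>2 = (\<Sum>j\<in>UNIV. (norm (column j A))\<^sup>2)" for A :: "'n cmat"
    unfolding norm_cmat_power2 by (subst sum.swap) (simp add: norm_vec_def L2_set_def sum_nonneg column_def)
  moreover have "column j (U ** A) = U *v column j A" for j
    by (simp add: vec_eq_iff column_def matrix_matrix_mult_def matrix_vector_mult_def)
  ultimately have "(norm (U ** A))\<^sup>2 = (norm A)\<^sup>2"
    by (simp add: norm_cunitary_vector[OF assms])
  then show ?thesis by simp
qed

lemma norm_uconj:
  assumes "cunitary U"
  shows "norm (uconj U X) = norm X"
proof -
  have "norm (uconj U X) = norm (cadjoint (X ** cadjoint U))"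
    by (simp add: uconj_def norm_cadjoint matrix_mul_assoc[symmetric] norm_cunitary_mult[OF assms])
  also have "\<dots> = norm X"
    by (simp add: cadjoint_mult norm_cunitary_mult[OF assms] norm_cadjoint)
  finally show ?thesis .
qed

lemma norm_cmat_le:
  assumes "\<And>i j. cmod (A $ i $ j) \<le> k * cmod (B $ i $ j)" "0 \<le> k"
  shows "norm A \<le> k * norm (B :: ('n::finite) cmat)"
proof -
  have "(norm A)\<^sup>2 \<le> (\<Sum>i\<in>UNIV. \<Sum>j\<in>UNIV. (k * cmod (B $ i $ j))\<^sup>2)"
    unfolding norm_cmat_power2 by (intro sum_mono power_mono assms) simp
  also have "\<dots> = (k * norm B)\<^sup>2"
    unfolding power_mult_distrib norm_cmat_power2 by (simp add: sum_distrib_left)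
  finally show ?thesis using assms(2) by (intro power2_le_imp_le[of "norm A"]) simp_all
qed

lemma tangent_similarity_orbit_uconj:
  assumes U: "cunitary U"
  shows "tangent_similarity_orbit (uconj U N) = uconj U ` tangent_similarity_orbit N"
proof (intro equalityI subsetI)
  fix X assume "X \<in> tangent_similarity_orbit (uconj U N)"
  then obtain A where "X = A ** uconj U N - uconj U N ** A" by (auto simp: tangent_similarity_orbit_def)
  then have "X = uconj U (uconj (cadjoint U) A ** N - N ** uconj (cadjoint U) A)"
    by (simp add: linear_diff[OF linear_uconj] uconj_mult[OF U, symmetric] U)
  then show "X \<in> uconj U ` tangent_similarity_orbit N" by (auto simp: tangent_similarity_orbit_def)
next
  fix X assume "X \<in> uconj U ` tangent_similarity_orbit N"
  then obtain A where "X = uconj U (A ** N - N ** A)" by (auto simp: tangent_similarity_orbit_def)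
  then have "X = uconj U A ** uconj U N - uconj U N ** uconj U A"
    by (simp add: linear_diff[OF linear_uconj] uconj_mult[OF U])
  then show "X \<in> tangent_similarity_orbit (uconj U N)" by (auto simp: tangent_similarity_orbit_def)
qed

lemma tangent_unitary_orbit_uconj:
  assumes U: "cunitary U"
  shows "tangent_unitary_orbit (uconj U N) = uconj U ` tangent_unitary_orbit N"
proof (intro equalityI subsetI)
  fix X assume "X \<in> tangent_unitary_orbit (uconj U N)"
  then obtain A where A: "cadjoint A = - A" "X = A ** uconj U N - uconj U N ** A"
    by (auto simp: tangent_unitary_orbit_def)
  then have "X = uconj U (uconj (cadjoint U) A ** N - N ** uconj (cadjoint U) A)"
    by (simp add: linear_diff[OF linear_uconj] uconj_mult[OF U, symmetric] U)
  moreover have "cadjoint (uconj (cadjoint U) A) = - uconj (cadjoint U) A"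
    by (simp add: cadjoint_uconj A(1) linear_neg[OF linear_uconj])
  ultimately show "X \<in> uconj U ` tangent_unitary_orbit N" unfolding tangent_unitary_orbit_def by blast
next
  fix X assume "X \<in> uconj U ` tangent_unitary_orbit N"
  then obtain A where A: "cadjoint A = - A" "X = uconj U (A ** N - N ** A)"
    by (auto simp: tangent_unitary_orbit_def)
  then have "X = uconj U A ** uconj U N - uconj U N ** uconj U A"
    by (simp add: linear_diff[OF linear_uconj] uconj_mult[OF U])
  moreover have "cadjoint (uconj U A) = - uconj U A"
    by (simp add: cadjoint_uconj A(1) linear_neg[OF linear_uconj])
  ultimately show "X \<in> tangent_unitary_orbit (uconj U N)" unfolding tangent_unitary_orbit_def by blast
qed

lemma commutator_diag_mat_nth: "(A ** diag_mat d - diag_mat d ** A) $ i $ j = A $ i $ j * (d $ j - d $ i)"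
  by (simp add: diag_mat_mult_left diag_mat_mult_right algebra_simps)

lemma tangent_similarity_orbit_diag_mat:
  fixes d :: "complex^'n::finite"
  shows
  "tangent_similarity_orbit (diag_mat d) = {X. \<forall>i j. d $ i = d $ j \<longrightarrow> X $ i $ j = 0}"
proof (intro equalityI subsetI)
  fix X :: "'n cmat" assume "X \<in> {X. \<forall>i j. d $ i = d $ j \<longrightarrow> X $ i $ j = 0}"
  then have X: "X $ i $ j = 0" if "d $ i = d $ j" for i j using that by simp
  define A where "A = (\<chi> i j. X $ i $ j / (d $ j - d $ i))"
  have "X $ i $ j = (A ** diag_mat d - diag_mat d ** A) $ i $ j" for i j
    unfolding commutator_diag_mat_nth A_def using X[of i j] by simp
  then have "X = A ** diag_mat d - diag_mat d ** A" unfolding vec_eq_iff by blast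
  then show "X \<in> tangent_similarity_orbit (diag_mat d)" by (auto simp: tangent_similarity_orbit_def)
qed (auto simp: tangent_similarity_orbit_def commutator_diag_mat_nth simp del: vector_minus_component)

text \<open>The equation says, with denominators cleared, that the matrix of the quotients
  \<open>X_ij / (d_j - d_i)\<close> is skew-Hermitian.\<close>

lemma tangent_unitary_orbit_diag_mat:
  fixes d :: "complex^'n::finite"
  shows
  "tangent_unitary_orbit (diag_mat d) = {X \<in> tangent_similarity_orbit (diag_mat d).
    \<forall>i j. X $ i $ j * cnj (d $ j - d $ i) = cnj (X $ j $ i) * (d $ j - d $ i)}"
proof (intro equalityI subsetI)
  fix X assume "X \<in> {X \<in> tangent_similarity_orbit (diag_mat d).
    \<forall>i j. X $ i $ j * cnj (d $ j - d $ i) = cnj (X $ j $ i) * (d $ j - d $ i)}"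
  then have X: "\<And>i j. d $ i = d $ j \<Longrightarrow> X $ i $ j = 0"
      "\<And>i j. X $ i $ j * cnj (d $ j - d $ i) = cnj (X $ j $ i) * (d $ j - d $ i)"
    by (simp_all add: tangent_similarity_orbit_diag_mat)
  \<comment> \<open>Where \<open>d $ i = d $ j\<close> division by zero makes the entry 0, which is
    consistent with skew-Hermitian symmetry.\<close>
  define A where "A = (\<chi> i j. X $ i $ j / (d $ j - d $ i))"
  have "X $ i $ j = (A ** diag_mat d - diag_mat d ** A) $ i $ j" for i j
    unfolding commutator_diag_mat_nth A_def using X(1)[of i j] by simp
  then have "X = A ** diag_mat d - diag_mat d ** A" unfolding vec_eq_iff by blast
  moreover have "cadjoint A $ i $ j = (- A) $ i $ j" for i j
  proof (cases "d $ i = d $ j")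
    case False
    then have "d $ i - d $ j \<noteq> 0" "cnj (d $ i - d $ j) \<noteq> 0" "d $ j - d $ i \<noteq> 0" by simp_all
    moreover have "cnj (d $ i - d $ j) = - cnj (d $ j - d $ i)" by simp
    moreover have "cnj (d $ j - d $ i) \<noteq> 0" using False by simp
    ultimately show ?thesis
      using X(2)[of i j] by (simp add: A_def divide_simps del: complex_cnj_diff)
  qed (simp add: A_def)
  then have "cadjoint A = - A" unfolding vec_eq_iff by blast
  ultimately show "X \<in> tangent_unitary_orbit (diag_mat d)" unfolding tangent_unitary_orbit_def by blast
next
  fix X assume "X \<in> tangent_unitary_orbit (diag_mat d)"
  then obtain A where A: "cadjoint A = - A" "X = A ** diag_mat d - diag_mat d ** A"
    by (auto simp: tangent_unitary_orbit_def)
  have "cnj (A $ j $ i) = - A $ i $ j" for i j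
    using arg_cong[OF A(1), of "\<lambda>M. M $ i $ j"] by simp
  then have "X $ i $ j * cnj (d $ j - d $ i) = cnj (X $ j $ i) * (d $ j - d $ i)" for i j
    unfolding A(2) commutator_diag_mat_nth by (simp add: algebra_simps)
  then show "X \<in> {X \<in> tangent_similarity_orbit (diag_mat d).
    \<forall>i j. X $ i $ j * cnj (d $ j - d $ i) = cnj (X $ j $ i) * (d $ j - d $ i)}"
    using A(2) by (auto simp: tangent_similarity_orbit_def)
qed


subsection \<open>The projection onto the stable subspace\<close>

text \<open>On the block of an eigenvalue pair \<open>x \<noteq> y\<close> the derivative has the eigenvalues 1, on
  the tangent space of the unitary orbit, and \<open>aluthge_eigenvalue lam x y\<close>. The complementary projection
  is therefore \<open>(L - 1) / (aluthge_eigenvalue lam x y - 1)\<close>, where \<open>L\<close> is the derivative.\<close>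

definition stable_coeff :: "real \<Rightarrow> complex \<Rightarrow> complex \<Rightarrow> complex" where
  "stable_coeff lam x y = (if x = y then 0 else (aluthge_coeff lam x y - 1) / (aluthge_eigenvalue lam x y - 1))"

definition stable_coeff_cnj :: "real \<Rightarrow> complex \<Rightarrow> complex \<Rightarrow> complex" where
  "stable_coeff_cnj lam x y = (if x = y then 0 else aluthge_coeff_cnj lam x y / (aluthge_eigenvalue lam x y - 1))"

text \<open>\<open>L - 1\<close> annihilates the vector that the block fixes.\<close>

lemma stable_coeff_kernel:
  assumes "x \<noteq> 0" "y \<noteq> 0"
  shows "stable_coeff lam x y * (y - x) + stable_coeff_cnj lam x y * cnj (y - x) = 0"
proof (cases "x = y")
  case False
  have "stable_coeff lam x y * (y - x) + stable_coeff_cnj lam x y * cnj (y - x) =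
     (aluthge_coeff lam x y * (y - x) + aluthge_coeff_cnj lam x y * cnj (y - x) - (y - x)) / (aluthge_eigenvalue lam x y - 1)"
    using False by (simp add: stable_coeff_def stable_coeff_cnj_def add_divide_distrib diff_divide_distrib algebra_simps)
  then show ?thesis by (simp only: aluthge_coeff_fixed[OF assms]) simp
qed (simp add: stable_coeff_def stable_coeff_cnj_def)

text \<open>The trace of \<open>L - 1\<close> is \<open>mu - 1\<close>. A 2 by 2 matrix of trace 1
  and determinant 0 is idempotent by Cayley-Hamilton; the next lemma supplies the
  determinant.\<close>

lemma stable_coeff_trace:
  assumes "x \<noteq> y" "aluthge_eigenvalue lam x y \<noteq> 1"
  shows "stable_coeff lam x y + cnj (stable_coeff lam y x) = 1"
proof -
  have "cnj (stable_coeff lam y x) = (cnj (aluthge_coeff lam y x) - 1) / (aluthge_eigenvalue lam x y - 1)"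
    using assms(1) by (simp add: stable_coeff_def aluthge_eigenvalue_commute[of lam x y, symmetric])
  then have "stable_coeff lam x y + cnj (stable_coeff lam y x) =
      ((aluthge_coeff lam x y - 1) + (cnj (aluthge_coeff lam y x) - 1)) / (aluthge_eigenvalue lam x y - 1)"
    using assms(1) by (simp only: stable_coeff_def[of lam x y] add_divide_distrib if_False)
  also have "(aluthge_coeff lam x y - 1) + (cnj (aluthge_coeff lam y x) - 1) = aluthge_eigenvalue lam x y - 1"
    by (simp add: aluthge_eigenvalue_def)
  finally show ?thesis using assms(2) by simp
qed

text \<open>The block has a kernel vector with nonzero components. Its second row is the first with
  \<open>x\<close> and \<open>y\<close> exchanged, conjugated; multiplying the two kernel equations
  gives the claim.\<close>

lemma stable_coeff_det:
  assumes "x \<noteq> 0" "y \<noteq> 0" "x \<noteq> y"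
  shows "stable_coeff_cnj lam x y * cnj (stable_coeff_cnj lam y x) = stable_coeff lam x y * cnj (stable_coeff lam y x)"
proof -
  have 1: "stable_coeff lam x y * (y - x) = - (stable_coeff_cnj lam x y * cnj (y - x))"
    using stable_coeff_kernel[OF assms(1,2), of lam] by (simp add: add_eq_0_iff)
  have "cnj (stable_coeff lam y x * (x - y) + stable_coeff_cnj lam y x * cnj (x - y)) = 0"
    using stable_coeff_kernel[OF assms(2,1), of lam] by simp
  then have 2: "cnj (stable_coeff lam y x) * cnj (y - x) = - (cnj (stable_coeff_cnj lam y x) * (y - x))"
    by (simp add: algebra_simps add_eq_0_iff)
  have "(stable_coeff lam x y * cnj (stable_coeff lam y x)) * ((y - x) * cnj (y - x)) =
      (stable_coeff lam x y * (y - x)) * (cnj (stable_coeff lam y x) * cnj (y - x))"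
    by (simp only: mult_ac)
  also have "\<dots> = (stable_coeff_cnj lam x y * cnj (stable_coeff_cnj lam y x)) * ((y - x) * cnj (y - x))"
    unfolding 1 2 by (simp only: minus_mult_minus mult_ac)
  finally show ?thesis using assms(3) by simp
qed

definition stable_proj_diag :: "real \<Rightarrow> complex^'n \<Rightarrow> 'n cmat \<Rightarrow> ('n::finite) cmat" where
  "stable_proj_diag lam d X = (\<chi> i j. stable_coeff lam (d $ i) (d $ j) * X $ i $ j
    + stable_coeff_cnj lam (d $ i) (d $ j) * cnj (X $ j $ i))"

lemma stable_proj_diag_tangent: "stable_proj_diag lam d X \<in> tangent_similarity_orbit (diag_mat d)"
  by (simp add: tangent_similarity_orbit_diag_mat stable_proj_diag_def stable_coeff_def stable_coeff_cnj_def)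

context
  fixes lam :: real and d :: "complex^'n::finite"
  assumes d: "\<And>i. d $ i \<noteq> 0"
    and eig: "\<And>i j. d $ i \<noteq> d $ j \<Longrightarrow> aluthge_eigenvalue lam (d $ i) (d $ j) \<noteq> 1"
begin

lemma stable_proj_diag_idem: "stable_proj_diag lam d (stable_proj_diag lam d X) = stable_proj_diag lam d X"
proof -
  have "stable_proj_diag lam d (stable_proj_diag lam d X) $ i $ j = stable_proj_diag lam d X $ i $ j" for i j
  proof (cases "d $ i = d $ j")
    case False
    let ?a = "stable_coeff lam (d $ i) (d $ j)" and ?b = "stable_coeff_cnj lam (d $ i) (d $ j)"
    let ?a' = "cnj (stable_coeff lam (d $ j) (d $ i))" and ?b' = "cnj (stable_coeff_cnj lam (d $ j) (d $ i))"
    have tr: "?a' = 1 - ?a" using stable_coeff_trace[OF False eig[OF False]] by (simp add: algebra_simps)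
    have det: "?b * ?b' = ?a * ?a'" by (rule stable_coeff_det[OF d d False])
    have "stable_proj_diag lam d (stable_proj_diag lam d X) $ i $ j =
        ?a * (?a * X $ i $ j + ?b * cnj (X $ j $ i)) + ?b * (?a' * cnj (X $ j $ i) + ?b' * X $ i $ j)"
      by (simp add: stable_proj_diag_def)
    also have "\<dots> = (?a * ?a + ?b * ?b') * X $ i $ j + ?b * (?a + ?a') * cnj (X $ j $ i)"
      by (simp add: algebra_simps)
    also have "?a * ?a + ?b * ?b' = ?a" unfolding det tr by (simp add: algebra_simps)
    also have "?b * (?a + ?a') = ?b" unfolding tr by simp
    finally show ?thesis by (simp add: stable_proj_diag_def)
  qed (simp add: stable_proj_diag_def stable_coeff_def stable_coeff_cnj_def)
  then show ?thesis by (simp add: vec_eq_iff)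
qed

text \<open>The formula for the projection solved for the derivative:
  \<open>L = 1 + (mu - 1) P\<close> on each block. Invariance of both summands and the norm bound
  all come from this.\<close>

lemma aluthge_deriv_stable_proj_diag:
  assumes X: "X \<in> tangent_similarity_orbit (diag_mat d)"
  shows "aluthge_deriv lam d X $ i $ j =
    X $ i $ j + (aluthge_eigenvalue lam (d $ i) (d $ j) - 1) * stable_proj_diag lam d X $ i $ j"
proof (cases "d $ i = d $ j")
  case True
  then have "X $ i $ j = 0" "X $ j $ i = 0" using X by (simp_all add: tangent_similarity_orbit_diag_mat)
  then show ?thesis by (simp add: aluthge_deriv_def stable_proj_diag_def)
next
  case False
  let ?m = "aluthge_eigenvalue lam (d $ i) (d $ j) - 1"
  have m: "?m \<noteq> 0" using eig[OF False] by simp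
  have "?m * stable_coeff lam (d $ i) (d $ j) = aluthge_coeff lam (d $ i) (d $ j) - 1"
    "?m * stable_coeff_cnj lam (d $ i) (d $ j) = aluthge_coeff_cnj lam (d $ i) (d $ j)"
    using m False by (simp_all add: stable_coeff_def stable_coeff_cnj_def)
  moreover have "?m * stable_proj_diag lam d X $ i $ j =
      (?m * stable_coeff lam (d $ i) (d $ j)) * X $ i $ j + (?m * stable_coeff_cnj lam (d $ i) (d $ j)) * cnj (X $ j $ i)"
    by (simp add: stable_proj_diag_def algebra_simps)
  ultimately have "?m * stable_proj_diag lam d X $ i $ j =
      (aluthge_coeff lam (d $ i) (d $ j) - 1) * X $ i $ j + aluthge_coeff_cnj lam (d $ i) (d $ j) * cnj (X $ j $ i)"
    by (simp only:)
  then show ?thesis by (simp only: aluthge_deriv_def vec_lambda_beta) (simp add: algebra_simps)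
qed

lemma aluthge_deriv_stable:
  "aluthge_deriv lam d (stable_proj_diag lam d X) $ i $ j =
    aluthge_eigenvalue lam (d $ i) (d $ j) * stable_proj_diag lam d X $ i $ j"
  unfolding aluthge_deriv_stable_proj_diag[OF stable_proj_diag_tangent] stable_proj_diag_idem
  by (simp add: algebra_simps)

text \<open>Exchanging \<open>i\<close> and \<open>j\<close> conjugates the eigenvalue, so
  \<open>X_ij\<close> and \<open>cnj X_ji\<close> are scaled by the same factor and the scaling
  commutes with the projection.\<close>

lemma stable_proj_diag_aluthge_deriv:
  "stable_proj_diag lam d (aluthge_deriv lam d (stable_proj_diag lam d X)) = aluthge_deriv lam d (stable_proj_diag lam d X)"
proof -
  let ?Z = "stable_proj_diag lam d X"
  have "stable_proj_diag lam d (aluthge_deriv lam d ?Z) $ i $ j = aluthge_deriv lam d ?Z $ i $ j" for i j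
  proof -
    have "stable_proj_diag lam d (aluthge_deriv lam d ?Z) $ i $ j =
        aluthge_eigenvalue lam (d $ i) (d $ j) * stable_proj_diag lam d ?Z $ i $ j"
      unfolding stable_proj_diag_def[of lam d "aluthge_deriv lam d ?Z"] stable_proj_diag_def[of lam d ?Z]
        vec_lambda_beta aluthge_deriv_stable
      by (simp add: aluthge_eigenvalue_commute[of lam "d $ i" "d $ j", symmetric] algebra_simps)
    then show ?thesis by (simp add: stable_proj_diag_idem aluthge_deriv_stable)
  qed
  then show ?thesis by (simp add: vec_eq_iff)
qed

lemma tangent_unitary_orbit_diag_eq_kernel:
  "tangent_unitary_orbit (diag_mat d) = {X \<in> tangent_similarity_orbit (diag_mat d). stable_proj_diag lam d X = 0}"
proof (intro equalityI subsetI)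
  fix X assume "X \<in> tangent_unitary_orbit (diag_mat d)"
  then have X: "X \<in> tangent_similarity_orbit (diag_mat d)"
      "\<And>i j. X $ i $ j * cnj (d $ j - d $ i) = cnj (X $ j $ i) * (d $ j - d $ i)"
    unfolding tangent_unitary_orbit_diag_mat by blast+
  have "stable_proj_diag lam d X $ i $ j = 0" for i j
  proof (cases "d $ i = d $ j")
    case False
    let ?a = "stable_coeff lam (d $ i) (d $ j)" and ?b = "stable_coeff_cnj lam (d $ i) (d $ j)"
    have "(?a * X $ i $ j + ?b * cnj (X $ j $ i)) * (d $ j - d $ i) =
        ?a * X $ i $ j * (d $ j - d $ i) + ?b * (cnj (X $ j $ i) * (d $ j - d $ i))"
      by (simp add: algebra_simps)
    also have "\<dots> = X $ i $ j * (?a * (d $ j - d $ i) + ?b * cnj (d $ j - d $ i))"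
      unfolding X(2)[symmetric] by (simp add: algebra_simps)
    also have "\<dots> = 0" by (simp only: stable_coeff_kernel[OF d d] mult_zero_right)
    finally show ?thesis using False by (simp add: stable_proj_diag_def)
  qed (simp add: stable_proj_diag_def stable_coeff_def stable_coeff_cnj_def)
  then show "X \<in> {X \<in> tangent_similarity_orbit (diag_mat d). stable_proj_diag lam d X = 0}"
    using X(1) by (simp add: vec_eq_iff)
next
  fix X assume "X \<in> {X \<in> tangent_similarity_orbit (diag_mat d). stable_proj_diag lam d X = 0}"
  then have X: "X \<in> tangent_similarity_orbit (diag_mat d)" and "stable_proj_diag lam d X = 0" by auto
  then have P: "stable_proj_diag lam d X $ i $ j = 0" for i j by simp
  have "X $ i $ j * cnj (d $ j - d $ i) = cnj (X $ j $ i) * (d $ j - d $ i)" for i j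
  proof (cases "d $ i = d $ j")
    case False
    let ?a = "stable_coeff lam (d $ i) (d $ j)" and ?b = "stable_coeff_cnj lam (d $ i) (d $ j)"
    let ?a' = "cnj (stable_coeff lam (d $ j) (d $ i))" and ?b' = "cnj (stable_coeff_cnj lam (d $ j) (d $ i))"
    define u v \<delta> \<delta>' where "u = X $ i $ j" and "v = cnj (X $ j $ i)" and "\<delta> = d $ j - d $ i" and "\<delta>' = cnj (d $ j - d $ i)"
    have tr: "?a + ?a' = 1" by (rule stable_coeff_trace[OF False eig[OF False]])
    have 1: "?a * u = - (?b * v)" using P[of i j] by (simp add: stable_proj_diag_def u_def v_def add_eq_0_iff2)
    have "cnj (stable_proj_diag lam d X $ j $ i) = 0" using P[of j i] by simp
    then have 2: "?a' * v = - (?b' * u)" by (simp add: stable_proj_diag_def u_def v_def add_eq_0_iff2)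
    have 3: "?a * \<delta> = - (?b * \<delta>')"
      using stable_coeff_kernel[OF d d, of lam i j] by (simp only: \<delta>_def \<delta>'_def add_eq_0_iff2)
    have "cnj (stable_coeff lam (d $ j) (d $ i) * (d $ i - d $ j) + stable_coeff_cnj lam (d $ j) (d $ i) * cnj (d $ i - d $ j)) = 0"
      using stable_coeff_kernel[OF d d, of lam j i] by simp
    then have 4: "?a' * \<delta>' = - (?b' * \<delta>)" by (simp add: \<delta>_def \<delta>'_def algebra_simps add_eq_0_iff)
    \<comment> \<open>Inserting the trace 1 avoids dividing by a coefficient that might vanish;
      relations 1 to 4 cancel the terms in pairs.\<close>
    have "u * \<delta>' - v * \<delta> = (?a + ?a') * (u * \<delta>' - v * \<delta>)" unfolding tr by simp
    also have "\<dots> = (?a * u) * \<delta>' - v * (?a * \<delta>) + u * (?a' * \<delta>') - (?a' * v) * \<delta>"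
      by (simp add: algebra_simps)
    also have "\<dots> = 0" unfolding 1 2 3 4 by (simp add: algebra_simps)
    finally show ?thesis by (simp add: u_def v_def \<delta>_def \<delta>'_def)
  next
    case True
    then show ?thesis using X by (simp add: tangent_similarity_orbit_diag_mat)
  qed
  then show "X \<in> tangent_unitary_orbit (diag_mat d)"
    unfolding tangent_unitary_orbit_diag_mat using X by blast
qed

end

text \<open>Lagrange interpolation: a polynomial in \<open>N\<close> that is the spectral projection of the normal matrix \<open>N\<close>
  for the eigenvalue \<open>x\<close> if \<open>vs\<close> lists all eigenvalues. This makes the projection onto the stable
  subspace a polynomial map.\<close>

definition spectral_proj :: "complex list \<Rightarrow> complex \<Rightarrow> ('n::finite) cmat \<Rightarrow> 'n cmat" where
  "spectral_proj vs x N = foldr (\<lambda>c M. if c = x then M else (mat (inverse (x - c)) ** (N - mat c)) ** M) vs (mat 1)"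

text \<open>A polynomial in a diagonal matrix is evaluated entrywise. Every factor is 1 at
  \<open>x\<close>, and at any other eigenvalue some factor is 0, so repetitions in
  \<open>vs\<close> do no harm.\<close>

lemma spectral_proj_uconj:
  assumes U: "cunitary U" and x: "x \<in> set vs" and d: "range (($) d) \<subseteq> set vs"
  shows "spectral_proj vs x (uconj U (diag_mat d)) = uconj U (diag_mat (\<chi> i. if d $ i = x then 1 else 0))"
proof -
  have lin: "uconj U (diag_mat d) - mat c = uconj U (diag_mat (\<chi> i. d $ i - c))" for c
  proof -
    have "uconj U (diag_mat d) - mat c = - (mat c - U ** diag_mat d ** cadjoint U)" by (simp add: uconj_def)
    also have "\<dots> = uconj U (- diag_mat (\<chi> i. c - d $ i))"
      unfolding mat_minus_diagonalization[OF U] by (simp add: uconj_def mmult.minus_left mmult.minus_right)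
    also have "- diag_mat (\<chi> i. c - d $ i) = diag_mat (\<chi> i. d $ i - c)"
      by (auto simp: vec_eq_iff diag_mat_nth)
    finally show ?thesis .
  qed
  have m: "mat c ** uconj U M = uconj U (mat c ** M)" for c M
    by (simp add: uconj_def matrix_mul_assoc mat_mult_commute[of c U])
  have "spectral_proj vs x (uconj U (diag_mat d)) =
      uconj U (diag_mat (\<chi> i. \<Prod>c\<leftarrow>vs. if c = x then 1 else inverse (x - c) * (d $ i - c)))" for vs
  proof (induction vs)
    case Nil
    show ?case by (simp add: spectral_proj_def diag_mat_one uconj_def cunitaryD[OF U])
  next
    case (Cons c vs)
    show ?case
    proof (cases "c = x")
      case False
      then have "spectral_proj (c # vs) x (uconj U (diag_mat d)) =
          (mat (inverse (x - c)) ** uconj U (diag_mat (\<chi> i. d $ i - c))) ** spectral_proj vs x (uconj U (diag_mat d))"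
        by (simp add: spectral_proj_def lin)
      also have "\<dots> = uconj U ((mat (inverse (x - c)) ** diag_mat (\<chi> i. d $ i - c)) **
          diag_mat (\<chi> i. \<Prod>c\<leftarrow>vs. if c = x then 1 else inverse (x - c) * (d $ i - c)))"
        unfolding Cons.IH m by (simp add: uconj_mult[OF U])
      finally show ?thesis using False by (simp add: mat_eq_diag diag_mat_mult)
    qed (use Cons.IH in \<open>simp add: spectral_proj_def\<close>)
  qed
  moreover have "(\<Prod>c\<leftarrow>vs. if c = x then 1 else inverse (x - c) * (d $ i - c)) = (if d $ i = x then 1 else 0)" for i
  proof (cases "d $ i = x")
    case True
    have "(\<Prod>c\<leftarrow>vs. if c = x then 1 else inverse (x - c) * (x - c)) = 1" for vs
      by (induction vs) auto
    from this[of vs] show ?thesis unfolding True by simp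
  next
    case False
    have "d $ i \<in> set vs" using d by auto
    then have "(\<Prod>c\<leftarrow>vs. if c = x then 1 else inverse (x - c) * (d $ i - c)) = 0"
      using False by (subst prod_list_zero_iff) (auto intro!: image_eqI[of _ _ "d $ i"])
    then show ?thesis using False by simp
  qed
  ultimately show ?thesis by simp
qed

lemma higher_differentiable_on_spectral_proj:
  assumes W: "open W" and f: "higher_differentiable_on W f n"
  shows "higher_differentiable_on W (\<lambda>y. spectral_proj vs x (f y)) n"
proof (induction vs)
  case Nil
  show ?case by (simp add: spectral_proj_def higher_differentiable_on_const[OF W])
next
  case (Cons c vs)
  have "spectral_proj (c # vs) x N = (if c = x then spectral_proj vs x N else
      (mat (inverse (x - c)) ** (N - mat c)) ** spectral_proj vs x N)" for N :: "'b cmat"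
    by (simp add: spectral_proj_def)
  then show ?case
    using Cons.IH by (cases "c = x")
      (simp_all add: higher_differentiable_on_mult higher_differentiable_on_diff higher_differentiable_on_const W f)
qed

text \<open>\<open>stable_proj_diag\<close> without coordinates: multiplying by the spectral
  projections for \<open>x\<close> and \<open>y\<close> on the two sides selects the entries with
  \<open>d $ i = x\<close> and \<open>d $ j = y\<close>. Only the eigenvalues and \<open>N\<close>
  occur, so no choice of a diagonalizing unitary is involved.\<close>

definition stable_proj :: "real \<Rightarrow> complex list \<Rightarrow> ('n::finite) cmat \<Rightarrow> 'n cmat \<Rightarrow> 'n cmat" where
  "stable_proj lam vs N X = (\<Sum>x\<in>set vs. \<Sum>y\<in>set vs. spectral_proj vs x N **
    (mat (stable_coeff lam x y) ** X + mat (stable_coeff_cnj lam x y) ** cadjoint X) ** spectral_proj vs y N)"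

lemma stable_proj_uconj:
  assumes U: "cunitary U" and d: "range (($) d) = set vs"
  shows "stable_proj lam vs (uconj U (diag_mat d)) (uconj U X) = uconj U (stable_proj_diag lam d X)"
proof -
  let ?I = "\<lambda>x. diag_mat (\<chi> i. if d $ i = x then 1 else 0) :: 'a cmat"
  let ?M = "\<lambda>x y. mat (stable_coeff lam x y) ** X + mat (stable_coeff_cnj lam x y) ** cadjoint X"
  have m: "mat c ** uconj U M = uconj U (mat c ** M)" for c M
    by (simp add: uconj_def matrix_mul_assoc mat_mult_commute[of c U])
  have "stable_proj lam vs (uconj U (diag_mat d)) (uconj U X) =
      (\<Sum>x\<in>set vs. \<Sum>y\<in>set vs. uconj U (?I x) ** uconj U (?M x y) ** uconj U (?I y))"
    unfolding stable_proj_def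
    by (intro sum.cong refl) (simp add: spectral_proj_uconj[OF U _ d[THEN equalityD1]] cadjoint_uconj m linear_add[OF linear_uconj])
  also have "\<dots> = uconj U (\<Sum>x\<in>set vs. \<Sum>y\<in>set vs. ?I x ** ?M x y ** ?I y)"
    by (simp add: uconj_mult[OF U] linear_sum[OF linear_uconj])
  also have "(\<Sum>x\<in>set vs. \<Sum>y\<in>set vs. ?I x ** ?M x y ** ?I y) = stable_proj_diag lam d X"
  proof -
    have "(\<Sum>x\<in>set vs. \<Sum>y\<in>set vs. ?I x ** ?M x y ** ?I y) $ i $ j = stable_proj_diag lam d X $ i $ j" for i j
    proof -
      have mem: "d $ i \<in> set vs" "d $ j \<in> set vs" using d by auto
      have "(\<Sum>x\<in>set vs. \<Sum>y\<in>set vs. ?I x ** ?M x y ** ?I y) $ i $ j =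
          (\<Sum>x\<in>set vs. \<Sum>y\<in>set vs. (if d $ i = x then 1 else 0) * ?M x y $ i $ j * (if d $ j = y then 1 else 0))"
        by (simp only: sum_component diag_mat_mult_left diag_mat_mult_right vec_lambda_beta)
      also have "\<dots> = (\<Sum>x\<in>set vs. if d $ i = x then (\<Sum>y\<in>set vs. if d $ j = y then ?M x y $ i $ j else 0) else 0)"
        by (intro sum.cong refl) (simp add: if_distrib[of "\<lambda>z. _ * z"] cong: if_cong)
      also have "\<dots> = ?M (d $ i) (d $ j) $ i $ j"
        using mem by (simp only: sum.delta'[OF finite_set] if_True)
      also have "\<dots> = stable_proj_diag lam d X $ i $ j"
        by (simp add: mat_eq_diag diag_mat_mult_left stable_proj_diag_def)
      finally show ?thesis .
    qed
    then show ?thesis unfolding vec_eq_iff by blast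
  qed
  finally show ?thesis .
qed

lemma linear_stable_proj: "linear (stable_proj lam vs N)"
  unfolding stable_proj_def
  by (rule linearI)
    (simp_all add: mmult.add_left mmult.add_right mmult.scaleR_left mmult.scaleR_right sum.distrib
      linear_add[OF bounded_linear.linear[OF bounded_linear_cadjoint]] linear_scale[OF bounded_linear.linear[OF bounded_linear_cadjoint]]
      scaleR_sum_right scaleR_add_right)

lemma smooth_stable_proj:
  "smooth_on_open UNIV (\<lambda>(N :: ('n::finite) cmat, X). stable_proj lam vs N X)"
proof -
  have f: "higher_differentiable_on UNIV (fst :: 'n cmat \<times> 'n cmat \<Rightarrow> 'n cmat) n" for n
    by (rule higher_differentiable_on_linear[OF open_UNIV bounded_linear_fst])
  have s: "higher_differentiable_on UNIV (snd :: 'n cmat \<times> 'n cmat \<Rightarrow> 'n cmat) n" for n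
    by (rule higher_differentiable_on_linear[OF open_UNIV bounded_linear_snd])
  have a: "higher_differentiable_on UNIV (\<lambda>y :: 'n cmat \<times> 'n cmat. cadjoint (snd y)) n" for n
    by (rule higher_differentiable_on_compose_linear[OF open_UNIV bounded_linear_cadjoint s])
  have "higher_differentiable_on UNIV (\<lambda>y :: 'n cmat \<times> 'n cmat. stable_proj lam vs (fst y) (snd y)) n" for n
    unfolding stable_proj_def
    by (rule higher_differentiable_on_sum[OF open_UNIV], rule higher_differentiable_on_sum[OF open_UNIV],
        rule higher_differentiable_on_mult[OF open_UNIV higher_differentiable_on_mult[OF open_UNIV
          higher_differentiable_on_spectral_proj[OF open_UNIV f] higher_differentiable_on_add[OF open_UNIV
          higher_differentiable_on_mult[OF open_UNIV higher_differentiable_on_const[OF open_UNIV] s]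
          higher_differentiable_on_mult[OF open_UNIV higher_differentiable_on_const[OF open_UNIV] a]]]
          higher_differentiable_on_spectral_proj[OF open_UNIV f]])
  then show ?thesis by (simp only: smooth_on_open_def case_prod_unfold open_UNIV simp_thms)
qed

lemma is_direct_sum_projection:
  fixes P :: "'a::real_vector \<Rightarrow> 'a"
  assumes P: "linear P" and V: "subspace V" and PV: "\<And>x. x \<in> V \<Longrightarrow> P x \<in> V"
    and idem: "\<And>x. x \<in> V \<Longrightarrow> P (P x) = P x"
  shows "is_direct_sum V (P ` V) {x \<in> V. P x = 0}"
    and "x \<in> V \<Longrightarrow> proj_parallel (P ` V) {x \<in> V. P x = 0} x = P x"
proof -
  have F: "subspace {x \<in> V. P x = 0}"
    using V by (auto simp: subspace_def linear_0[OF P] linear_add[OF P] linear_scale[OF P])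
  have E: "subspace (P ` V)" by (rule linear_subspace_image[OF P V])
  have diff: "x - P x \<in> {x \<in> V. P x = 0}" if "x \<in> V" for x
    using that by (simp add: subspace_diff[OF V] PV linear_diff[OF P] idem)
  have disj: "x = 0" if "x \<in> P ` V" "P x = 0" for x using that idem by auto
  show "is_direct_sum V (P ` V) {x \<in> V. P x = 0}"
    unfolding is_direct_sum_def
  proof (intro conjI E F equalityI subsetI)
    fix x assume "x \<in> V"
    then show "x \<in> {x + y |x y. x \<in> P ` V \<and> y \<in> {x \<in> V. P x = 0}}"
      using diff by (intro CollectI exI[of _ "P x"] exI[of _ "x - P x"]) simp
  next
    fix x assume "x \<in> {x + y |x y. x \<in> P ` V \<and> y \<in> {x \<in> V. P x = 0}}"
    then show "x \<in> V" using PV by (auto intro: subspace_add[OF V])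
  next
    fix x assume "x \<in> P ` V \<inter> {x \<in> V. P x = 0}"
    then show "x \<in> {0}" using disj by simp
  next
    fix x :: 'a assume "x \<in> {0}"
    then show "x \<in> P ` V \<inter> {x \<in> V. P x = 0}" using subspace_0[OF E] subspace_0[OF F] by simp
  qed
  show "proj_parallel (P ` V) {x \<in> V. P x = 0} x = P x" if x: "x \<in> V"
    unfolding proj_parallel_def
  proof (rule the_equality)
    show "P x \<in> P ` V \<and> x - P x \<in> {x \<in> V. P x = 0}" using x diff by simp
    fix y assume y: "y \<in> P ` V \<and> x - y \<in> {x \<in> V. P x = 0}"
    then have "P y = y" using idem by auto
    moreover have "P x = P y" using y linear_diff[OF P, of x y] by simp
    ultimately show "y = P x" by simp
  qed
qed

section \<open>The contraction constant\<close>

lemma Max0_bounds: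
  assumes "finite A"
  shows "x \<in> A \<Longrightarrow> x \<le> Max0 A" "(\<And>x. x \<in> A \<Longrightarrow> 0 \<le> x) \<Longrightarrow> 0 \<le> Max0 A"
    "(\<And>x. x \<in> A \<Longrightarrow> x < c) \<Longrightarrow> 0 < c \<Longrightarrow> Max0 A < c"
proof -
  show "x \<in> A \<Longrightarrow> x \<le> Max0 A" using assms by (auto simp: Max0_def)
  show "0 \<le> Max0 A" if "\<And>x. x \<in> A \<Longrightarrow> 0 \<le> x"
    using that assms Max_in[OF assms] by (auto simp: Max0_def)
  show "Max0 A < c" if "\<And>x. x \<in> A \<Longrightarrow> x < c" "0 < c"
    using that assms Max_in[OF assms] by (auto simp: Max0_def)
qed

lemma finite_pairs: "finite {f i j | i j. P i j}" for f :: "'n::finite \<Rightarrow> 'n \<Rightarrow> 'a"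
  by (rule finite_subset[of _ "(\<lambda>(i, j). f i j) ` UNIV"]) auto

lemma contraction_const_properties:
  fixes d :: "complex^'n::finite" and \<theta> :: "'n \<Rightarrow> real"
  assumes \<theta>: "\<And>j. 0 \<le> \<theta> j \<and> \<theta> j < 2 * pi"
      "\<And>j. d $ j = exp (\<i> * of_real (\<theta> j)) * of_real (cmod (d $ j))"
    and d: "\<And>i. d $ i \<noteq> 0" and lam: "0 < lam" "lam < 1"
  shows "0 \<le> contraction_const d \<theta> lam" "contraction_const d \<theta> lam < 1"
    "d $ i \<noteq> d $ j \<Longrightarrow> cmod (aluthge_eigenvalue lam (d $ i) (d $ j)) \<le> contraction_const d \<theta> lam"
proof -
  define A where "A = {(cmod (d $ j) powr (1 - lam) * cmod (d $ i) powr lam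
               + cmod (d $ i) powr (1 - lam) * cmod (d $ j) powr lam)
              / (cmod (d $ i) + cmod (d $ j)) | i j. cmod (d $ i) \<noteq> cmod (d $ j)}"
  define B where "B = {cmod (of_real lam * (exp (\<i> * of_real (\<theta> j - \<theta> i)) - 1) + 1) | i j. \<theta> i \<noteq> \<theta> j}"
  have k: "contraction_const d \<theta> lam = max (Max0 A) (Max0 B)"
    by (simp add: contraction_const_def A_def B_def)
  have fin: "finite A" "finite B" unfolding A_def B_def by (rule finite_pairs)+
  have pos: "0 < cmod (d $ i)" for i using d by simp
  have "0 \<le> Max0 A" by (rule Max0_bounds(2)[OF fin(1)]) (auto simp: A_def)
  then show "0 \<le> contraction_const d \<theta> lam" unfolding k by simp
  have "Max0 A < 1"
    by (rule Max0_bounds(3)[OF fin(1)]) (auto simp: A_def intro!: weighted_mean_less_one[OF lam pos pos])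
  moreover have "Max0 B < 1"
  proof (rule Max0_bounds(3)[OF fin(2)])
    fix x assume "x \<in> B"
    then obtain i j where x: "x = cmod (of_real lam * (exp (\<i> * of_real (\<theta> j - \<theta> i)) - 1) + 1)" "\<theta> i \<noteq> \<theta> j"
      unfolding B_def by blast
    \<comment> \<open>Two angles in \<open>[0, 2 * pi)\<close> differ by less than
      \<open>2 * pi\<close>.\<close>
    show "x < 1"
      unfolding x(1) using \<theta>(1)[of i] \<theta>(1)[of j] x(2) by (intro cmod_convex_unit_less_one lam) auto
  qed simp
  ultimately show "contraction_const d \<theta> lam < 1" unfolding k by simp
  show "cmod (aluthge_eigenvalue lam (d $ i) (d $ j)) \<le> contraction_const d \<theta> lam" if ne: "d $ i \<noteq> d $ j"
  proof (cases "cmod (d $ i) = cmod (d $ j)")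
    case False
    have "cmod (aluthge_eigenvalue lam (d $ i) (d $ j)) \<le> (cmod (d $ j) powr (1 - lam) * cmod (d $ i) powr lam
               + cmod (d $ i) powr (1 - lam) * cmod (d $ j) powr lam) / (cmod (d $ i) + cmod (d $ j))"
      by (rule cmod_aluthge_eigenvalue[OF lam False d d])
    also have "\<dots> \<le> Max0 A" using False by (intro Max0_bounds(1)[OF fin(1)]) (auto simp: A_def)
    finally show ?thesis unfolding k by simp
  next
    case True
    \<comment> \<open>Equal moduli and equal angles would give \<open>d $ i = d $ j\<close>.\<close>
    have "\<theta> i \<noteq> \<theta> j" using ne \<theta>(2)[of i] \<theta>(2)[of j] True by metis
    have "d $ j / d $ i = exp (\<i> * of_real (\<theta> j - \<theta> i))"
    proof -
      have "d $ j / d $ i = (exp (\<i> * of_real (\<theta> j)) * of_real (cmod (d $ j))) / (exp (\<i> * of_real (\<theta> i)) * of_real (cmod (d $ i)))"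
        using \<theta>(2)[of i] \<theta>(2)[of j] by simp
      then show ?thesis using pos[of j] by (simp add: True exp_diff right_diff_distrib)
    qed
    then have "cmod (aluthge_eigenvalue lam (d $ i) (d $ j)) = cmod (of_real lam * (exp (\<i> * of_real (\<theta> j - \<theta> i)) - 1) + 1)"
      unfolding aluthge_eigenvalue_same_modulus[OF True d] by simp
    also have "\<dots> \<le> Max0 B" using \<open>\<theta> i \<noteq> \<theta> j\<close> by (intro Max0_bounds(1)[OF fin(2)]) (auto simp: B_def)
    finally show ?thesis unfolding k by simp
  qed
qed

lemma subspace_tangent_similarity_orbit: "subspace (tangent_similarity_orbit N)"
proof -
  have "linear (\<lambda>A. A ** N - N ** A)"
    by (rule linearI) (simp_all add: mmult.add_left mmult.add_right mmult.scaleR_left mmult.scaleR_right scaleR_diff_right)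
  from linear_subspace_image[OF this subspace_UNIV] show ?thesis
    by (simp add: tangent_similarity_orbit_def image_def)
qed

theorem theorem3p2p1:
  fixes d :: "complex^'n::finite" and \<theta> :: "'n \<Rightarrow> real" and lam :: real and D :: "'n cmat"
  assumes D: "D = diag_mat d" "invertible D"
    and \<theta>: "\<And>j. 0 \<le> \<theta> j \<and> \<theta> j < 2 * pi"
           "\<And>j. d $ j = exp (\<i> * of_real (\<theta> j)) * of_real (cmod (d $ j))"
    and lam: "0 < lam" "lam < 1"
  shows "aluthge lam ` similarity_orbit D \<subseteq> similarity_orbit D
    \<and> smooth_on_submanifold (similarity_orbit D) (aluthge lam)
    \<and> (\<exists>E :: 'n cmat \<Rightarrow> 'n cmat set.
        (\<forall>N \<in> unitary_orbit D.
            subspace (E N) \<and> E N \<subseteq> tangent_similarity_orbit N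
          \<and> is_direct_sum (tangent_similarity_orbit N) (E N) (tangent_unitary_orbit N)
          \<and> aluthge_tangent_map lam D N ` E N \<subseteq> E N
          \<and> aluthge_tangent_map lam D N ` tangent_unitary_orbit N \<subseteq> tangent_unitary_orbit N
          \<and> onorm_on (E N) (aluthge_tangent_map lam D N) \<le> contraction_const d \<theta> lam
          \<and> contraction_const d \<theta> lam < 1
          \<and> (\<forall>U. cunitary U \<and> N = U ** D ** cadjoint U
                \<longrightarrow> E N = (\<lambda>X. U ** X ** cadjoint U) ` E D))
      \<and> smooth_on_submanifold
          {(N, X). N \<in> unitary_orbit D \<and> X \<in> tangent_similarity_orbit N}
          (\<lambda>(N, X). proj_parallel (E N) (tangent_unitary_orbit N) X))"
proof -
  have d: "d $ i \<noteq> 0" for i using D by (simp add: invertible_diag_mat)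
  note const = contraction_const_properties[OF \<theta> d lam]
  \<comment> \<open>The strict bound enters here: it keeps the denominators of the stable
    coefficients away from 0.\<close>
  have eig: "aluthge_eigenvalue lam (d $ i) (d $ j) \<noteq> 1" if "d $ i \<noteq> d $ j" for i j
    using const(3)[OF that] const(2) by auto
  \<comment> \<open>The list depends on \<open>D\<close> alone, so \<open>?P N\<close> and
    \<open>?E N\<close> are functions of \<open>N\<close>; the equivariance then holds for every
    unitary that carries \<open>D\<close> to \<open>N\<close>.\<close>
  obtain vs where vs: "range (($) d) = set vs" using finite_list[of "range (($) d)"] by auto
  let ?V = tangent_similarity_orbit and ?F = tangent_unitary_orbit
  let ?P = "stable_proj lam vs" and ?Pd = "stable_proj_diag lam d"
  let ?E = "\<lambda>N. ?P N ` ?V N"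
  have V: "?V (uconj U D) = uconj U ` ?V D" and F: "?F (uconj U D) = uconj U ` ?F D"
    and P: "?P (uconj U D) (uconj U X) = uconj U (?Pd X)" if "cunitary U" for U X
    using that by (simp_all add: tangent_similarity_orbit_uconj tangent_unitary_orbit_uconj D stable_proj_uconj vs)
  have E: "?E (uconj U D) = uconj U ` ?Pd ` ?V D" if "cunitary U" for U
    unfolding V[OF that] by (simp add: image_image P that)
  have ED: "?E D = ?Pd ` ?V D" using E[OF cunitary_one] by (simp add: uconj_one image_image)
  have PdV: "?Pd X \<in> ?V D" for X unfolding D by (rule stable_proj_diag_tangent)
  have idem: "?Pd (?Pd X) = ?Pd X" for X by (rule stable_proj_diag_idem[OF d eig])
  have deriv: "aluthge_deriv lam d (?Pd X) $ i $ j = aluthge_eigenvalue lam (d $ i) (d $ j) * ?Pd X $ i $ j" for X i j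
    by (rule aluthge_deriv_stable[OF d eig])
  have FD: "?F D = {X \<in> ?V D. ?Pd X = 0}" unfolding D by (rule tangent_unitary_orbit_diag_eq_kernel[OF d eig])
  have orbit: "\<exists>U. cunitary U \<and> N = uconj U D" if "N \<in> unitary_orbit D" for N
    using that by (auto simp: unitary_orbit_def uconj_def)
  have PV: "?P N X \<in> ?V N" "?P N (?P N X) = ?P N X" if "N \<in> unitary_orbit D" "X \<in> ?V N" for N X
  proof -
    from orbit[OF that(1)] obtain U where U: "cunitary U" "N = uconj U D" by blast
    with that(2) obtain Y where Y: "X = uconj U Y" "Y \<in> ?V D" by (auto simp: V)
    show "?P N X \<in> ?V N" "?P N (?P N X) = ?P N X"
      using PdV by (simp_all add: U Y P V idem)
  qed
  have FN: "?F N = {X \<in> ?V N. ?P N X = 0}" if "N \<in> unitary_orbit D" for N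
  proof -
    from orbit[OF that(1)] obtain U where U: "cunitary U" "N = uconj U D" by blast
    \<comment> \<open>Conjugation by \<open>U\<close> preserves the norm, hence is
      injective.\<close>
    have zero: "?P N (uconj U Y) = 0 \<longleftrightarrow> ?Pd Y = 0" for Y
      unfolding U(2) P[OF U(1)] using norm_uconj[OF U(1), of "?Pd Y"] by (metis norm_eq_zero)
    have "?F N = uconj U ` {X \<in> ?V D. ?Pd X = 0}" unfolding U(2) F[OF U(1)] FD ..
    also have "\<dots> = {X \<in> uconj U ` ?V D. ?P N X = 0}" using zero by blast
    finally show ?thesis unfolding U(2) V[OF U(1)] .
  qed
  have sum: "is_direct_sum (?V N) (?E N) (?F N)" "X \<in> ?V N \<Longrightarrow> proj_parallel (?E N) (?F N) X = ?P N X"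
    if N: "N \<in> unitary_orbit D" for N X
  proof -
    note * = is_direct_sum_projection[where V = "?V N" and P = "?P N",
        OF linear_stable_proj subspace_tangent_similarity_orbit PV(1)[OF N] PV(2)[OF N]]
    show "is_direct_sum (?V N) (?E N) (?F N)" unfolding FN[OF N] by (rule *(1))
    show "X \<in> ?V N \<Longrightarrow> proj_parallel (?E N) (?F N) X = ?P N X" unfolding FN[OF N] by (rule *(2))
  qed
  have T: "aluthge_tangent_map lam D (uconj U D) (uconj U X) = uconj U (aluthge_deriv lam d X)"
    if "cunitary U" "X \<in> ?V D" for U X
  proof -
    have "uconj U D \<in> similarity_orbit D"
      using unitary_orbit_subset_similarity_orbit[of D] that(1) by (auto simp: unitary_orbit_def uconj_def)
    moreover have "uconj U X \<in> ?V (uconj U D)" using that by (simp add: V)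
    ultimately have "aluthge_tangent_map lam D (uconj U D) (uconj U X) =
        U ** aluthge_deriv lam d (cadjoint U ** uconj U X ** U) ** cadjoint U"
      unfolding aluthge_tangent_map_def
      using frechet_derivative_within_similarity_orbit[OF has_derivative_aluthge_unitary_conj[OF d that(1), of lam]]
      by (simp add: D uconj_def)
    then show ?thesis by (simp add: uconj_def matrix_mul_assoc[symmetric] cunitaryD[OF that(1)])
  qed
  have range: "aluthge lam ` similarity_orbit D \<subseteq> similarity_orbit D"
    using aluthge_similarity_orbit[OF D(2)] by blast
  have smooth: "smooth_on_submanifold (similarity_orbit D) (aluthge lam)"
    unfolding smooth_on_submanifold_def
  proof
    fix T assume "T \<in> similarity_orbit D"
    then obtain W where "T \<in> W" "smooth_on_open W (aluthge lam)"
      using aluthge_smooth_local[OF invertible_similarity_orbit[OF _ D(2)]] by metis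
    then show "\<exists>W g. T \<in> W \<and> smooth_on_open W g \<and> (\<forall>y\<in>similarity_orbit D \<inter> W. g y = aluthge lam y)"
      by blast
  qed
  have smooth_proj: "smooth_on_submanifold {(N, X). N \<in> unitary_orbit D \<and> X \<in> ?V N} (\<lambda>(N, X). proj_parallel (?E N) (?F N) X)"
    unfolding smooth_on_submanifold_def
  proof
    fix y
    have "(case z of (N, X) \<Rightarrow> ?P N X) = (case z of (N, X) \<Rightarrow> proj_parallel (?E N) (?F N) X)"
      if "z \<in> {(N, X). N \<in> unitary_orbit D \<and> X \<in> ?V N}" for z
      using that sum(2) by auto
    \<comment> \<open>\<open>?P\<close> is smooth on all pairs of matrices, so one extension on
      \<open>UNIV\<close> serves every point.\<close>
    then show "\<exists>W g. y \<in> W \<and> smooth_on_open W g \<and>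
        (\<forall>z\<in>{(N, X). N \<in> unitary_orbit D \<and> X \<in> ?V N} \<inter> W. g z = (case z of (N, X) \<Rightarrow> proj_parallel (?E N) (?F N) X))"
      using smooth_stable_proj[of lam vs] by (intro exI[of _ UNIV] exI[of _ "\<lambda>(N, X). ?P N X"]) auto
  qed
  have "\<forall>N \<in> unitary_orbit D.
            subspace (?E N) \<and> ?E N \<subseteq> ?V N
          \<and> is_direct_sum (?V N) (?E N) (?F N)
          \<and> aluthge_tangent_map lam D N ` ?E N \<subseteq> ?E N
          \<and> aluthge_tangent_map lam D N ` ?F N \<subseteq> ?F N
          \<and> onorm_on (?E N) (aluthge_tangent_map lam D N) \<le> contraction_const d \<theta> lam
          \<and> contraction_const d \<theta> lam < 1
          \<and> (\<forall>U. cunitary U \<and> N = U ** D ** cadjoint U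
                \<longrightarrow> ?E N = (\<lambda>X. U ** X ** cadjoint U) ` ?E D)"
  proof (intro ballI conjI allI impI)
    fix N assume N: "N \<in> unitary_orbit D"
    from orbit[OF N] obtain U where U: "cunitary U" "N = uconj U D" by blast
    show sub: "subspace (?E N)" by (rule linear_subspace_image[OF linear_stable_proj subspace_tangent_similarity_orbit])
    show "?E N \<subseteq> ?V N" using PV(1)[OF N] by blast
    show "is_direct_sum (?V N) (?E N) (?F N)" by (rule sum(1)[OF N])
    have EN: "\<exists>X. Z = uconj U (?Pd X) \<and> X \<in> ?V D" if "Z \<in> ?E N" for Z
      using that E[OF U(1)] by (auto simp: U(2))
    have TE: "aluthge_tangent_map lam D N (uconj U (?Pd X)) = uconj U (aluthge_deriv lam d (?Pd X))" for X
      unfolding U(2) by (rule T[OF U(1) PdV])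
    show "aluthge_tangent_map lam D N ` ?E N \<subseteq> ?E N"
    proof (intro image_subsetI)
      fix Z assume "Z \<in> ?E N"
      from EN[OF this] obtain X where X: "Z = uconj U (?Pd X)" by blast
      have eq: "?Pd (aluthge_deriv lam d (?Pd X)) = aluthge_deriv lam d (?Pd X)"
        by (rule stable_proj_diag_aluthge_deriv[OF d eig])
      then have "aluthge_deriv lam d (?Pd X) \<in> ?Pd ` ?V D" using PdV by (metis imageI)
      then show "aluthge_tangent_map lam D N Z \<in> ?E N"
        unfolding X TE unfolding U(2) E[OF U(1)] by (rule imageI)
    qed
    show "aluthge_tangent_map lam D N ` ?F N \<subseteq> ?F N"
    proof (intro image_subsetI)
      fix Z assume "Z \<in> ?F N"
      then obtain Y where Y: "Z = uconj U Y" "Y \<in> ?F D" by (auto simp: U(2) F[OF U(1)])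
      have "Y \<in> ?V D" "?Pd Y = 0" using Y(2) FD by auto
      \<comment> \<open>On the kernel of the projection, \<open>L = 1 + (mu - 1) P\<close> is the
        identity.\<close>
      then have "aluthge_deriv lam d Y = Y"
        using aluthge_deriv_stable_proj_diag[OF d eig, of Y] by (simp add: vec_eq_iff D)
      then have "aluthge_tangent_map lam D N Z = Z"
        using T[OF U(1) \<open>Y \<in> ?V D\<close>] by (simp add: Y(1) U(2))
      with \<open>Z \<in> ?F N\<close> show "aluthge_tangent_map lam D N Z \<in> ?F N" by simp
    qed
    show "onorm_on (?E N) (aluthge_tangent_map lam D N) \<le> contraction_const d \<theta> lam"
      unfolding onorm_on_def
    proof (rule cSUP_least)
      show "?E N \<noteq> {}" using subspace_0[OF sub] by blast
      fix Z assume "Z \<in> ?E N"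
      from EN[OF this] obtain X where X: "Z = uconj U (?Pd X)" by blast
      have "norm (aluthge_deriv lam d (?Pd X)) \<le> contraction_const d \<theta> lam * norm (?Pd X)"
      proof (rule norm_cmat_le[OF _ const(1)])
        fix i j
        show "cmod (aluthge_deriv lam d (?Pd X) $ i $ j) \<le> contraction_const d \<theta> lam * cmod (?Pd X $ i $ j)"
        \<comment> \<open>For \<open>d $ i = d $ j\<close> the eigenvalue is 1 and exceeds the
          constant, but there a tangent vector has entry 0.\<close>
        proof (cases "d $ i = d $ j")
          case True
          then have "?Pd X $ i $ j = 0" using PdV[of X] by (simp add: D tangent_similarity_orbit_diag_mat)
          then show ?thesis unfolding deriv by simp
        next
          case False
          show ?thesis
            unfolding deriv norm_mult by (intro mult_right_mono const(3)[OF False]) simp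
        qed
      qed
      \<comment> \<open>For \<open>Z = 0\<close> the quotient is 0 by convention, and the bound
        holds because the constant is nonnegative.\<close>
      then show "norm (aluthge_tangent_map lam D N Z) / norm Z \<le> contraction_const d \<theta> lam"
        unfolding X TE norm_uconj[OF U(1)] using const(1)
        by (cases "norm (?Pd X) = 0") (simp_all add: pos_divide_le_eq)
    qed
    show "contraction_const d \<theta> lam < 1" by (rule const(2))
    fix U' assume U': "cunitary U' \<and> N = U' ** D ** cadjoint U'"
    then have "?E N = uconj U' ` ?E D" using E[of U'] by (simp add: uconj_def[symmetric] ED)
    then show "?E N = (\<lambda>X. U' ** X ** cadjoint U') ` ?E D" by (simp add: uconj_def)
  qed
  then show ?thesis
    by (intro conjI range smooth exI[of _ ?E] smooth_proj)
qed

end
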